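(* Let $X$ and $Y$ be a pair of commuting vector fields defined on a complex manifold $M$. (i) Assume that $X$ and $Y$ are holomorphic, with $X$ $\mathbb{C}$-complete and $Y$ semicomplete on $M$. Then the Lie algebra formed by $X$ and $Y$ is univalent on $M$. (ii) Assume that $X$ and $Y$ are real vector fields which are, respectively, the real and the imaginary parts of a holomorphic vector field $Z$ on $M$. If $X$ is $\mathbb{R}$-complete, then $Z$ is semicomplete on $M$.
   Context: A holomorphic vector field is $\mathbb{C}$-complete if its flow is defined for all complex times; a real vector field is $\mathbb{R}$-complete if its flow is defined for all real times. A holomorphic vector field $Z$ on $M$ is semicomplete if for every $p\in M$ there is an integral curve $\phi:V_p\subset\mathbb{C}\to M$ of $Z$ such that (A) $\phi(0)=p$ and $\phi'(T)=Z(\phi(T))$ for every $T\in V_p$; (B) whenever $\{T_i\}\subset V_p$ converges to a point of the boundary of $V_p$ in $\mathbb{C}$, the sequence $\phi(T_i)$ leaves every compact subset of $M$. Equivalently, the one-dimensional complex Lie algebra generated by $Z$ integrates to a maximal local action of $\mathbb{C}$. In (ii), the real and imaginary parts $X$ and $Y$ of $Z$ are the real vector fields on $M$ induced respectively by the restriction of the local complex flow of $Z$ to real time and by its restriction to purely imaginary time. Let $G$ be a complex Lie group with identity $e$. A local $G$-action on $M$ is a holomorphic map $\Phi:\Omega\subset G\times M\to M$, where $\Omega$ is a connected open set containing $\{e\}\times M$, with $\Phi(e,p)=p$ for all $p$, and $\Phi(g_1g_2,p)=\Phi(g_1,\Phi(g_2,p))$ whenever both sides are defined. It is maximal if, with $V_p=\{g\in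 G:(g,p)\in\Omega\}$, for every $p\in M$ and every sequence $\{g_i\}\subset V_p$ converging to a boundary point of $V_p$ in $G$, the sequence $\Phi(g_i,p)$ leaves every compact subset of $M$. A finite-dimensional Lie algebra of holomorphic vector fields on $M$ is univalent if it integrates to a maximal local action of a corresponding Lie group; for the abelian Lie algebra formed by $X$ and $Y$ in (i) this group is $\mathbb{C}^2$.
   Formalization: In (i), M is additionally assumed connected: a local action has a connected domain Ω containing {e}×M, so none exists on a disconnected M (e.g. two disjoint copies of C with X=Y=0), and (i) fails there. *)

theory Defs
  imports "HOL-Analysis.Analysis"
begin

text \<open>
  A chart is a pair of its domain and its coordinate map; the coordinate map is a total function
  whose values outside the domain are irrelevant.  A complex manifold of dimension
  \<open>CARD('n)\<close> is given by an atlas; its set of points is the union of the chart domains,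
  an open subset of the ambient Hausdorff, second countable space.
\<close>

type_synonym ('m, 'n) chart = "'m set \<times> ('m \<Rightarrow> (complex, 'n) vec)"

definition points :: "('m, 'n::finite) chart set \<Rightarrow> 'm set"
  where "points A = (\<Union>c\<in>A. fst c)"

abbreviation chart_inv :: "('m, 'n::finite) chart \<Rightarrow> complex ^ 'n \<Rightarrow> 'm"
  where "chart_inv c \<equiv> inv_into (fst c) (snd c)"

text \<open>Holomorphy in several variables: complex linearity of the Frechet derivative.\<close>

definition holomorphic_map_on ::
    "(complex ^ 'a) set \<Rightarrow> (complex ^ 'a \<Rightarrow> complex ^ 'b) \<Rightarrow> bool"
  where "holomorphic_map_on S f \<longleftrightarrow> open S \<and>
    (\<forall>x\<in>S. \<exists>D. (f has_derivative D) (at x) \<and> (\<forall>a v. D (a *s v) = a *s D v))"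

definition complex_manifold ::
    "('m::{t2_space, second_countable_topology}, 'n::finite) chart set \<Rightarrow> bool"
  where "complex_manifold A \<longleftrightarrow>
    (\<forall>c\<in>A. open (fst c) \<and> open (snd c ` fst c) \<and>
       homeomorphism (fst c) (snd c ` fst c) (snd c) (chart_inv c)) \<and>
    (\<forall>c\<in>A. \<forall>d\<in>A. holomorphic_map_on (snd c ` (fst c \<inter> fst d)) (snd d \<circ> chart_inv c))"

definition leaves_compacts ::
    "('m::topological_space, 'n::finite) chart set \<Rightarrow> (nat \<Rightarrow> 'm) \<Rightarrow> bool"
  where "leaves_compacts A x \<longleftrightarrow>
    (\<forall>K. compact K \<and> K \<subseteq> points A \<longrightarrow> (\<forall>\<^sub>F i in sequentially. x i \<notin> K))"

text \<open>
  A tangent vector at \<open>p\<close> is a family of coordinate vectors, one for each chart around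
  \<open>p\<close>, related by the differentials of the transition maps; a vector field assigns to a
  chart and a point of its domain the coordinates of the vector at that point.  The same
  representation serves for real vector fields: the real tangent space at \<open>p\<close> is read in a
  chart as the real vector space underlying \<open>complex ^ 'n\<close>.
\<close>

type_synonym ('m, 'n) vfield = "('m, 'n) chart \<Rightarrow> 'm \<Rightarrow> (complex, 'n) vec"

definition tangent_field :: "('m, 'n::finite) chart set \<Rightarrow> ('m, 'n) vfield \<Rightarrow> bool"
  where "tangent_field A X \<longleftrightarrow>
    (\<forall>c\<in>A. \<forall>d\<in>A. \<forall>p\<in>fst c \<inter> fst d.
       X d p = frechet_derivative (snd d \<circ> chart_inv c) (at (snd c p)) (X c p))"

definition local_rep ::
    "('m, 'n::finite) vfield \<Rightarrow> ('m, 'n) chart \<Rightarrow> complex ^ 'n \<Rightarrow> complex ^ 'n"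
  where "local_rep X c = (\<lambda>z. X c (chart_inv c z))"

definition holomorphic_vector_field ::
    "('m, 'n::finite) chart set \<Rightarrow> ('m, 'n) vfield \<Rightarrow> bool"
  where "holomorphic_vector_field A X \<longleftrightarrow> tangent_field A X \<and>
    (\<forall>c\<in>A. holomorphic_map_on (snd c ` fst c) (local_rep X c))"

text \<open>
  Infinite real differentiability on an open set: the map is differentiable and all of its
  directional derivatives are again infinitely differentiable.
\<close>

coinductive smooth_map_on ::
    "'a::real_normed_vector set \<Rightarrow> ('a \<Rightarrow> 'b::real_normed_vector) \<Rightarrow> bool"
  for S :: "'a set"
  where "\<lbrakk>open S; \<forall>x\<in>S. (f has_derivative D x) (at x); \<forall>v. smooth_map_on S (\<lambda>x. D x v)\<rbrakk>
    \<Longrightarrow> smooth_map_on S f"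

definition real_vector_field ::
    "('m, 'n::finite) chart set \<Rightarrow> ('m, 'n) vfield \<Rightarrow> bool"
  where "real_vector_field A X \<longleftrightarrow> tangent_field A X \<and>
    (\<forall>c\<in>A. smooth_map_on (snd c ` fst c) (local_rep X c))"

text \<open>
  The coordinate formula for the Lie bracket uses real differentials; for holomorphic vector
  fields these are the complex ones.
\<close>

definition lie_bracket ::
    "('m, 'n::finite) vfield \<Rightarrow> ('m, 'n) vfield \<Rightarrow> ('m, 'n) vfield"
  where "lie_bracket X Y c p =
    frechet_derivative (local_rep Y c) (at (snd c p)) (X c p) -
    frechet_derivative (local_rep X c) (at (snd c p)) (Y c p)"

definition commuting ::
    "('m, 'n::finite) chart set \<Rightarrow> ('m, 'n) vfield \<Rightarrow> ('m, 'n) vfield \<Rightarrow> bool"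
  where "commuting A X Y \<longleftrightarrow> (\<forall>c\<in>A. \<forall>p\<in>fst c. lie_bracket X Y c p = 0)"

text \<open>
  Continuity of the curve is required explicitly: it guarantees that the curve stays in the
  domain of a chart for nearby times, so that its coordinate expression is meaningful.
  Connectedness of \<open>V\<close> does not affect semicompleteness: one may always pass to the
  component of \<open>0\<close>, whose frontier is contained in that of \<open>V\<close>.
\<close>

definition integral_curve ::
    "('m::topological_space, 'n::finite) chart set \<Rightarrow> ('m, 'n) vfield \<Rightarrow>
     complex set \<Rightarrow> (complex \<Rightarrow> 'm) \<Rightarrow> bool"
  where "integral_curve A Z V \<phi> \<longleftrightarrow>
    open V \<and> connected V \<and> continuous_on V \<phi> \<and> \<phi> ` V \<subseteq> points A \<and>
    (\<forall>T\<in>V. \<forall>c\<in>A. \<phi> T \<in> fst c \<longrightarrow>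
       ((\<lambda>s. snd c (\<phi> s)) has_derivative (\<lambda>h. h *s Z c (\<phi> T))) (at T))"

definition real_integral_curve ::
    "('m::topological_space, 'n::finite) chart set \<Rightarrow> ('m, 'n) vfield \<Rightarrow>
     real set \<Rightarrow> (real \<Rightarrow> 'm) \<Rightarrow> bool"
  where "real_integral_curve A X I \<gamma> \<longleftrightarrow>
    open I \<and> continuous_on I \<gamma> \<and> \<gamma> ` I \<subseteq> points A \<and>
    (\<forall>t\<in>I. \<forall>c\<in>A. \<gamma> t \<in> fst c \<longrightarrow>
       ((\<lambda>s. snd c (\<gamma> s)) has_vector_derivative X c (\<gamma> t)) (at t))"

definition complex_complete ::
    "('m::topological_space, 'n::finite) chart set \<Rightarrow> ('m, 'n) vfield \<Rightarrow> bool"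
  where "complex_complete A X \<longleftrightarrow>
    (\<forall>p\<in>points A. \<exists>\<phi>. integral_curve A X UNIV \<phi> \<and> \<phi> 0 = p)"

definition real_complete ::
    "('m::topological_space, 'n::finite) chart set \<Rightarrow> ('m, 'n) vfield \<Rightarrow> bool"
  where "real_complete A X \<longleftrightarrow>
    (\<forall>p\<in>points A. \<exists>\<gamma>. real_integral_curve A X UNIV \<gamma> \<and> \<gamma> 0 = p)"

definition semicomplete ::
    "('m::topological_space, 'n::finite) chart set \<Rightarrow> ('m, 'n) vfield \<Rightarrow> bool"
  where "semicomplete A Z \<longleftrightarrow>
    (\<forall>p\<in>points A. \<exists>V \<phi>. 0 \<in> V \<and> \<phi> 0 = p \<and> integral_curve A Z V \<phi> \<and>
       (\<forall>T a. (\<forall>i. T i \<in> V) \<and> T \<longlonglongrightarrow> a \<and> a \<in> frontier V \<longrightarrow>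
          leaves_compacts A (\<lambda>i. \<phi> (T i))))"

text \<open>
  \<open>X\<close> is induced by the local complex flow of \<open>Z\<close> restricted to the times
  \<open>t * e\<close> with \<open>t\<close> real.
\<close>

definition induced_by_flow ::
    "('m::topological_space, 'n::finite) chart set \<Rightarrow> ('m, 'n) vfield \<Rightarrow>
     complex \<Rightarrow> ('m, 'n) vfield \<Rightarrow> bool"
  where "induced_by_flow A Z e X \<longleftrightarrow>
    (\<forall>p\<in>points A. \<exists>V \<phi>. 0 \<in> V \<and> \<phi> 0 = p \<and> integral_curve A Z V \<phi> \<and>
       real_integral_curve A X {t. of_real t * e \<in> V} (\<lambda>t. \<phi> (of_real t * e)))"

definition real_part_of ::
    "('m::topological_space, 'n::finite) chart set \<Rightarrow> ('m, 'n) vfield \<Rightarrow> ('m, 'n) vfield \<Rightarrow> bool"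
  where "real_part_of A Z X \<longleftrightarrow> real_vector_field A X \<and> induced_by_flow A Z 1 X"

definition imaginary_part_of ::
    "('m::topological_space, 'n::finite) chart set \<Rightarrow> ('m, 'n) vfield \<Rightarrow> ('m, 'n) vfield \<Rightarrow> bool"
  where "imaginary_part_of A Z Y \<longleftrightarrow> real_vector_field A Y \<and> induced_by_flow A Z \<i> Y"

text \<open>
  Local actions of the additive complex Lie group \<open>complex ^ 'k\<close>.  Holomorphy on the
  product of the group and the manifold is expressed in the product charts.  Connectedness of
  the domain forces the manifold to be connected as soon as a local action exists.
\<close>

definition local_action ::
    "('m::topological_space, 'n::finite) chart set \<Rightarrow>
     ((complex ^ 'k) \<times> 'm) set \<Rightarrow> ((complex ^ 'k) \<times> 'm \<Rightarrow> 'm) \<Rightarrow> bool"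
  where "local_action A \<Omega> \<Phi> \<longleftrightarrow>
    open \<Omega> \<and> connected \<Omega> \<and> {0} \<times> points A \<subseteq> \<Omega> \<and> \<Omega> \<subseteq> UNIV \<times> points A \<and>
    \<Phi> ` \<Omega> \<subseteq> points A \<and> continuous_on \<Omega> \<Phi> \<and>
    (\<forall>g p. (g, p) \<in> \<Omega> \<longrightarrow> (\<forall>c\<in>A. \<forall>d\<in>A. p \<in> fst c \<and> \<Phi> (g, p) \<in> fst d \<longrightarrow>
       (\<exists>D. ((\<lambda>(h, z). snd d (\<Phi> (h, chart_inv c z))) has_derivative D) (at (g, snd c p)) \<and>
            (\<forall>a u v. D (a *s u, a *s v) = a *s D (u, v))))) \<and>
    (\<forall>p\<in>points A. \<Phi> (0, p) = p) \<and>
    (\<forall>g h p. (g + h, p) \<in> \<Omega> \<and> (h, p) \<in> \<Omega> \<and> (g, \<Phi> (h, p)) \<in> \<Omega> \<longrightarrow>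
       \<Phi> (g + h, p) = \<Phi> (g, \<Phi> (h, p)))"

definition maximal_local_action ::
    "('m::topological_space, 'n::finite) chart set \<Rightarrow>
     ((complex ^ 'k) \<times> 'm) set \<Rightarrow> ((complex ^ 'k) \<times> 'm \<Rightarrow> 'm) \<Rightarrow> bool"
  where "maximal_local_action A \<Omega> \<Phi> \<longleftrightarrow> local_action A \<Omega> \<Phi> \<and>
    (\<forall>p\<in>points A. \<forall>g a.
       (\<forall>i. (g i, p) \<in> \<Omega>) \<and> g \<longlonglongrightarrow> a \<and> a \<in> frontier {h. (h, p) \<in> \<Omega>} \<longrightarrow>
       leaves_compacts A (\<lambda>i. \<Phi> (g i, p)))"

text \<open>
  The abelian Lie algebra formed by commuting \<open>X\<close> and \<open>Y\<close> integrates to an action of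
  \<open>complex ^ 2\<close> whose infinitesimal generator in the direction \<open>v\<close> is
  \<open>v\<^sub>1 X + v\<^sub>2 Y\<close>.
\<close>

definition integrates_to ::
    "('m::topological_space, 'n::finite) chart set \<Rightarrow> ('m, 'n) vfield \<Rightarrow> ('m, 'n) vfield \<Rightarrow>
     ((complex ^ 2) \<times> 'm \<Rightarrow> 'm) \<Rightarrow> bool"
  where "integrates_to A X Y \<Phi> \<longleftrightarrow>
    (\<forall>p\<in>points A. \<forall>c\<in>A. p \<in> fst c \<longrightarrow>
       ((\<lambda>g. snd c (\<Phi> (g, p))) has_derivative (\<lambda>v. v $ 1 *s X c p + v $ 2 *s Y c p)) (at 0))"

definition univalent ::
    "('m::topological_space, 'n::finite) chart set \<Rightarrow> ('m, 'n) vfield \<Rightarrow> ('m, 'n) vfield \<Rightarrow> bool"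
  where "univalent A X Y \<longleftrightarrow>
    (\<exists>\<Omega> \<Phi>. maximal_local_action A \<Omega> \<Phi> \<and> integrates_to A X Y \<Phi>)"

end

theory Submission
  imports Defs "HOL-Complex_Analysis.Cauchy_Integral_Formula"
begin

text \<open>
  Both parts come from one principle.  Let \<open>X\<close> and \<open>Y\<close> be commuting holomorphic fields,
  and let \<open>L1\<close>, \<open>L2\<close> be real linear maps assigning to a time the combination
  \<open>v\<^sub>1 X + v\<^sub>2 Y\<close> that is to be followed.  Suppose that the \<open>L1\<close>-solution
  \<open>x p\<close> from every point \<open>p\<close> exists for all times, and let \<open>\<psi>\<close> be an
  \<open>L2\<close>-solution on \<open>V\<close>.  Then \<open>(s, t) \<mapsto> x (\<psi> t) s\<close> solves the combined system on
  \<open>UNIV \<times> V\<close> (\<open>product_sol\<close>), and it escapes every compact set at the boundary as soon as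
  \<open>\<psi>\<close> does (\<open>product_escapes\<close>): if it did not, a combined solution of a definite size
  would exist near the accumulation point, and transporting it back with the complete
  \<open>L1\<close>-flow would extend \<open>\<psi>\<close> across the boundary of \<open>V\<close>.

  In part (i), \<open>L1\<close> and \<open>L2\<close> are the complex times of \<open>X\<close> and of \<open>Y\<close>, so every
  point carries a maximal solution of the two-parameter system; these solutions
  fit together to a maximal local action (\<open>univalent_of_maximal_solutions\<close>).  In part (ii)
  the principle is applied to the pair \<open>Z, 0\<close>, which commutes trivially: \<open>L1\<close> is real time
  and \<open>L2\<close> imaginary time of \<open>Z\<close>.  Imaginary time is one real parameter, so a maximal
  solution on an interval \<open>J\<close> exists without further hypotheses (\<open>maximal_real_sol\<close>), and
  \<open>Z\<close> acquires a maximal integral curve on the strip of times with imaginary part in \<open>J\<close>.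

  The only analytic input is the local flow of a commuting pair (\<open>local_flow\<close>), as a
  map \<open>u (h, z)\<close> that is jointly holomorphic in the two complex times \<open>h\<close> and the initial
  point \<open>z\<close>.  It is the fixed point of
  \<open>u (h, z) = z + (integral over 0 \<le> \<tau> \<le> 1 of F h (u (\<tau> h, z)))\<close> with \<open>F h = h\<^sub>1 X + h\<^sub>2 Y\<close>; the
  Picard iterates are holomorphic, and holomorphy passes to their uniform limit by the
  Cauchy inequality.  That \<open>u\<close> satisfies the equation in every time direction, and not
  only along rays, is the one place where the vanishing of the Lie bracket enters.
  Everything after that is continuation by local existence and uniqueness.
\<close>

section \<open>Holomorphic maps of several variables\<close>

lemma norm_vector_smult: "norm (a *s x) = norm a * norm (x :: complex ^ 'n::finite)"
  by (simp add: norm_vec_def L2_set_def norm_mult power_mult_distrib sum_distrib_left[symmetric]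
        real_sqrt_mult)

lemma of_real_vector_smult: "complex_of_real r *s x = r *\<^sub>R (x :: complex ^ 'n::finite)"
  unfolding vec_eq_iff vector_smult_component vector_scaleR_component
  by (simp add: scaleR_conv_of_real)

lemma bounded_bilinear_vector_smult:
  "bounded_bilinear (\<lambda>a (x :: complex ^ 'n::finite). a *s x)"
proof
  fix a b :: complex and r :: real and x y :: "complex ^ 'n"
  show "(a + b) *s x = a *s x + b *s x" by (simp add: vec_eq_iff algebra_simps)
  show "a *s (x + y) = a *s x + a *s y" by (simp add: vec_eq_iff algebra_simps)
  show "(r *\<^sub>R a) *s x = r *\<^sub>R (a *s x)" by (simp add: vec_eq_iff algebra_simps)
  show "a *s (r *\<^sub>R x) = r *\<^sub>R (a *s x)" by (simp add: vec_eq_iff algebra_simps)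
  show "\<exists>K. \<forall>a (x :: complex ^ 'n). norm (a *s x) \<le> norm a * norm x * K"
    by (rule exI[of _ 1]) (simp add: norm_vector_smult)
qed

lemmas has_derivative_vector_smult [derivative_intros] =
  bounded_bilinear.FDERIV[OF bounded_bilinear_vector_smult]
lemmas continuous_on_vector_smult [continuous_intros] =
  bounded_bilinear.continuous_on[OF bounded_bilinear_vector_smult]
lemmas vector_smult_add_left = bounded_bilinear.add_left[OF bounded_bilinear_vector_smult]
lemmas vector_smult_add_right = bounded_bilinear.add_right[OF bounded_bilinear_vector_smult]
lemmas vector_smult_diff_right = bounded_bilinear.diff_right[OF bounded_bilinear_vector_smult]
lemmas vector_smult_scaleR_left = bounded_bilinear.scaleR_left[OF bounded_bilinear_vector_smult]
lemmas vector_smult_scaleR_right = bounded_bilinear.scaleR_right[OF bounded_bilinear_vector_smult]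

lemma norm_vec_le_card:
  fixes x :: "complex ^ 'n::finite"
  assumes "\<And>i. norm (x $ i) \<le> b"
  shows "norm x \<le> real CARD('n) * b"
proof -
  have "norm x \<le> (\<Sum>i\<in>UNIV. norm (x $ i))"
    unfolding norm_vec_def by (rule L2_set_le_sum) simp
  also have "\<dots> \<le> (\<Sum>i\<in>(UNIV :: 'n set). b)" by (rule sum_mono) (rule assms)
  finally show ?thesis by simp
qed

text \<open>
  Holomorphic maps are needed on \<open>\<complex>\<^sup>n\<close> and on products \<open>\<complex>\<^sup>2 \<times> \<complex>\<^sup>n\<close> of times and
  initial points.  Only the scalar multiplication by complex numbers differs between the two,
  so it is made a parameter.
\<close>

locale complex_scaling =
  fixes sc :: "complex \<Rightarrow> 'a \<Rightarrow> 'a::euclidean_space"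
  assumes sc_add_left: "sc (a + b) x = sc a x + sc b x"
    and sc_of_real: "sc (of_real r) x = r *\<^sub>R x"
    and sc_sc: "sc a (sc b x) = sc (a * b) x"
    and norm_sc: "norm (sc a x) = norm a * norm x"
begin

definition holo :: "'a set \<Rightarrow> ('a \<Rightarrow> complex ^ 'n) \<Rightarrow> bool"
  where "holo S f \<longleftrightarrow> open S \<and>
    (\<forall>x\<in>S. \<exists>D. (f has_derivative D) (at x) \<and> (\<forall>a v. D (sc a v) = a *s D v))"

lemma sc_bounded_linear: "bounded_linear (\<lambda>a. sc a x)"
proof
  show "sc (a + b) x = sc a x + sc b x" for a b by (rule sc_add_left)
  show "sc (r *\<^sub>R a) x = r *\<^sub>R sc a x" for r a
    by (simp add: scaleR_conv_of_real sc_sc[symmetric] sc_of_real)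
  show "\<exists>K. \<forall>a. norm (sc a x) \<le> norm a * K" by (auto simp: norm_sc)
qed

lemma holo_open: "holo S f \<Longrightarrow> open S"
  by (simp add: holo_def)

lemma holo_subset: "holo S f \<Longrightarrow> open T \<Longrightarrow> T \<subseteq> S \<Longrightarrow> holo T f"
  by (auto simp: holo_def)

lemma holo_continuous_on: "holo S f \<Longrightarrow> continuous_on S f"
  unfolding holo_def by (meson continuous_at_imp_continuous_on has_derivative_continuous)

lemma holo_cong: "holo S f \<Longrightarrow> (\<And>x. x \<in> S \<Longrightarrow> f x = g x) \<Longrightarrow> holo S g"
  unfolding holo_def by (metis has_derivative_transform_within_open)

lemma holo_frechet:
  assumes "holo S f" "x \<in> S"
  shows "(f has_derivative frechet_derivative f (at x)) (at x)"
    and "frechet_derivative f (at x) (sc a v) = a *s frechet_derivative f (at x) v"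
proof -
  obtain D where D: "(f has_derivative D) (at x)" "\<forall>a v. D (sc a v) = a *s D v"
    using assms by (auto simp: holo_def)
  with frechet_derivative_at[OF D(1)]
  show "(f has_derivative frechet_derivative f (at x)) (at x)"
    "frechet_derivative f (at x) (sc a v) = a *s frechet_derivative f (at x) v" by simp_all
qed

lemma holo_derivative_scale:
  assumes "holo S f" "x \<in> S" "(f has_derivative D) (at x)"
  shows "D (sc a v) = a *s D v"
  using holo_frechet[OF assms(1,2)] frechet_derivative_at[OF assms(3)] by simp

lemma holo_const: "open S \<Longrightarrow> holo S (\<lambda>x. c)"
  unfolding holo_def by (auto intro!: exI[of _ "\<lambda>v. 0"])

lemma holo_add: "holo S f \<Longrightarrow> holo S g \<Longrightarrow> holo S (\<lambda>x. f x + g x)"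
  unfolding holo_def
  by (auto, metis (mono_tags, lifting) has_derivative_add vector_smult_add_right)

lemma holo_diff: "holo S f \<Longrightarrow> holo S g \<Longrightarrow> holo S (\<lambda>x. f x - g x)"
  unfolding holo_def
  by (auto, metis (mono_tags, lifting) has_derivative_diff vector_smult_diff_right)

lemma holo_translate:
  assumes "holo S f"
  shows "holo ((\<lambda>x. x + y) -` S) (\<lambda>x. f (x + y))"
  unfolding holo_def
proof (intro conjI ballI)
  show "open ((\<lambda>x. x + y) -` S)"
    by (intro open_vimage holo_open[OF assms] continuous_intros)
  fix x assume "x \<in> (\<lambda>x. x + y) -` S"
  then obtain D where D: "(f has_derivative D) (at (x + y))" "\<forall>a v. D (sc a v) = a *s D v"
    using assms by (auto simp: holo_def)
  have "((\<lambda>x. f (x + y)) has_derivative (\<lambda>v. D (v + 0))) (at x)"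
    by (rule has_derivative_compose[where f = "\<lambda>x. x + y"]) (auto intro!: derivative_eq_intros D)
  with D(2) show "\<exists>D. ((\<lambda>x. f (x + y)) has_derivative D) (at x) \<and> (\<forall>a v. D (sc a v) = a *s D v)"
    by auto
qed

text \<open>
  The one variable Cauchy inequality, applied to each coordinate on the complex line through
  \<open>x\<close> in direction \<open>v\<close>.  All compactness of holomorphic maps used below comes from it.
\<close>

lemma cauchy_bound:
  fixes f :: "'a \<Rightarrow> complex ^ 'n::finite"
  assumes f: "holo (ball x \<rho>) f" and \<rho>: "0 < \<rho>"
    and M: "\<And>y. y \<in> ball x \<rho> \<Longrightarrow> norm (f y) \<le> M"
    and D: "(f has_derivative D) (at x)"
  shows "norm (D v) \<le> real CARD('n) * (2 * M / \<rho>) * norm v"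
proof (cases "v = 0")
  case True
  then show ?thesis using has_derivative_bounded_linear[OF D]
    by (simp add: linear_simps)
next
  case False
  \<comment> \<open>On the closed disc of this radius the line stays strictly inside the ball.\<close>
  define r where "r = \<rho> / (2 * norm v)"
  have r: "0 < r" using False \<rho> by (simp add: r_def)
  have inb: "x + sc \<zeta> v \<in> ball x \<rho>" if "norm \<zeta> \<le> r" for \<zeta>
  proof -
    have "norm \<zeta> * norm v \<le> r * norm v" using that by (simp add: mult_right_mono)
    also have "\<dots> < \<rho>" using False \<rho> by (simp add: r_def)
    finally show ?thesis by (simp add: dist_norm norm_sc)
  qed
  have "norm (D v $ j) \<le> 2 * M / \<rho> * norm v" for j
  proof -
    define g where "g = (\<lambda>\<zeta>. f (x + sc \<zeta> v) $ j)"
    have der: "(g has_field_derivative (E v $ j)) (at \<zeta>)"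
      if E: "(f has_derivative E) (at (x + sc \<zeta> v))" and z: "norm \<zeta> \<le> r" for \<zeta> E
    proof -
      have "((\<lambda>\<zeta>. x + sc \<zeta> v) has_derivative (\<lambda>h. 0 + sc h v)) (at \<zeta>)"
        by (intro derivative_intros bounded_linear.has_derivative[OF sc_bounded_linear])
      from has_derivative_compose[OF this E]
      have "(g has_derivative (\<lambda>h. E (0 + sc h v) $ j)) (at \<zeta>)"
        unfolding g_def
        by (rule bounded_linear.has_derivative[OF bounded_linear_vec_nth])
      moreover have "E (0 + sc h v) $ j = E v $ j * h" for h
        using holo_derivative_scale[OF f inb[OF z] E, of h v] by simp
      ultimately show ?thesis by (simp add: has_field_derivative_def)
    qed
    have der': "\<exists>d. (g has_field_derivative d) (at \<zeta>)" if "norm \<zeta> \<le> r" for \<zeta>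
      using holo_frechet(1)[OF f inb[OF that]] der that by blast
    have "norm ((deriv ^^ 1) g 0) \<le> fact 1 * M / r ^ 1"
    proof (rule Cauchy_inequality)
      show "g holomorphic_on ball 0 r"
        unfolding holomorphic_on_def field_differentiable_def
        using der' by (metis has_field_derivative_at_within less_imp_le mem_ball_0)
      show "continuous_on (cball 0 r) g"
        using der' by (intro continuous_at_imp_continuous_on ballI) (metis DERIV_isCont mem_cball_0)
      show "norm (g \<zeta>) \<le> M" if "cmod (0 - \<zeta>) = r" for \<zeta>
      proof -
        have "norm (g \<zeta>) \<le> norm (f (x + sc \<zeta> v))" unfolding g_def by (rule Finite_Cartesian_Product.norm_nth_le)
        also have "\<dots> \<le> M" by (rule M, rule inb) (use that in simp)
        finally show ?thesis .
      qed
    qed (rule r)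
    moreover have "deriv g 0 = D v $ j"
    proof (rule DERIV_imp_deriv, rule der)
      show "(f has_derivative D) (at (x + sc 0 v))" using D sc_of_real[of 0 v] by simp
    qed (use r in simp)
    ultimately have "norm (D v $ j) \<le> M / r" by simp
    also have "\<dots> = 2 * M / \<rho> * norm v" using False by (simp add: r_def)
    finally show ?thesis .
  qed
  then have "norm (D v) \<le> real CARD('n) * (2 * M / \<rho> * norm v)" by (rule norm_vec_le_card)
  then show ?thesis by (simp add: mult.assoc)
qed


text \<open>
  The Cauchy bound for the differences \<open>f k - f l\<close> makes the derivatives uniformly Cauchy
  near every point, so that the limit may be differentiated termwise.
\<close>

lemma holo_uniform_limit:
  fixes f :: "nat \<Rightarrow> 'a \<Rightarrow> complex ^ 'n::finite"
  assumes S: "open S" and f: "\<And>k. holo S (f k)" and lim: "uniform_limit S f g sequentially"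
  shows "holo S g"
  unfolding holo_def
proof (intro conjI ballI)
  fix x0 assume "x0 \<in> S"
  with S obtain \<rho> where \<rho>: "0 < \<rho>" "ball x0 (2 * \<rho>) \<subseteq> S"
    by (metis openE mult.commute field_sum_of_halves half_gt_zero mult_2_right)
  define D where "D k x = frechet_derivative (f k) (at x)" for k x
  have sub: "ball x \<rho> \<subseteq> S" if "x \<in> ball x0 \<rho>" for x
    using that by (intro order_trans[OF _ \<rho>(2)])
      (simp add: ball_subset_ball_iff dist_commute)
  have derf: "(f k has_derivative D k x) (at x)" "D k x (sc a v) = a *s D k x v"
    if "x \<in> ball x0 \<rho>" for k x a v
    using holo_frechet[OF f] sub[OF that] \<rho>(1) unfolding D_def
    by (metis centre_in_ball subsetD)+
  define C where "C = real CARD('n) * (2 / \<rho>)"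
  have C: "0 < C" using \<rho>(1) by (simp add: C_def)
  have diff: "norm (D k x v - D l x v) \<le> C * e * norm v"
    if "x \<in> ball x0 \<rho>" "\<forall>y\<in>S. norm (f k y - f l y) \<le> e" for k l x v e
  proof -
    have "norm (D k x v - D l x v) \<le> real CARD('n) * (2 * e / \<rho>) * norm v"
    proof (rule cauchy_bound)
      show "holo (ball x \<rho>) (\<lambda>y. f k y - f l y)"
        by (rule holo_subset[OF holo_diff[OF f f] open_ball sub[OF that(1)]])
      show "((\<lambda>y. f k y - f l y) has_derivative (\<lambda>v. D k x v - D l x v)) (at x)"
        by (intro has_derivative_diff derf that)
      show "norm (f k y - f l y) \<le> e" if y: "y \<in> ball x \<rho>" for y
        using subsetD[OF sub[OF \<open>x \<in> ball x0 \<rho>\<close>] y] \<open>\<forall>y\<in>S. norm (f k y - f l y) \<le> e\<close> by blast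
    qed (rule \<rho>(1))
    then show ?thesis by (simp add: C_def)
  qed
  have cau: "\<exists>N. \<forall>k\<ge>N. \<forall>l\<ge>N. \<forall>x\<in>ball x0 \<rho>. \<forall>v. norm (D k x v - D l x v) \<le> e * norm v"
    if e: "0 < e" for e
  proof -
    have cau: "uniformly_Cauchy_on S f"
      by (rule uniformly_convergent_Cauchy, unfold uniformly_convergent_on_def, rule exI, rule lim)
    obtain N where N: "\<forall>x\<in>S. \<forall>k\<ge>N. \<forall>l\<ge>N. dist (f k x) (f l x) < e / C"
      using cau[unfolded uniformly_Cauchy_on_def, rule_format, OF divide_pos_pos[OF e C]] ..
    have "norm (D k x v - D l x v) \<le> C * (e / C) * norm v"
      if "k \<ge> N" "l \<ge> N" "x \<in> ball x0 \<rho>" for k l x v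
    proof (rule diff[OF that(3)], rule ballI)
      fix y assume "y \<in> S"
      with N that(1,2) have "dist (f k y) (f l y) < e / C" by blast
      then show "norm (f k y - f l y) \<le> e / C" by (simp add: dist_norm)
    qed
    moreover have "C * (e / C) = e" using C by simp
    ultimately show ?thesis by (intro exI[of _ N]) metis
  qed
  have conv: "convergent (\<lambda>k. D k x v)" if x: "x \<in> ball x0 \<rho>" for x v
  proof (rule Cauchy_convergent, rule metric_CauchyI)
    fix e :: real assume e: "0 < e"
    have "0 < e / (1 + norm v)" by (rule divide_pos_pos[OF e]) (simp add: add_pos_nonneg)
    from cau[OF this] obtain N where N: "\<And>k l x v'. k \<ge> N \<Longrightarrow> l \<ge> N \<Longrightarrow> x \<in> ball x0 \<rho> \<Longrightarrow>
        norm (D k x v' - D l x v') \<le> e / (1 + norm v) * norm v'" by blast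
    have "e / (1 + norm v) * norm v = e * (norm v / (1 + norm v))" by simp
    also have "\<dots> < e * 1"
      by (intro mult_strict_left_mono e) (simp add: divide_less_eq add_pos_nonneg)
    finally have "e / (1 + norm v) * norm v < e" by simp
    with N[OF _ _ x, of _ _ v] show "\<exists>M. \<forall>m\<ge>M. \<forall>n\<ge>M. dist (D m x v) (D n x v) < e"
      unfolding dist_norm by (meson le_less_trans)
  qed
  define E where "E x v = lim (\<lambda>k. D k x v)" for x v
  have E: "(\<lambda>k. D k x v) \<longlonglongrightarrow> E x v" if "x \<in> ball x0 \<rho>" for x v
    using conv[OF that] unfolding E_def by (simp add: convergent_LIMSEQ_iff)
  have "\<exists>h. \<forall>x\<in>ball x0 \<rho>. (\<lambda>k. f k x) \<longlonglongrightarrow> h x \<and> (h has_derivative E x) (at x within ball x0 \<rho>)"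
  proof (rule has_derivative_sequence)
    show "(f k has_derivative D k x) (at x within ball x0 \<rho>)" if "x \<in> ball x0 \<rho>" for k x
      by (rule has_derivative_at_withinI, rule derf(1)[OF that])
    show "\<forall>\<^sub>F k in sequentially. \<forall>x\<in>ball x0 \<rho>. \<forall>v. norm (D k x v - E x v) \<le> e * norm v"
      if e: "0 < e" for e
    proof -
      obtain N where N: "\<And>k l x v. k \<ge> N \<Longrightarrow> l \<ge> N \<Longrightarrow> x \<in> ball x0 \<rho> \<Longrightarrow>
          norm (D k x v - D l x v) \<le> e * norm v"
        using cau[OF e] by blast
      have "norm (D k x v - E x v) \<le> e * norm v" if "k \<ge> N" "x \<in> ball x0 \<rho>" for k x v
      proof (rule LIMSEQ_le_const2)
        show "(\<lambda>l. norm (D k x v - D l x v)) \<longlonglongrightarrow> norm (D k x v - E x v)"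
          by (intro tendsto_intros E that)
        show "\<exists>N. \<forall>l\<ge>N. norm (D k x v - D l x v) \<le> e * norm v"
          using N that by blast
      qed
      then show ?thesis unfolding eventually_sequentially by (intro exI[of _ N]) blast
    qed
    show "x0 \<in> ball x0 \<rho>" using \<rho> by simp
    show "(\<lambda>k. f k x0) \<longlonglongrightarrow> g x0" by (rule tendsto_uniform_limitI[OF lim \<open>x0 \<in> S\<close>])
  qed simp
  then obtain h where h: "\<And>x. x \<in> ball x0 \<rho> \<Longrightarrow> (\<lambda>k. f k x) \<longlonglongrightarrow> h x"
      "\<And>x. x \<in> ball x0 \<rho> \<Longrightarrow> (h has_derivative E x) (at x within ball x0 \<rho>)" by blast
  have "h x = g x" if "x \<in> ball x0 \<rho>" for x
    using h(1)[OF that] tendsto_uniform_limitI[OF lim] sub[OF that] \<rho>(1)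
    by (metis LIMSEQ_unique centre_in_ball subsetD)
  moreover have "(h has_derivative E x0) (at x0)"
    using h(2)[of x0] \<rho>(1) by (simp add: at_within_open[OF _ open_ball])
  ultimately have "(g has_derivative E x0) (at x0)"
    using \<rho>(1) by (metis has_derivative_transform_within_open open_ball centre_in_ball)
  moreover have "E x0 (sc a v) = a *s E x0 v" for a v
  proof (rule LIMSEQ_unique[OF E])
    have "(\<lambda>k. a *s D k x0 v) \<longlonglongrightarrow> a *s E x0 v"
      by (intro bounded_bilinear.tendsto[OF bounded_bilinear_vector_smult] tendsto_const E)
        (use \<rho> in simp)
    then show "(\<lambda>k. D k x0 (sc a v)) \<longlonglongrightarrow> a *s E x0 v"
      using derf(2)[of x0] \<rho>(1) by simp
  qed (use \<rho> in simp)
  ultimately show "\<exists>D. (g has_derivative D) (at x0) \<and> (\<forall>a v. D (sc a v) = a *s D v)" by blast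
qed (rule S)

text \<open>Derivatives inherit continuity in a parameter from the map itself, because the Cauchy bound
  applies to the difference of two translates.\<close>

lemma derivative_continuous_param:
  fixes g :: "real \<Rightarrow> 'a \<Rightarrow> complex ^ 'n::finite"
  assumes S: "open S" and cont: "continuous_on ({0..1} \<times> S) (\<lambda>(\<tau>, x). g \<tau> x)"
    and hol: "\<And>\<tau>. \<tau> \<in> {0..1} \<Longrightarrow> holo S (g \<tau>)"
    and G: "\<And>\<tau> x. \<tau> \<in> {0..1} \<Longrightarrow> x \<in> S \<Longrightarrow> (g \<tau> has_derivative G \<tau> x) (at x)"
    and x: "x \<in> S" and \<tau>: "\<tau> \<in> {0..1}" and \<eta>: "0 < \<eta>"
  obtains \<delta> where "0 < \<delta>"
    "\<And>\<sigma> y v. \<sigma> \<in> {0..1} \<Longrightarrow> y \<in> S \<Longrightarrow> \<bar>\<sigma> - \<tau>\<bar> < \<delta> \<Longrightarrow> dist y x < \<delta> \<Longrightarrow>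
      norm (G \<sigma> y v - G \<tau> x v) \<le> \<eta> * norm v"
proof -
  obtain \<rho> where \<rho>: "0 < \<rho>" "cball x (2 * \<rho>) \<subseteq> S"
    using S x open_contains_cball
    by (metis field_sum_of_halves half_gt_zero mult_2)
  define \<eta>' where "\<eta>' = \<eta> / (real CARD('n) * (2 / \<rho>))"
  have \<eta>': "0 < \<eta>'" using \<eta> \<rho> by (simp add: \<eta>'_def)
  have "uniformly_continuous_on ({0..1} \<times> cball x (2 * \<rho>)) (\<lambda>(\<tau>, x). g \<tau> x)"
    by (intro compact_uniformly_continuous compact_Times compact_cball compact_Icc
        continuous_on_subset[OF cont]) (use \<rho> in auto)
  then obtain \<delta> where \<delta>: "0 < \<delta>"
    "\<And>p p'. p \<in> {0..1} \<times> cball x (2 * \<rho>) \<Longrightarrow> p' \<in> {0..1} \<times> cball x (2 * \<rho>) \<Longrightarrow> dist p' p < \<delta> \<Longrightarrow>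
      dist (case p' of (\<tau>, x) \<Rightarrow> g \<tau> x) (case p of (\<tau>, x) \<Rightarrow> g \<tau> x) < \<eta>'"
    unfolding uniformly_continuous_on_def using \<eta>' by metis
  show ?thesis
  proof
    show "0 < min (\<delta> / 2) \<rho>" using \<delta> \<rho> by simp
    fix \<sigma> y v assume \<sigma>: "\<sigma> \<in> {0..1}" and y: "y \<in> S"
      and d: "\<bar>\<sigma> - \<tau>\<bar> < min (\<delta> / 2) \<rho>" "dist y x < min (\<delta> / 2) \<rho>"
    have in1: "w + (y - x) \<in> cball x (2 * \<rho>)" "w \<in> cball x (2 * \<rho>)" if "w \<in> ball x \<rho>" for w
    proof -
      have "norm (w + (y - x) - x) \<le> norm (w - x) + norm (y - x)"
        by (metis add_diff_eq diff_add_eq norm_triangle_ineq)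
      moreover have "norm (w - x) < \<rho>" "norm (y - x) < \<rho>"
        using that d by (auto simp: dist_norm norm_minus_commute)
      ultimately show "w + (y - x) \<in> cball x (2 * \<rho>)" "w \<in> cball x (2 * \<rho>)"
        using \<rho> by (auto simp: dist_norm norm_minus_commute)
    qed
    have "norm (G \<sigma> y v - G \<tau> x v) \<le> real CARD('n) * (2 * \<eta>' / \<rho>) * norm v"
    proof (rule cauchy_bound)
      show "holo (ball x \<rho>) (\<lambda>w. g \<sigma> (w + (y - x)) - g \<tau> w)"
      proof (rule holo_diff)
        show "holo (ball x \<rho>) (\<lambda>w. g \<sigma> (w + (y - x)))"
          using in1(1) \<rho>(2) by (intro holo_subset[OF holo_translate[OF hol[OF \<sigma>]]]) blast+
        show "holo (ball x \<rho>) (g \<tau>)"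
          using in1 \<rho> by (intro holo_subset[OF hol[OF \<tau>]]) auto
      qed
      have "((\<lambda>w. g \<sigma> (w + (y - x))) has_derivative (\<lambda>v. G \<sigma> y (v + 0))) (at x)"
        by (rule has_derivative_compose[where f = "\<lambda>w. w + (y - x)"])
          (auto intro!: derivative_eq_intros G \<sigma> y)
      then show "((\<lambda>w. g \<sigma> (w + (y - x)) - g \<tau> w) has_derivative (\<lambda>v. G \<sigma> y v - G \<tau> x v)) (at x)"
        by (intro has_derivative_diff G \<tau> x) simp
      fix w assume w: "w \<in> ball x \<rho>"
      have "dist (\<sigma>, w + (y - x)) (\<tau>, w) \<le> \<bar>\<sigma> - \<tau>\<bar> + norm (y - x)"
        unfolding dist_Pair_Pair
        by (rule order_trans[OF sqrt_sum_squares_le_sum]) (auto simp: dist_norm)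
      also have "\<dots> < \<delta>" using d by (simp add: dist_norm)
      finally show "norm (g \<sigma> (w + (y - x)) - g \<tau> w) \<le> \<eta>'"
        using \<delta>(2)[of "(\<tau>, w)" "(\<sigma>, w + (y - x))"] in1[OF w] \<sigma> \<tau> by (simp add: dist_norm)
    qed (rule \<rho>)
    also have "\<dots> = \<eta> * norm v" using \<rho> by (simp add: \<eta>'_def field_simps)
    finally show "norm (G \<sigma> y v - G \<tau> x v) \<le> \<eta> * norm v" .
  qed
qed

lemma continuous_on_derivative_param:
  fixes g :: "real \<Rightarrow> 'a \<Rightarrow> complex ^ 'n::finite"
  assumes S: "open S" and cont: "continuous_on ({0..1} \<times> S) (\<lambda>(\<tau>, x). g \<tau> x)"
    and hol: "\<And>\<tau>. \<tau> \<in> {0..1} \<Longrightarrow> holo S (g \<tau>)"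
    and G: "\<And>\<tau> x. \<tau> \<in> {0..1} \<Longrightarrow> x \<in> S \<Longrightarrow> (g \<tau> has_derivative G \<tau> x) (at x)"
  shows "continuous_on (S \<times> {0..1}) (\<lambda>(x, \<tau>). Blinfun (G \<tau> x))"
  unfolding continuous_on_iff
proof (intro ballI allI impI, clarify)
  fix x and \<tau> e :: real assume x: "x \<in> S" and \<tau>: "\<tau> \<in> {0..1}" and e: "0 < e"
  obtain \<delta> where \<delta>: "0 < \<delta>"
    "\<And>\<sigma> y v. \<sigma> \<in> {0..1} \<Longrightarrow> y \<in> S \<Longrightarrow> \<bar>\<sigma> - \<tau>\<bar> < \<delta> \<Longrightarrow> dist y x < \<delta> \<Longrightarrow>
      norm (G \<sigma> y v - G \<tau> x v) \<le> e / 2 * norm v"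
    using derivative_continuous_param[OF S cont hol G x \<tau>, of "e / 2"] e by (metis half_gt_zero)
  have bl: "bounded_linear (G \<tau> x)" if "x \<in> S" "\<tau> \<in> {0..1}" for x \<tau>
    using G[OF that(2,1)] by (rule has_derivative_bounded_linear)
  have "dist (Blinfun (G \<sigma> y)) (Blinfun (G \<tau> x)) < e"
    if p: "y \<in> S" "\<sigma> \<in> {0..1}" "dist (y, \<sigma>) (x, \<tau>) < \<delta>" for y \<sigma>
  proof -
    have "dist y x < \<delta>" "\<bar>\<sigma> - \<tau>\<bar> < \<delta>"
      using p(3) dist_fst_le[of "(y, \<sigma>)" "(x, \<tau>)"] dist_snd_le[of "(y, \<sigma>)" "(x, \<tau>)"]
      by (auto simp: dist_real_def)
    then have "norm (Blinfun (G \<sigma> y) - Blinfun (G \<tau> x)) \<le> e / 2"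
      using e p x \<tau> \<delta>(2) by (intro norm_blinfun_bound)
        (auto simp: blinfun.diff_left bounded_linear_Blinfun_apply bl)
    then show ?thesis using e by (simp add: dist_norm)
  qed
  then show "\<exists>d>0. \<forall>p\<in>S \<times> {0..1}. dist p (x, \<tau>) < d \<longrightarrow>
      dist (case p of (x, \<tau>) \<Rightarrow> Blinfun (G \<tau> x)) (Blinfun (G \<tau> x)) < e"
    using \<delta>(1) by (intro exI[of _ \<delta>]) auto
qed

text \<open>
  Differentiation under the integral sign.  Joint continuity of the integrand suffices, since
  it already entails the joint continuity of the derivative.
\<close>

lemma holo_integral:
  fixes g :: "real \<Rightarrow> 'a \<Rightarrow> complex ^ 'n::finite"
  assumes S: "open S" and cont: "continuous_on ({0..1} \<times> S) (\<lambda>(\<tau>, x). g \<tau> x)"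
    and hol: "\<And>\<tau>. \<tau> \<in> {0..1} \<Longrightarrow> holo S (g \<tau>)"
    and G: "\<And>\<tau> x. \<tau> \<in> {0..1} \<Longrightarrow> x \<in> S \<Longrightarrow> (g \<tau> has_derivative G \<tau> x) (at x)"
  shows "holo S (\<lambda>x. integral {0..1} (\<lambda>\<tau>. g \<tau> x))"
    and "x \<in> S \<Longrightarrow> ((\<lambda>x. integral {0..1} (\<lambda>\<tau>. g \<tau> x)) has_derivative
      (\<lambda>v. integral {0..1} (\<lambda>\<tau>. G \<tau> x v))) (at x)"
    and "x \<in> S \<Longrightarrow> continuous_on {0..1} (\<lambda>\<tau>. G \<tau> x v)"
proof -
  note cB = continuous_on_derivative_param[OF S cont hol G]
  have bl: "bounded_linear (G \<tau> x)" if "x \<in> S" "\<tau> \<in> {0..1}" for x \<tau>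
    using G[OF that(2,1)] by (rule has_derivative_bounded_linear)
  have cBx: "continuous_on {0..1} (\<lambda>\<tau>. Blinfun (G \<tau> x))" if "x \<in> S" for x
    using continuous_on_compose2[OF cB, of "{0..1}" "\<lambda>\<tau>. (x, \<tau>)"] that
    by (simp add: continuous_on_Pair image_subset_iff)
  show cv: "continuous_on {0..1} (\<lambda>\<tau>. G \<tau> x v)" if "x \<in> S" for x v
  proof -
    have "continuous_on {0..1} (\<lambda>\<tau>. Blinfun (G \<tau> x) v)"
      by (intro continuous_intros cBx that)
    then show ?thesis
      by (rule continuous_on_eq) (simp add: bounded_linear_Blinfun_apply bl that)
  qed
  show der: "((\<lambda>x. integral {0..1} (\<lambda>\<tau>. g \<tau> x)) has_derivative
      (\<lambda>v. integral {0..1} (\<lambda>\<tau>. G \<tau> x v))) (at x)" if x: "x \<in> S" for x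
  proof -
    obtain r where r: "0 < r" "ball x r \<subseteq> S" using S x openE by blast
    have "((\<lambda>x. integral (cbox 0 1) (\<lambda>\<tau>. g \<tau> x)) has_derivative
      integral (cbox 0 1) (\<lambda>\<tau>. Blinfun (G \<tau> x))) (at x within ball x r)"
    proof (rule leibniz_rule[where fx = "\<lambda>x \<tau>. Blinfun (G \<tau> x)"])
      show "((\<lambda>x. g \<tau> x) has_derivative blinfun_apply (Blinfun (G \<tau> y))) (at y within ball x r)"
        if "y \<in> ball x r" "\<tau> \<in> cbox 0 1" for y \<tau>
      proof -
        have "y \<in> S" "\<tau> \<in> {0..1}" using that r by auto
        then show ?thesis
          using has_derivative_at_withinI[OF G] by (simp add: bounded_linear_Blinfun_apply bl)
      qed
      show "(\<lambda>\<tau>. g \<tau> y) integrable_on cbox 0 1" if "y \<in> ball x r" for y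
      proof (rule integrable_continuous)
        show "continuous_on (cbox 0 1) (\<lambda>\<tau>. g \<tau> y)"
          using continuous_on_compose2[OF cont, of "{0..1}" "\<lambda>\<tau>. (\<tau>, y)"] subsetD[OF r(2) that]
          by (simp add: continuous_on_Pair image_subset_iff)
      qed
      show "continuous_on (ball x r \<times> cbox 0 1) (\<lambda>(x, \<tau>). Blinfun (G \<tau> x))"
        by (rule continuous_on_subset[OF cB]) (use r in auto)
    qed (use r in auto)
    moreover have "blinfun_apply (integral (cbox 0 1) (\<lambda>\<tau>. Blinfun (G \<tau> x))) =
        (\<lambda>v. integral {0..1} (\<lambda>\<tau>. G \<tau> x v))"
    proof
      fix v
      show "blinfun_apply (integral (cbox 0 1) (\<lambda>\<tau>. Blinfun (G \<tau> x))) v =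
        integral {0..1} (\<lambda>\<tau>. G \<tau> x v)"
      proof -
        have "blinfun_apply (integral {0..1} (\<lambda>\<tau>. Blinfun (G \<tau> x))) v =
            integral {0..1} (\<lambda>\<tau>. Blinfun (G \<tau> x) v)"
          using integral_linear[OF integrable_continuous_real[OF cBx[OF x]]
              bounded_bilinear.bounded_linear_left[OF bounded_bilinear_blinfun_apply, of v]]
          by (simp add: o_def)
        also have "\<dots> = integral {0..1} (\<lambda>\<tau>. G \<tau> x v)"
          by (rule integral_cong) (simp add: bounded_linear_Blinfun_apply bl x)
        finally show ?thesis by simp
      qed
    qed
    ultimately show ?thesis
      using r(1) by (simp add: at_within_open[OF _ open_ball])
  qed
  show "holo S (\<lambda>x. integral {0..1} (\<lambda>\<tau>. g \<tau> x))"
    unfolding holo_def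
  proof (intro conjI ballI exI allI)
    fix x a v assume x: "x \<in> S"
    have "integral {0..1} (\<lambda>\<tau>. G \<tau> x (sc a v)) = integral {0..1} (\<lambda>\<tau>. a *s G \<tau> x v)"
      by (rule integral_cong) (simp add: holo_derivative_scale[OF hol x G] x)
    also have "\<dots> = a *s integral {0..1} (\<lambda>\<tau>. G \<tau> x v)"
      using integral_linear[OF integrable_continuous_real[OF cv[OF x, of v]]
          bounded_bilinear.bounded_linear_right[OF bounded_bilinear_vector_smult, of a]]
      by (simp add: o_def)
    finally show "integral {0..1} (\<lambda>\<tau>. G \<tau> x (sc a v)) = a *s integral {0..1} (\<lambda>\<tau>. G \<tau> x v)" .
  qed (use S der in auto)
qed


lemma holo_local_bounds:
  fixes f :: "'a \<Rightarrow> complex ^ 'n::finite"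
  assumes f: "holo S f" and x: "x \<in> S"
  obtains R M L where "0 < R" "cball x R \<subseteq> S" "0 \<le> M" "0 \<le> L"
    "\<And>y. y \<in> cball x R \<Longrightarrow> norm (f y) \<le> M"
    "\<And>y v. y \<in> cball x R \<Longrightarrow> norm (frechet_derivative f (at y) v) \<le> L * norm v"
proof -
  obtain R where R: "0 < R" "cball x (2 * R) \<subseteq> S"
    using holo_open[OF f] x open_contains_cball
    by (metis field_sum_of_halves half_gt_zero mult_2)
  have "compact (f ` cball x (2 * R))"
    by (intro compact_continuous_image compact_cball continuous_on_subset[OF holo_continuous_on[OF f]] R)
  then obtain M where M: "0 < M" "\<And>y. y \<in> cball x (2 * R) \<Longrightarrow> norm (f y) \<le> M"
    unfolding bounded_pos[symmetric] using compact_imp_bounded bounded_pos by (metis imageI)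
  have sub: "ball y R \<subseteq> cball x (2 * R)" if "y \<in> cball x R" for y
    using that by (simp add: ball_subset_cball_iff dist_commute)
  show ?thesis
  proof
    show "0 < R" "0 \<le> M" using R M by auto
    show "0 \<le> real CARD('n) * (2 * M / R)" using R M by simp
    show "cball x R \<subseteq> S" using R(1) by (intro order_trans[OF _ R(2)]) (simp add: cball_subset_cball_iff)
    show "norm (f y) \<le> M" if "y \<in> cball x R" for y
      using that R(1) by (intro M) auto
    show "norm (frechet_derivative f (at y) v) \<le> real CARD('n) * (2 * M / R) * norm v"
      if y: "y \<in> cball x R" for y v
    proof (rule cauchy_bound[OF _ R(1)])
      show "holo (ball y R) f" by (rule holo_subset[OF f]) (use sub[OF y] R in auto)
      show "norm (f w) \<le> M" if "w \<in> ball y R" for w using sub[OF y] that by (intro M) auto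
      show "(f has_derivative frechet_derivative f (at y)) (at y)"
        using y R by (intro holo_frechet(1)[OF f]) (auto simp: subset_iff)
    qed
  qed
qed

end

interpretation vec: complex_scaling "(*s) :: complex \<Rightarrow> complex ^ 'n::finite \<Rightarrow> complex ^ 'n"
  by unfold_locales
    (simp_all add: vector_smult_add_left of_real_vector_smult norm_vector_smult vector_smult_assoc)

interpretation pair: complex_scaling
  "\<lambda>a (x :: (complex ^ 'k::finite) \<times> (complex ^ 'n::finite)). (a *s fst x, a *s snd x)"
proof
  fix a b :: complex and x :: "(complex ^ 'k) \<times> (complex ^ 'n)" and r :: real
  show "norm (a *s fst x, a *s snd x) = norm a * norm x"
    by (cases x) (simp add: norm_Pair norm_vector_smult power_mult_distrib distrib_left[symmetric]
        real_sqrt_mult)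
qed (simp_all add: vector_smult_add_left of_real_vector_smult vector_smult_assoc scaleR_prod_def)

lemma holomorphic_map_on_iff_holo: "holomorphic_map_on S f \<longleftrightarrow> vec.holo S f"
  by (simp add: holomorphic_map_on_def vec.holo_def)

section \<open>The local flow of a commuting pair\<close>

text \<open>
  The bracket condition is \<open>[f1, f2] = 0\<close> in coordinates.  \<open>F h\<close> is the combination of the
  two fields with coefficients \<open>h\<close>, and \<open>DF h\<close> its derivative; both are linear in \<open>h\<close>, and
  the vanishing of all brackets of such combinations is \<open>DF_F_commute\<close> below.
\<close>

locale commuting_fields =
  fixes U :: "(complex ^ 'n::finite) set" and f1 f2 :: "complex ^ 'n \<Rightarrow> complex ^ 'n"
  assumes f1: "vec.holo U f1" and f2: "vec.holo U f2"
    and bracket: "y \<in> U \<Longrightarrow>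
      frechet_derivative f2 (at y) (f1 y) = frechet_derivative f1 (at y) (f2 y)"
begin

abbreviation D1 where "D1 y \<equiv> frechet_derivative f1 (at y)"
abbreviation D2 where "D2 y \<equiv> frechet_derivative f2 (at y)"

definition F :: "complex ^ 2 \<Rightarrow> complex ^ 'n \<Rightarrow> complex ^ 'n"
  where "F h y = h $ 1 *s f1 y + h $ 2 *s f2 y"

definition DF :: "complex ^ 2 \<Rightarrow> complex ^ 'n \<Rightarrow> complex ^ 'n \<Rightarrow> complex ^ 'n"
  where "DF h y k = h $ 1 *s D1 y k + h $ 2 *s D2 y k"

lemma has_derivative_f:
  assumes "y \<in> U"
  shows "(f1 has_derivative D1 y) (at y)" "(f2 has_derivative D2 y) (at y)"
  using vec.holo_frechet(1)[OF f1 assms] vec.holo_frechet(1)[OF f2 assms] .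

lemma D_linear:
  assumes "y \<in> U"
  shows "bounded_linear (D1 y)" "bounded_linear (D2 y)"
  using has_derivative_bounded_linear[OF has_derivative_f(1)[OF assms]]
    has_derivative_bounded_linear[OF has_derivative_f(2)[OF assms]] .

lemma D_scale:
  assumes "y \<in> U"
  shows "D1 y (a *s k) = a *s D1 y k" "D2 y (a *s k) = a *s D2 y k"
  using vec.holo_frechet(2)[OF f1 assms] vec.holo_frechet(2)[OF f2 assms] .

lemma DF_scaleR: "DF (r *\<^sub>R h) y k = r *\<^sub>R DF h y k"
  by (simp add: DF_def vector_smult_scaleR_left scaleR_add_right)

lemma F_scale: "F (a *s h) y = a *s F h y"
  by (simp add: F_def vector_smult_add_right vector_smult_assoc)

lemma F_0: "F 0 y = 0"
  by (simp add: F_def)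

lemma DF_linear: "y \<in> U \<Longrightarrow> bounded_linear (DF h y)"
  unfolding DF_def
  by (intro bounded_linear_add D_linear bounded_linear_compose[OF
        bounded_bilinear.bounded_linear_right[OF bounded_bilinear_vector_smult]])

lemma DF_scale: "y \<in> U \<Longrightarrow> DF h y (a *s k) = a *s DF h y k"
  by (simp add: DF_def D_scale vector_smult_add_right vector_smult_assoc mult.commute)

lemma DF_F_commute:
  assumes y: "y \<in> U"
  shows "DF v y (F h y) = DF h y (F v y)"
proof -
  have "DF v y (F h y) = v $ 1 *s (h $ 1 *s D1 y (f1 y) + h $ 2 *s D1 y (f2 y)) +
      v $ 2 *s (h $ 1 *s D2 y (f1 y) + h $ 2 *s D2 y (f2 y))" for v h
    by (simp add: DF_def F_def D_scale[OF y] linear_simps[OF D_linear(1)[OF y]]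
        linear_simps[OF D_linear(2)[OF y]])
  then show ?thesis
    by (simp add: bracket[OF y] vector_smult_add_right vector_smult_assoc algebra_simps)
qed

lemma has_derivative_F: "y \<in> U \<Longrightarrow> (F h has_derivative DF h y) (at y)"
  unfolding F_def DF_def
  by (rule derivative_eq_intros has_derivative_f refl | assumption)+ simp

lemma integrand_has_derivative:
  assumes w: "(w has_derivative W) (at (\<tau> *\<^sub>R h, z))" and U: "w (\<tau> *\<^sub>R h, z) \<in> U"
  shows "((\<lambda>x. F (fst x) (w (\<tau> *\<^sub>R fst x, snd x))) has_derivative
    (\<lambda>v. F (fst v) (w (\<tau> *\<^sub>R h, z)) + DF h (w (\<tau> *\<^sub>R h, z)) (W (\<tau> *\<^sub>R fst v, snd v)))) (at (h, z))"
proof -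
  have m: "((\<lambda>x. (\<tau> *\<^sub>R fst x, snd x)) has_derivative (\<lambda>v. (\<tau> *\<^sub>R fst v, snd v))) (at (h, z))"
    by (auto intro!: derivative_eq_intros)
  have wm: "((\<lambda>x. w (\<tau> *\<^sub>R fst x, snd x)) has_derivative (\<lambda>v. W (\<tau> *\<^sub>R fst v, snd v))) (at (h, z))"
    by (rule has_derivative_compose[OF m]) (simp add: w)
  have f: "((\<lambda>x. f1 (w (\<tau> *\<^sub>R fst x, snd x))) has_derivative
      (\<lambda>v. D1 (w (\<tau> *\<^sub>R h, z)) (W (\<tau> *\<^sub>R fst v, snd v)))) (at (h, z))"
    "((\<lambda>x. f2 (w (\<tau> *\<^sub>R fst x, snd x))) has_derivative
      (\<lambda>v. D2 (w (\<tau> *\<^sub>R h, z)) (W (\<tau> *\<^sub>R fst v, snd v)))) (at (h, z))"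
    by (rule has_derivative_compose[OF wm]; simp add: has_derivative_f U)+
  have c: "((\<lambda>x. fst x $ i) has_derivative (\<lambda>v. fst v $ i)) (at (h, z))" for i
    by (intro bounded_linear.has_derivative[OF bounded_linear_vec_nth] derivative_intros)
  show ?thesis
    unfolding F_def DF_def
    by (rule has_derivative_eq_rhs[OF has_derivative_add[OF
            has_derivative_vector_smult[OF c f(1)] has_derivative_vector_smult[OF c f(2)]]])
      (simp add: fun_eq_iff algebra_simps)
qed

text \<open>
  Integrating over the segment \<open>[0, h]\<close>, parametrized by \<open>[0, 1]\<close>, gives all
  time directions at once and turns the time \<open>h\<close> into an ordinary parameter of the integrand.
\<close>

definition picard :: "((complex ^ 2) \<times> (complex ^ 'n) \<Rightarrow> complex ^ 'n) \<Rightarrow> (complex ^ 2) \<times> (complex ^ 'n) \<Rightarrow> complex ^ 'n"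
  where "picard w x = snd x + integral {0..1} (\<lambda>\<tau>. F (fst x) (w (\<tau> *\<^sub>R fst x, snd x)))"

context
  fixes S :: "((complex ^ 2) \<times> (complex ^ 'n)) set"
  assumes S: "open S"
    and star: "\<And>h z \<tau>. (h, z) \<in> S \<Longrightarrow> \<tau> \<in> {0..1} \<Longrightarrow> (\<tau> *\<^sub>R h, z) \<in> S"
begin

lemma integrand_continuous:
  assumes w: "continuous_on S w" "w ` S \<subseteq> U"
  shows "continuous_on ({0..1} \<times> S) (\<lambda>(\<tau>, x). F (fst x) (w (\<tau> *\<^sub>R fst x, snd x)))"
proof -
  let ?m = "\<lambda>p :: real \<times> (complex ^ 2) \<times> (complex ^ 'n). (fst p *\<^sub>R fst (snd p), snd (snd p))"
  have m: "continuous_on ({0..1} \<times> S) ?m" by (intro continuous_intros)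
  have im: "?m ` ({0..1} \<times> S) \<subseteq> S" using star by auto
  have wm: "continuous_on ({0..1} \<times> S) (\<lambda>p. w (?m p))"
    by (rule continuous_on_compose2[OF w(1) m im])
  have imU: "(\<lambda>p. w (?m p)) ` ({0..1} \<times> S) \<subseteq> U" using im w(2) by blast
  have "continuous_on ({0..1} \<times> S) (\<lambda>p. F (fst (snd p)) (w (?m p)))"
    unfolding F_def
    by (intro continuous_intros continuous_on_compose2[OF vec.holo_continuous_on[OF f1] wm imU]
        continuous_on_compose2[OF vec.holo_continuous_on[OF f2] wm imU]
        bounded_linear.continuous_on[OF bounded_linear_vec_nth])
  then show ?thesis by (simp add: split_def)
qed

lemma picard_derivative:
  assumes w: "pair.holo S w" "w ` S \<subseteq> U"
    and W: "\<And>x. x \<in> S \<Longrightarrow> (w has_derivative W x) (at x)"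
  shows "pair.holo S (picard w)"
    and "(h, z) \<in> S \<Longrightarrow> (picard w has_derivative (\<lambda>v. snd v + integral {0..1} (\<lambda>\<tau>.
      F (fst v) (w (\<tau> *\<^sub>R h, z)) + DF h (w (\<tau> *\<^sub>R h, z)) (W (\<tau> *\<^sub>R h, z) (\<tau> *\<^sub>R fst v, snd v))))) (at (h, z))"
    and "(h, z) \<in> S \<Longrightarrow> continuous_on {0..1} (\<lambda>\<tau>.
      F v (w (\<tau> *\<^sub>R h, z)) + DF h (w (\<tau> *\<^sub>R h, z)) (W (\<tau> *\<^sub>R h, z) (\<tau> *\<^sub>R v, k)))"
proof -
  let ?g = "\<lambda>\<tau> x. F (fst x) (w (\<tau> *\<^sub>R fst x, snd x))"
  define G where "G = (\<lambda>\<tau> x v. F (fst v) (w (\<tau> *\<^sub>R fst x, snd x)) +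
    DF (fst x) (w (\<tau> *\<^sub>R fst x, snd x)) (W (\<tau> *\<^sub>R fst x, snd x) (\<tau> *\<^sub>R fst v, snd v)))"
  have inS: "(\<tau> *\<^sub>R fst x, snd x) \<in> S" "w (\<tau> *\<^sub>R fst x, snd x) \<in> U" if "\<tau> \<in> {0..1}" "x \<in> S" for \<tau> x
    using star[of "fst x" "snd x"] that w(2) by auto
  have G: "(?g \<tau> has_derivative G \<tau> x) (at x)" if "\<tau> \<in> {0..1}" "x \<in> S" for \<tau> x
    using integrand_has_derivative[OF W[OF inS(1)[OF that]] inS(2)[OF that]]
    by (simp add: G_def)
  have hol: "pair.holo S (?g \<tau>)" if \<tau>: "\<tau> \<in> {0..1}" for \<tau>
    unfolding pair.holo_def
  proof (intro conjI ballI exI allI)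
    fix x a v assume x: "x \<in> S"
    have "W (\<tau> *\<^sub>R fst x, snd x) (a *s (\<tau> *\<^sub>R fst v), a *s snd v) =
        a *s W (\<tau> *\<^sub>R fst x, snd x) (\<tau> *\<^sub>R fst v, snd v)"
      using pair.holo_derivative_scale[OF w(1) inS(1)[OF \<tau> x] W[OF inS(1)[OF \<tau> x]],
          of a "(\<tau> *\<^sub>R fst v, snd v)"] by simp
    then show "G \<tau> x (a *s fst v, a *s snd v) = a *s G \<tau> x v"
      by (simp add: G_def F_scale DF_scale[OF inS(2)[OF \<tau> x]] vector_smult_add_right
          vector_smult_scaleR_right[symmetric])
  qed (use S G \<tau> in auto)
  note cont = integrand_continuous[OF pair.holo_continuous_on[OF w(1)] w(2)]
  have I: "pair.holo S (\<lambda>x. integral {0..1} (\<lambda>\<tau>. ?g \<tau> x))"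
    by (rule pair.holo_integral(1)[OF S cont hol G])
  have I': "((\<lambda>x. integral {0..1} (\<lambda>\<tau>. ?g \<tau> x)) has_derivative
      (\<lambda>v. integral {0..1} (\<lambda>\<tau>. G \<tau> x v))) (at x)" if "x \<in> S" for x
    by (rule pair.holo_integral(2)[OF S cont hol G that])
  have c: "continuous_on {0..1} (\<lambda>\<tau>. G \<tau> x v)" if "x \<in> S" for x v
    by (rule pair.holo_integral(3)[OF S cont hol G that])
  have "pair.holo S snd"
    unfolding pair.holo_def using S by (auto intro!: exI[of _ snd] derivative_intros)
  from pair.holo_add[OF this I] show "pair.holo S (picard w)"
    unfolding picard_def by simp
  show "(picard w has_derivative (\<lambda>v. snd v + integral {0..1} (\<lambda>\<tau>.
      F (fst v) (w (\<tau> *\<^sub>R h, z)) + DF h (w (\<tau> *\<^sub>R h, z)) (W (\<tau> *\<^sub>R h, z) (\<tau> *\<^sub>R fst v, snd v))))) (at (h, z))"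
    if "(h, z) \<in> S"
    using has_derivative_add[OF has_derivative_snd[OF has_derivative_ident] I'[OF that]]
    unfolding picard_def G_def by simp
  show "continuous_on {0..1} (\<lambda>\<tau>.
      F v (w (\<tau> *\<^sub>R h, z)) + DF h (w (\<tau> *\<^sub>R h, z)) (W (\<tau> *\<^sub>R h, z) (\<tau> *\<^sub>R v, k)))"
    if "(h, z) \<in> S"
    using c[OF that, of "(v, k)"] unfolding G_def by simp
qed


text \<open>A fixed point \<open>u\<close> of the Picard operator satisfies
  \<open>\<partial>\<^sub>v u = F\<^sub>v(u)\<close> for every parameter direction \<open>v\<close>.  Differentiating the
  integral equation shows that the defect satisfies a homogeneous linear
  integral equation along the ray \<open>[0,h]\<close>; it is here that the bracket is used.\<close>

lemma picard_fixed_point_derivative: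
  assumes u: "pair.holo S u" "u ` S \<subseteq> U" and fixed: "\<And>x. x \<in> S \<Longrightarrow> picard u x = u x"
    and B: "B < 1" "\<And>h z y k. (h, z) \<in> S \<Longrightarrow> y \<in> u ` S \<Longrightarrow> norm (DF h y k) \<le> B * norm k"
    and S0: "(h, z) \<in> S" and D: "(u has_derivative D) (at (h, z))"
  shows "D (v, 0) = F v (u (h, z))"
proof -
  define W where "W x = frechet_derivative u (at x)" for x
  have W: "(u has_derivative W x) (at x)" if "x \<in> S" for x
    unfolding W_def by (rule pair.holo_frechet(1)[OF u(1) that])
  have Wl: "bounded_linear (W x)" if "x \<in> S" for x
    by (rule has_derivative_bounded_linear[OF W[OF that]])
  have Wr: "W x (r *\<^sub>R v, 0) = r *\<^sub>R W x (v, 0)" if "x \<in> S" for x r v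
    using linear_simps(5)[OF Wl[OF that], of r "(v, 0)"] by (simp add: scaleR_prod_def)
  have inU: "u x \<in> U" if "x \<in> S" for x using u(2) that by auto
  have W_eq: "W (h, z) (v, 0) = integral {0..1} (\<lambda>\<tau>. F v (u (\<tau> *\<^sub>R h, z)) +
      \<tau> *\<^sub>R DF h (u (\<tau> *\<^sub>R h, z)) (W (\<tau> *\<^sub>R h, z) (v, 0)))"
    and W_int: "(\<lambda>\<tau>. F v (u (\<tau> *\<^sub>R h, z)) +
      \<tau> *\<^sub>R DF h (u (\<tau> *\<^sub>R h, z)) (W (\<tau> *\<^sub>R h, z) (v, 0))) integrable_on {0..1}"
    if hz: "(h, z) \<in> S" for h z v
  proof -
    have eq: "F v (u (\<tau> *\<^sub>R h, z)) + DF h (u (\<tau> *\<^sub>R h, z)) (W (\<tau> *\<^sub>R h, z) (\<tau> *\<^sub>R v, 0)) =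
        F v (u (\<tau> *\<^sub>R h, z)) + \<tau> *\<^sub>R DF h (u (\<tau> *\<^sub>R h, z)) (W (\<tau> *\<^sub>R h, z) (v, 0))"
      if "\<tau> \<in> {0..1}" for \<tau>
      using star[OF hz that] by (simp add: Wr linear_simps(5)[OF DF_linear[OF inU]])
    have "(u has_derivative (\<lambda>v. snd v + integral {0..1} (\<lambda>\<tau>.
      F (fst v) (u (\<tau> *\<^sub>R h, z)) + DF h (u (\<tau> *\<^sub>R h, z)) (W (\<tau> *\<^sub>R h, z) (\<tau> *\<^sub>R fst v, snd v))))) (at (h, z))"
      by (rule has_derivative_transform_within_open[OF picard_derivative(2)[OF u W hz] S hz fixed])
    from has_derivative_unique[OF W[OF hz] this]
    have "W (h, z) (v, 0) = integral {0..1} (\<lambda>\<tau>. F v (u (\<tau> *\<^sub>R h, z)) +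
      DF h (u (\<tau> *\<^sub>R h, z)) (W (\<tau> *\<^sub>R h, z) (\<tau> *\<^sub>R v, 0)))" by simp
    also have "\<dots> = integral {0..1} (\<lambda>\<tau>. F v (u (\<tau> *\<^sub>R h, z)) +
      \<tau> *\<^sub>R DF h (u (\<tau> *\<^sub>R h, z)) (W (\<tau> *\<^sub>R h, z) (v, 0)))"
      by (rule integral_cong) (rule eq)
    finally show "W (h, z) (v, 0) = integral {0..1} (\<lambda>\<tau>. F v (u (\<tau> *\<^sub>R h, z)) +
      \<tau> *\<^sub>R DF h (u (\<tau> *\<^sub>R h, z)) (W (\<tau> *\<^sub>R h, z) (v, 0)))" .
    show "(\<lambda>\<tau>. F v (u (\<tau> *\<^sub>R h, z)) +
      \<tau> *\<^sub>R DF h (u (\<tau> *\<^sub>R h, z)) (W (\<tau> *\<^sub>R h, z) (v, 0))) integrable_on {0..1}"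
      by (rule integrable_continuous_real,
          rule continuous_on_eq[OF picard_derivative(3)[OF u W hz, of v 0] eq])
  qed
  have ray: "((\<lambda>\<tau>. \<tau> *\<^sub>R F v (u (\<tau> *\<^sub>R h, z))) has_vector_derivative
      F v (u (\<tau> *\<^sub>R h, z)) + \<tau> *\<^sub>R DF v (u (\<tau> *\<^sub>R h, z)) (W (\<tau> *\<^sub>R h, z) (h, 0)))
      (at \<tau> within {0..1})"
    if hz: "(h, z) \<in> S" and \<tau>: "\<tau> \<in> {0..1}" for h z v \<tau>
  proof -
    note S\<tau> = star[OF hz \<tau>]
    have "((\<lambda>\<tau>. (\<tau> *\<^sub>R h, z)) has_derivative (\<lambda>s. (s *\<^sub>R h, 0))) (at \<tau>)"
      by (auto intro!: derivative_eq_intros)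
    from has_derivative_compose[OF has_derivative_compose[OF this W[OF S\<tau>]] has_derivative_F[OF inU[OF S\<tau>], of v]]
    have "((\<lambda>\<tau>. F v (u (\<tau> *\<^sub>R h, z))) has_derivative
        (\<lambda>s. s *\<^sub>R DF v (u (\<tau> *\<^sub>R h, z)) (W (\<tau> *\<^sub>R h, z) (h, 0)))) (at \<tau>)"
      by (simp add: Wr[OF S\<tau>] linear_simps(5)[OF DF_linear[OF inU[OF S\<tau>]]])
    then have "((\<lambda>\<tau>. \<tau> *\<^sub>R F v (u (\<tau> *\<^sub>R h, z))) has_derivative
        (\<lambda>s. s *\<^sub>R (F v (u (\<tau> *\<^sub>R h, z)) + \<tau> *\<^sub>R DF v (u (\<tau> *\<^sub>R h, z)) (W (\<tau> *\<^sub>R h, z) (h, 0))))) (at \<tau>)"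
      by (auto intro!: derivative_eq_intros simp: algebra_simps)
    then show ?thesis
      by (simp add: has_vector_derivative_def has_derivative_at_withinI)
  qed
  have F_int: "((\<lambda>\<tau>. F v (u (\<tau> *\<^sub>R h, z)) + \<tau> *\<^sub>R DF v (u (\<tau> *\<^sub>R h, z)) (W (\<tau> *\<^sub>R h, z) (h, 0)))
      has_integral F v (u (h, z))) {0..1}" if hz: "(h, z) \<in> S" for h z v
    using fundamental_theorem_of_calculus[OF zero_le_one ray[OF hz]] by simp
  \<comment> \<open>For \<open>v = h\<close> the two integrands agree: along rays the equation holds for any pair of fields.\<close>
  have radial: "W (h, z) (h, 0) = F h (u (h, z))" if hz: "(h, z) \<in> S" for h z
    using W_eq[OF hz, of h] integral_unique[OF F_int[OF hz, of h]] by simp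
  \<comment> \<open>The defect in direction \<open>v\<close>; the aim is to show that it vanishes.\<close>
  define e where "e h = W (h, z) (v, 0) - F v (u (h, z))" for h
  have e_int: "((\<lambda>\<tau>. \<tau> *\<^sub>R DF h (u (\<tau> *\<^sub>R h, z)) (e (\<tau> *\<^sub>R h))) has_integral e h) (cbox 0 1)"
    if hz: "(h, z) \<in> S" for h
  proof -
    have "F v (u (\<tau> *\<^sub>R h, z)) + \<tau> *\<^sub>R DF h (u (\<tau> *\<^sub>R h, z)) (W (\<tau> *\<^sub>R h, z) (v, 0)) -
        (F v (u (\<tau> *\<^sub>R h, z)) + \<tau> *\<^sub>R DF v (u (\<tau> *\<^sub>R h, z)) (W (\<tau> *\<^sub>R h, z) (h, 0))) = \<tau> *\<^sub>R DF h (u (\<tau> *\<^sub>R h, z)) (e (\<tau> *\<^sub>R h))" if \<tau>: "\<tau> \<in> {0..1}" for \<tau>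
    proof -
      note S\<tau> = star[OF hz \<tau>]
      note lin = linear_simps[OF DF_linear[OF inU[OF S\<tau>]]]
      have "\<tau> *\<^sub>R DF v (u (\<tau> *\<^sub>R h, z)) (W (\<tau> *\<^sub>R h, z) (h, 0)) =
          DF v (u (\<tau> *\<^sub>R h, z)) (F (\<tau> *\<^sub>R h) (u (\<tau> *\<^sub>R h, z)))"
        by (simp add: radial[OF S\<tau>, symmetric] Wr[OF S\<tau>] lin)
      also have "\<dots> = \<tau> *\<^sub>R DF h (u (\<tau> *\<^sub>R h, z)) (F v (u (\<tau> *\<^sub>R h, z)))"
        by (simp only: DF_F_commute[OF inU[OF S\<tau>], of v "\<tau> *\<^sub>R h"] DF_scaleR)
      finally show ?thesis by (simp add: e_def lin scaleR_diff_right)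
    qed
    moreover have "((\<lambda>\<tau>. F v (u (\<tau> *\<^sub>R h, z)) + \<tau> *\<^sub>R DF h (u (\<tau> *\<^sub>R h, z)) (W (\<tau> *\<^sub>R h, z) (v, 0)) -
        (F v (u (\<tau> *\<^sub>R h, z)) + \<tau> *\<^sub>R DF v (u (\<tau> *\<^sub>R h, z)) (W (\<tau> *\<^sub>R h, z) (h, 0))))
        has_integral e h) {0..1}"
      unfolding e_def
      using has_integral_diff[OF integrable_integral[OF W_int[OF hz, of v]] F_int[OF hz, of v]]
      by (simp add: W_eq[OF hz, symmetric])
    ultimately show ?thesis unfolding box_real(2) by (rule has_integral_eq)
  qed
  have inS: "(\<tau> *\<^sub>R h, z) \<in> S" if "\<tau> \<in> {0..1}" for \<tau> by (rule star[OF S0 that])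
  have "continuous_on {0..1} (\<lambda>\<tau>. e (\<tau> *\<^sub>R h))"
  proof -
    have "continuous_on (S \<times> {0..1}) (\<lambda>(x, \<tau>::real). Blinfun (W x))"
    proof (rule pair.continuous_on_derivative_param[OF S, of "\<lambda>_. u"])
      show "continuous_on ({0..1} \<times> S) (\<lambda>(\<tau>::real, x). u x)"
        unfolding split_def
        by (rule continuous_on_compose2[OF pair.holo_continuous_on[OF u(1)]])
          (auto intro!: continuous_intros)
    qed (use u W in auto)
    from continuous_on_compose2[OF this, of "{0..1}" "\<lambda>\<tau>. ((\<tau> *\<^sub>R h, z), \<tau>)"]
    have "continuous_on {0..1} (\<lambda>\<tau>. Blinfun (W (\<tau> *\<^sub>R h, z)))"
      using inS by (simp add: continuous_on_Pair image_subset_iff continuous_on_scaleR)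
    then have "continuous_on {0..1} (\<lambda>\<tau>. blinfun_apply (Blinfun (W (\<tau> *\<^sub>R h, z))) (v, 0))"
      by (intro continuous_intros)
    then have c1: "continuous_on {0..1} (\<lambda>\<tau>. W (\<tau> *\<^sub>R h, z) (v, 0))"
      by (rule continuous_on_eq) (simp add: bounded_linear_Blinfun_apply Wl inS)
    have c2: "continuous_on {0..1} (\<lambda>\<tau>. F v (u (\<tau> *\<^sub>R h, z)))"
    proof (intro continuous_at_imp_continuous_on ballI)
      fix \<tau> :: real assume \<tau>: "\<tau> \<in> {0..1}"
      have "isCont (\<lambda>\<tau>. (\<tau> *\<^sub>R h, z)) \<tau>" by (intro continuous_intros)
      then have "isCont (\<lambda>\<tau>. u (\<tau> *\<^sub>R h, z)) \<tau>"
        by (rule isCont_o2) (rule has_derivative_continuous[OF W[OF inS[OF \<tau>]]])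
      then show "isCont (\<lambda>\<tau>. F v (u (\<tau> *\<^sub>R h, z))) \<tau>"
        by (rule isCont_o2) (rule has_derivative_continuous[OF has_derivative_F[OF inU[OF inS[OF \<tau>]]]])
    qed
    show ?thesis unfolding e_def by (intro continuous_intros c1 c2)
  qed
  then have "continuous_on {0..1} (\<lambda>\<tau>. norm (e (\<tau> *\<^sub>R h)))" by (intro continuous_intros)
  \<comment> \<open>The integral equation, taken where the defect is largest on the ray, bounds its norm by
    a multiple less than one of itself.\<close>
  then obtain \<sigma> where \<sigma>: "\<sigma> \<in> {0..1}" and max: "\<And>\<tau>. \<tau> \<in> {0..1} \<Longrightarrow> norm (e (\<tau> *\<^sub>R h)) \<le> norm (e (\<sigma> *\<^sub>R h))"
    using continuous_attains_sup[of "{0..1::real}" "\<lambda>\<tau>. norm (e (\<tau> *\<^sub>R h))"] by (metis atLeastAtMost_iff atLeastatMost_empty_iff compact_Icc zero_le_one)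
  define B' where "B' = max B 0"
  have B': "0 \<le> B'" "B' < 1" using B(1) by (auto simp: B'_def)
  have "norm (\<tau> *\<^sub>R DF (\<sigma> *\<^sub>R h) (u (\<tau> *\<^sub>R \<sigma> *\<^sub>R h, z)) (e (\<tau> *\<^sub>R \<sigma> *\<^sub>R h))) \<le> B' * norm (e (\<sigma> *\<^sub>R h))"
    if "\<tau> \<in> cbox 0 1" for \<tau>
  proof -
    have \<tau>: "\<tau> \<in> {0..1}" "\<tau> * \<sigma> \<in> {0..1}" using that \<sigma> by (auto simp: mult_le_one)
    have "norm (DF (\<sigma> *\<^sub>R h) (u (\<tau> *\<^sub>R \<sigma> *\<^sub>R h, z)) (e (\<tau> *\<^sub>R \<sigma> *\<^sub>R h))) \<le> B * norm (e (\<tau> *\<^sub>R \<sigma> *\<^sub>R h))"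
      using \<tau>(2) inS by (intro B(2)[OF inS[OF \<sigma>]] imageI) (metis scaleR_scaleR)
    also have "\<dots> \<le> B' * norm (e (\<sigma> *\<^sub>R h))"
      using max[OF \<tau>(2)] B' by (intro mult_mono) (auto simp: B'_def)
    finally have "norm (DF (\<sigma> *\<^sub>R h) (u (\<tau> *\<^sub>R \<sigma> *\<^sub>R h, z)) (e (\<tau> *\<^sub>R \<sigma> *\<^sub>R h))) \<le> B' * norm (e (\<sigma> *\<^sub>R h))" .
    moreover have "\<bar>\<tau>\<bar> * c \<le> c" if "0 \<le> c" for c
      using \<tau>(1) that by (simp add: mult_left_le_one_le)
    ultimately show ?thesis unfolding norm_scaleR by (meson norm_ge_zero order_trans)
  qed
  from has_integral_bound[OF _ e_int[OF inS[OF \<sigma>]] this]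
  have "norm (e (\<sigma> *\<^sub>R h)) \<le> B' * norm (e (\<sigma> *\<^sub>R h))" using B' by simp
  then have "(1 - B') * norm (e (\<sigma> *\<^sub>R h)) \<le> 0" by (simp add: algebra_simps)
  then have "norm (e (\<sigma> *\<^sub>R h)) \<le> 0" using B' by (simp add: mult_le_0_iff)
  with max[of 1] have "e h = 0" by simp
  then show ?thesis
    using has_derivative_unique[OF D W[OF S0]] by (simp add: e_def)
qed

end

text \<open>
  The derivative is bounded near every point by the Cauchy inequality, hence the fields are
  locally Lipschitz; the constants are uniform in the coefficients \<open>h\<close>.
\<close>

lemma F_local_bounds:
  assumes z0: "z0 \<in> U"
  obtains R M L where "0 < R" "cball z0 R \<subseteq> U" "0 < M" "0 < L"
    "\<And>h y. y \<in> cball z0 R \<Longrightarrow> norm (F h y) \<le> norm h * M"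
    "\<And>h y k. y \<in> cball z0 R \<Longrightarrow> norm (DF h y k) \<le> norm h * L * norm k"
    "\<And>h y y'. y \<in> cball z0 R \<Longrightarrow> y' \<in> cball z0 R \<Longrightarrow>
      norm (F h y - F h y') \<le> norm h * L * norm (y - y')"
proof -
  obtain R1 M1 L1 where 1: "0 < R1" "cball z0 R1 \<subseteq> U" "0 \<le> M1" "0 \<le> L1"
    "\<And>y. y \<in> cball z0 R1 \<Longrightarrow> norm (f1 y) \<le> M1"
    "\<And>y v. y \<in> cball z0 R1 \<Longrightarrow> norm (D1 y v) \<le> L1 * norm v"
    by (rule vec.holo_local_bounds[OF f1 z0]) blast
  obtain R2 M2 L2 where 2: "0 < R2" "cball z0 R2 \<subseteq> U" "0 \<le> M2" "0 \<le> L2"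
    "\<And>y. y \<in> cball z0 R2 \<Longrightarrow> norm (f2 y) \<le> M2"
    "\<And>y v. y \<in> cball z0 R2 \<Longrightarrow> norm (D2 y v) \<le> L2 * norm v"
    by (rule vec.holo_local_bounds[OF f2 z0]) blast
  define R where "R = min R1 R2"
  define M where "M = M1 + M2 + 1"
  define L where "L = L1 + L2 + 1"
  have R: "0 < R" "cball z0 R \<subseteq> U" using 1 2 by (auto simp: R_def)
  have M: "0 < M" and L: "0 < L" using 1 2 by (auto simp: M_def L_def)
  have comp: "norm (h $ i) \<le> norm h" for h :: "complex ^ 2" and i
    by (rule Finite_Cartesian_Product.norm_nth_le)
  have F_bound: "norm (F h y) \<le> norm h * M" if "y \<in> cball z0 R" for h y
  proof -
    have "norm (F h y) \<le> norm (h $ 1) * norm (f1 y) + norm (h $ 2) * norm (f2 y)"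
      unfolding F_def by (rule order_trans[OF norm_triangle_ineq]) (simp add: norm_vector_smult)
    also have "\<dots> \<le> norm h * M1 + norm h * M2"
      using that by (intro add_mono mult_mono comp 1 2) (auto simp: R_def)
    also have "\<dots> \<le> norm h * M" by (simp add: M_def distrib_left)
    finally show ?thesis .
  qed
  have DF_bound: "norm (DF h y k) \<le> norm h * L * norm k" if "y \<in> cball z0 R" for h y k
  proof -
    have "norm (DF h y k) \<le> norm (h $ 1) * norm (D1 y k) + norm (h $ 2) * norm (D2 y k)"
      unfolding DF_def by (rule order_trans[OF norm_triangle_ineq]) (simp add: norm_vector_smult)
    also have "\<dots> \<le> norm h * (L1 * norm k) + norm h * (L2 * norm k)"
      using that by (intro add_mono mult_mono comp 1 2) (auto simp: R_def)
    also have "\<dots> \<le> norm h * L * norm k" by (simp add: L_def algebra_simps)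
    finally show ?thesis .
  qed
  have F_lip: "norm (F h y - F h y') \<le> norm h * L * norm (y - y')"
    if "y \<in> cball z0 R" "y' \<in> cball z0 R" for h y y'
  proof (rule differentiable_bound[where S = "cball z0 R" and f' = "\<lambda>w. DF h w", OF convex_cball _ _ that])
    show "(F h has_derivative DF h w) (at w within cball z0 R)" if "w \<in> cball z0 R" for w
      by (rule has_derivative_at_withinI[OF has_derivative_F[OF subsetD[OF R(2) that]]])
    show "onorm (DF h w) \<le> norm h * L" if "w \<in> cball z0 R" for w
      by (rule onorm_le) (rule DF_bound[OF that])
  qed
  show ?thesis by (rule that[OF R M L F_bound DF_bound F_lip])
qed

text \<open>
  Picard iteration starting with \<open>u (h, z) = z\<close>.  Joint holomorphy in time and
  initial point comes for free: each iterate is holomorphic and the convergence is uniform.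
\<close>

lemma local_flow:
  assumes z0: "z0 \<in> U"
  obtains \<epsilon> u where "0 < \<epsilon>" "pair.holo (ball 0 \<epsilon> \<times> ball z0 \<epsilon>) u"
    "u ` (ball 0 \<epsilon> \<times> ball z0 \<epsilon>) \<subseteq> U" "ball z0 \<epsilon> \<subseteq> U"
    "\<And>z. z \<in> ball z0 \<epsilon> \<Longrightarrow> u (0, z) = z"
    "\<And>h z D v. h \<in> ball 0 \<epsilon> \<Longrightarrow> z \<in> ball z0 \<epsilon> \<Longrightarrow> (u has_derivative D) (at (h, z)) \<Longrightarrow>
      D (v, 0) = F v (u (h, z))"
proof -
  obtain R M L where R: "0 < R" "cball z0 R \<subseteq> U" and M: "0 < M" and L: "0 < L"
    and F_bound: "\<And>h y. y \<in> cball z0 R \<Longrightarrow> norm (F h y) \<le> norm h * M"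
    and DF_bound: "\<And>h y k. y \<in> cball z0 R \<Longrightarrow> norm (DF h y k) \<le> norm h * L * norm k"
    and F_lip: "\<And>h y y'. y \<in> cball z0 R \<Longrightarrow> y' \<in> cball z0 R \<Longrightarrow>
      norm (F h y - F h y') \<le> norm h * L * norm (y - y')"
    using F_local_bounds[OF z0] by metis
  \<comment> \<open>The first two bounds keep the iterates inside \<open>cball z0 R\<close>, the third makes the Picard
    operator a contraction with factor one half.\<close>
  define \<epsilon> where "\<epsilon> = min (R / 2) (min (R / (2 * M)) (1 / (2 * L)))"
  have \<epsilon>: "0 < \<epsilon>" "\<epsilon> \<le> R / 2" "\<epsilon> * M \<le> R / 2" "\<epsilon> * L \<le> 1 / 2"
  proof -
    show "0 < \<epsilon>" "\<epsilon> \<le> R / 2" using R M L by (auto simp: \<epsilon>_def)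
    have "\<epsilon> * M \<le> R / (2 * M) * M" using M by (intro mult_right_mono) (auto simp: \<epsilon>_def)
    then show "\<epsilon> * M \<le> R / 2" using M by simp
    have "\<epsilon> * L \<le> 1 / (2 * L) * L" using L by (intro mult_right_mono) (auto simp: \<epsilon>_def)
    then show "\<epsilon> * L \<le> 1 / 2" using L by simp
  qed
  define S where "S = ball (0 :: complex ^ 2) \<epsilon> \<times> ball z0 \<epsilon>"
  have S: "open S" unfolding S_def by (intro open_Times open_ball)
  have star: "(\<tau> *\<^sub>R h, z) \<in> S" if "(h, z) \<in> S" "\<tau> \<in> {0..1}" for h z and \<tau> :: real
  proof -
    have "\<bar>\<tau>\<bar> * norm h \<le> norm h" using that(2) by (simp add: mult_left_le_one_le)
    then show ?thesis using that(1) by (auto simp: S_def)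
  qed
  have hbound: "norm h * M \<le> R / 2" "norm h * L \<le> 1 / 2" if "(h, z) \<in> S" for h z
  proof -
    have "norm h \<le> \<epsilon>" using that by (simp add: S_def)
    then have "norm h * M \<le> \<epsilon> * M" "norm h * L \<le> \<epsilon> * L" using M L by simp_all
    then show "norm h * M \<le> R / 2" "norm h * L \<le> 1 / 2" using \<epsilon> by auto
  qed
  define u where "u k = (picard ^^ k) snd" for k
  have u_Suc: "u (Suc k) = picard (u k)" for k by (simp add: u_def)
  have cont_int: "continuous_on {0..1} (\<lambda>\<tau>. F h (w (\<tau> *\<^sub>R h, z)))"
    if "pair.holo S w" "w ` S \<subseteq> U" "(h, z) \<in> S" for w h z
    using continuous_on_compose2[OF integrand_continuous[OF S star pair.holo_continuous_on[OF that(1)] that(2)],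
        of "{0..1}" "\<lambda>\<tau>. (\<tau>, h, z)"] that(3)
    by (simp add: continuous_on_Pair image_subset_iff)
  have step: "pair.holo S (u k) \<and> u k ` S \<subseteq> cball z0 R" for k
  proof (induction k)
    case 0
    have "pair.holo S snd"
      unfolding pair.holo_def using S by (auto intro!: exI[of _ snd] derivative_intros)
    moreover have "snd ` S \<subseteq> cball z0 R" using \<epsilon> R by (auto simp: S_def)
    ultimately show ?case by (simp add: u_def)
  next
    case (Suc k)
    then have h: "pair.holo S (u k)" and b: "u k ` S \<subseteq> cball z0 R" by auto
    have bU: "u k ` S \<subseteq> U" using b R by auto
    have "picard (u k) (h, z) \<in> cball z0 R" if hz: "(h, z) \<in> S" for h z
    proof -
      have "norm (integral {0..1} (\<lambda>\<tau>. F h (u k (\<tau> *\<^sub>R h, z)))) \<le> R / 2 * (1 - 0)"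
      proof (rule integral_bound[OF _ cont_int[OF h bU hz]])
        show "norm (F h (u k (\<tau> *\<^sub>R h, z))) \<le> R / 2" if "\<tau> \<in> {0..1}" for \<tau>
          using star[OF hz that] b hbound(1)[OF hz]
          by (intro order_trans[OF F_bound]) auto
      qed simp
      moreover have "dist z0 z \<le> R / 2" using hz \<epsilon> by (auto simp: S_def)
      moreover have "dist z0 (z + i) \<le> dist z0 z + norm i" for i
        using dist_triangle[of z0 "z + i" z] by (simp add: dist_norm)
      ultimately show ?thesis by (simp add: picard_def) (smt (verit) field_sum_of_halves)
    qed
    with picard_derivative(1)[OF S star h bU pair.holo_frechet(1)[OF h]] show ?case
      by (auto simp: u_Suc)
  qed
  then have uh: "pair.holo S (u k)" and ub: "u k ` S \<subseteq> cball z0 R" for k by auto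
  have uU: "u k ` S \<subseteq> U" for k using ub R by blast
  have picard_contract: "norm (picard w x - picard w' x) \<le> c / 2"
    if w: "pair.holo S w" "w ` S \<subseteq> cball z0 R" and w': "pair.holo S w'" "w' ` S \<subseteq> cball z0 R"
      and x: "x \<in> S" and c: "\<And>x. x \<in> S \<Longrightarrow> norm (w x - w' x) \<le> c" for w w' x c
  proof -
    obtain h z where hz: "x = (h, z)" "(h, z) \<in> S" using x by (cases x) auto
    have ci: "continuous_on {0..1} (\<lambda>\<tau>. F h (w (\<tau> *\<^sub>R h, z)))" "continuous_on {0..1} (\<lambda>\<tau>. F h (w' (\<tau> *\<^sub>R h, z)))"
      using cont_int[OF w(1) _ hz(2)] cont_int[OF w'(1) _ hz(2)] w(2) w'(2) R(2) by blast+
    have "picard w x - picard w' x = integral {0..1} (\<lambda>\<tau>. F h (w (\<tau> *\<^sub>R h, z)) - F h (w' (\<tau> *\<^sub>R h, z)))"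
      using ci by (simp add: picard_def hz(1) integral_diff integrable_continuous_real)
    also have "norm \<dots> \<le> (c / 2) * (1 - 0)"
    proof (rule integral_bound)
      fix \<tau> :: real assume \<tau>: "\<tau> \<in> {0..1}"
      note s = star[OF hz(2) \<tau>]
      have "norm (F h (w (\<tau> *\<^sub>R h, z)) - F h (w' (\<tau> *\<^sub>R h, z))) \<le>
          norm h * L * norm (w (\<tau> *\<^sub>R h, z) - w' (\<tau> *\<^sub>R h, z))"
        using s w(2) w'(2) by (intro F_lip) auto
      also have "\<dots> \<le> 1 / 2 * c"
        using hbound(2)[OF hz(2)] c[OF s] by (intro mult_mono) auto
      finally show "norm (F h (w (\<tau> *\<^sub>R h, z)) - F h (w' (\<tau> *\<^sub>R h, z))) \<le> c / 2" by simp
    qed (auto intro!: continuous_intros ci)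
    finally show ?thesis by simp
  qed
  have geo: "norm (u (Suc k) x - u k x) \<le> 2 * R * (1 / 2) ^ k" if "x \<in> S" for k x
    using that
  proof (induction k arbitrary: x)
    case 0
    have "u (Suc 0) x \<in> cball z0 R" "u 0 x \<in> cball z0 R" using ub 0 by blast+
    then have "dist (u (Suc 0) x) (u 0 x) \<le> R + R"
      by (intro order_trans[OF dist_triangle3[of _ _ z0]] add_mono) auto
    then show ?case by (simp add: dist_norm)
  next
    case (Suc k)
    have "norm (picard (u (Suc k)) x - picard (u k) x) \<le> 2 * R * (1 / 2) ^ k / 2"
      by (rule picard_contract[OF uh ub uh ub Suc.prems Suc.IH])
    then show ?case by (simp add: u_Suc)
  qed
  have "summable (\<lambda>k. 2 * R * (1 / 2) ^ k)" by (intro summable_mult summable_geometric) simp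
  from Weierstrass_m_test[OF geo this, of S "\<lambda>n x. x"]
  obtain d where d: "uniform_limit S (\<lambda>n x. \<Sum>i<n. u (Suc i) x - u i x) d sequentially" by blast
  define v where "v x = d x + u 0 x" for x
  have lim: "uniform_limit S u v sequentially"
  proof -
    have "uniform_limit S (\<lambda>n x. (\<Sum>i<n. u (Suc i) x - u i x) + u 0 x) v sequentially"
      unfolding v_def by (intro uniform_limit_add d uniform_limit_const)
    moreover have "(\<Sum>i<n. u (Suc i) x - u i x) + u 0 x = u n x" for n x
      using sum_lessThan_telescope[of "\<lambda>i. u i x" n] by simp
    ultimately show ?thesis by simp
  qed
  have vh: "pair.holo S v" by (rule pair.holo_uniform_limit[OF S uh lim])
  have pw: "(\<lambda>k. u k x) \<longlonglongrightarrow> v x" if "x \<in> S" for x by (rule tendsto_uniform_limitI[OF lim that])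
  have vb: "v ` S \<subseteq> cball z0 R"
  proof clarify
    fix h z assume "(h, z) \<in> S"
    with ub show "v (h, z) \<in> cball z0 R"
      by (intro closed_sequentially[OF closed_cball _ pw]) blast+
  qed
  have fixed: "picard v x = v x" if x: "x \<in> S" for x
  proof (rule LIMSEQ_unique)
    show "(\<lambda>k. u (Suc k) x) \<longlonglongrightarrow> v x" by (rule LIMSEQ_Suc[OF pw[OF x]])
    show "(\<lambda>k. u (Suc k) x) \<longlonglongrightarrow> picard v x"
    proof (rule metric_LIMSEQ_I)
      fix e :: real assume e: "0 < e"
      obtain N where N: "\<And>k x. k \<ge> N \<Longrightarrow> x \<in> S \<Longrightarrow> dist (u k x) (v x) < e"
        using uniform_limitD[OF lim e] unfolding eventually_sequentially by blast
      have "dist (u (Suc k) x) (picard v x) < e" if "k \<ge> N" for k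
      proof -
        have "norm (picard (u k) x - picard v x) \<le> e / 2"
          using N[OF that] by (intro picard_contract[OF uh ub vh vb x]) (simp add: dist_norm less_imp_le)
        then show ?thesis using e by (simp add: u_Suc dist_norm)
      qed
      then show "\<exists>N. \<forall>k\<ge>N. dist (u (Suc k) x) (picard v x) < e" by blast
    qed
  qed
  show ?thesis
  proof
    show "0 < \<epsilon>" by (rule \<epsilon>(1))
    show "pair.holo (ball 0 \<epsilon> \<times> ball z0 \<epsilon>) v" using vh by (simp add: S_def)
    show "v ` (ball 0 \<epsilon> \<times> ball z0 \<epsilon>) \<subseteq> U" using vb R by (auto simp: S_def)
    show "ball z0 \<epsilon> \<subseteq> U" using \<epsilon> R by (intro order_trans[OF _ R(2)]) (auto simp: ball_subset_cball_iff)
    show "v (0, z) = z" if "z \<in> ball z0 \<epsilon>" for z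
      using fixed[of "(0, z)"] that \<epsilon> by (simp add: S_def picard_def F_0)
    show "D (k, 0) = F k (v (h, z))"
      if "h \<in> ball 0 \<epsilon>" "z \<in> ball z0 \<epsilon>" "(v has_derivative D) (at (h, z))" for h z D k
    proof (rule picard_fixed_point_derivative[OF S star vh _ fixed _ _ _ that(3), of "1 / 2"])
      show "norm (DF h y k) \<le> 1 / 2 * norm k" if "(h, z) \<in> S" "y \<in> v ` S" for h z y k
        using DF_bound[of y h k] that(2) vb mult_right_mono[OF hbound(2)[OF that(1)], of "norm k"]
        by force
    qed (use that vb R in \<open>auto simp: S_def\<close>)
  qed
qed

end

section \<open>Solutions on a complex manifold\<close>

text \<open>
  One notion covers integral curves in real and in complex time as well as orbit maps with
  several times: the time space \<open>'e\<close> is real, and \<open>F h\<close> is the field followed in the direction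
  \<open>h\<close>.  Connectedness of the domain is left out, so that solutions can be localized.
\<close>

definition integral_map :: "('m::topological_space, 'n::finite) chart set \<Rightarrow>
    ('e::euclidean_space \<Rightarrow> ('m, 'n) vfield) \<Rightarrow> 'e set \<Rightarrow> ('e \<Rightarrow> 'm) \<Rightarrow> bool"
  where "integral_map A F V \<phi> \<longleftrightarrow> open V \<and> continuous_on V \<phi> \<and> \<phi> ` V \<subseteq> points A \<and>
    (\<forall>T\<in>V. \<forall>c\<in>A. \<phi> T \<in> fst c \<longrightarrow>
      ((\<lambda>s. snd c (\<phi> s)) has_derivative (\<lambda>h. F h c (\<phi> T))) (at T))"

definition span_field :: "('m, 'n::finite) vfield \<Rightarrow> ('m, 'n) vfield \<Rightarrow>
    ('e \<Rightarrow> complex ^ 2) \<Rightarrow> 'e \<Rightarrow> ('m, 'n) vfield"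
  where "span_field X Y L h c p = L h $ 1 *s X c p + L h $ 2 *s Y c p"

definition escapes :: "('m::topological_space, 'n::finite) chart set \<Rightarrow>
    'e::euclidean_space set \<Rightarrow> ('e \<Rightarrow> 'm) \<Rightarrow> bool"
  where "escapes A V \<phi> \<longleftrightarrow> (\<forall>T a. (\<forall>i. T i \<in> V) \<and> T \<longlonglongrightarrow> a \<and> a \<in> frontier V \<longrightarrow>
    leaves_compacts A (\<lambda>i. \<phi> (T i)))"

text \<open>
  The range of a convergent sequence together with its limit is compact.
\<close>

lemma leaves_compacts_no_limit:
  fixes x :: "nat \<Rightarrow> 'm::topological_space"
  assumes lc: "leaves_compacts A x" and x: "\<And>i. x i \<in> points A" and q: "q \<in> points A"
  shows "\<not> x \<longlonglongrightarrow> q"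
proof
  assume lim: "x \<longlonglongrightarrow> q"
  have "compact (insert q (range x))"
  proof (rule compactI)
    fix \<C> assume C: "\<forall>t\<in>\<C>. open t" "insert q (range x) \<subseteq> \<Union>\<C>"
    then obtain t where t: "t \<in> \<C>" "q \<in> t" by blast
    obtain N where N: "\<And>i. i \<ge> N \<Longrightarrow> x i \<in> t"
      using topological_tendstoD[OF lim, of t] C t unfolding eventually_sequentially by blast
    have "\<forall>i. \<exists>t\<in>\<C>. x i \<in> t" using C(2) by blast
    then obtain f where f: "\<And>i. f i \<in> \<C>" "\<And>i. x i \<in> f i" by metis
    have "insert q (range x) \<subseteq> \<Union>(insert t (f ` {..<N}))"
    proof
      fix y assume "y \<in> insert q (range x)"
      then consider "y = q" | i where "y = x i" "i \<ge> N" | i where "y = x i" "i < N" by force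
      then show "y \<in> \<Union>(insert t (f ` {..<N}))"
        using t N f by cases auto
    qed
    then show "\<exists>\<C>'\<subseteq>\<C>. finite \<C>' \<and> insert q (range x) \<subseteq> \<Union>\<C>'"
      using t f by (intro exI[of _ "insert t (f ` {..<N})"]) auto
  qed
  moreover have "insert q (range x) \<subseteq> points A" using x q by auto
  ultimately have "\<forall>\<^sub>F i in sequentially. x i \<notin> insert q (range x)"
    using lc unfolding leaves_compacts_def by blast
  then show False by simp
qed

text \<open>
  Second countability makes compact sets sequentially compact, so failure to leave
  compact sets produces an accumulation point in the manifold.
\<close>

lemma not_leaves_compacts_subseq:
  fixes x :: "nat \<Rightarrow> 'm::{t2_space, second_countable_topology}"
  assumes "\<not> leaves_compacts A x"
  obtains r q where "strict_mono r" "q \<in> points A" "(x \<circ> r) \<longlonglongrightarrow> q"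
proof -
  obtain K where K: "compact K" "K \<subseteq> points A" "\<exists>\<^sub>F i in sequentially. x i \<in> K"
    using assms unfolding leaves_compacts_def frequently_def by blast
  then have "infinite {i. x i \<in> K}"
    by (simp add: INFM_nat_le frequently_cofinite[symmetric] cofinite_eq_sequentially)
  then have "\<exists>r::nat \<Rightarrow> nat. strict_mono r \<and> (\<forall>n. r n \<in> {i. x i \<in> K})"
    by (rule infinite_enumerate)
  then obtain r :: "nat \<Rightarrow> nat" where r: "strict_mono r" "\<And>n. x (r n) \<in> K" by auto
  obtain q s where s: "q \<in> K" "strict_mono s" "((x \<circ> r) \<circ> s) \<longlonglongrightarrow> q"
    using seq_compactE[OF compact_imp_seq_compact[OF K(1)], of "x \<circ> r"] r(2) by auto
  show ?thesis
    by (rule that[of "r \<circ> s" q]) (use s K r in \<open>auto simp: o_assoc strict_mono_o\<close>)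
qed

locale commuting_pair =
  fixes A :: "('m::{t2_space, second_countable_topology}, 'n::finite) chart set"
    and X Y :: "('m, 'n) vfield"
  assumes manifold: "complex_manifold A"
    and X: "holomorphic_vector_field A X" and Y: "holomorphic_vector_field A Y"
    and XY: "commuting A X Y"
begin

abbreviation sol :: "('e::euclidean_space \<Rightarrow> complex ^ 2) \<Rightarrow> 'e set \<Rightarrow> ('e \<Rightarrow> 'm) \<Rightarrow> bool"
  where "sol L \<equiv> integral_map A (span_field X Y L)"

lemma open_chart: "c \<in> A \<Longrightarrow> open (fst c)"
  and open_chart_image: "c \<in> A \<Longrightarrow> open (snd c ` fst c)"
  and homeo_chart: "c \<in> A \<Longrightarrow> homeomorphism (fst c) (snd c ` fst c) (snd c) (chart_inv c)"
  using manifold by (auto simp: complex_manifold_def)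

lemma chart_inv_chart: "c \<in> A \<Longrightarrow> p \<in> fst c \<Longrightarrow> chart_inv c (snd c p) = p"
  using homeo_chart homeomorphism_apply1 by fastforce

lemma chart_chart_inv: "z \<in> snd c ` fst c \<Longrightarrow> snd c (chart_inv c z) = z"
  by (rule f_inv_into_f)

lemma chart_inv_in: "z \<in> snd c ` fst c \<Longrightarrow> chart_inv c z \<in> fst c"
  by (rule inv_into_into)

lemma continuous_chart: "c \<in> A \<Longrightarrow> continuous_on (fst c) (snd c)"
  using homeo_chart homeomorphism_cont1 by blast

lemma continuous_chart_inv: "c \<in> A \<Longrightarrow> continuous_on (snd c ` fst c) (chart_inv c)"
  using homeo_chart homeomorphism_cont2 by blast

lemma in_points: "c \<in> A \<Longrightarrow> p \<in> fst c \<Longrightarrow> p \<in> points A"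
  by (auto simp: points_def)

lemma transition_holo:
  "c \<in> A \<Longrightarrow> d \<in> A \<Longrightarrow> vec.holo (snd c ` (fst c \<inter> fst d)) (snd d \<circ> chart_inv c)"
  using manifold by (simp add: complex_manifold_def holomorphic_map_on_iff_holo)

lemma transition_derivative:
  assumes "c \<in> A" "d \<in> A" "p \<in> fst c" "p \<in> fst d"
  shows "((snd d \<circ> chart_inv c) has_derivative
      frechet_derivative (snd d \<circ> chart_inv c) (at (snd c p))) (at (snd c p))"
    and "frechet_derivative (snd d \<circ> chart_inv c) (at (snd c p)) (a *s v) =
      a *s frechet_derivative (snd d \<circ> chart_inv c) (at (snd c p)) v"
  using vec.holo_frechet[OF transition_holo[OF assms(1,2)], of "snd c p"] assms(3,4) by auto

lemma span_field_transition:
  assumes "c \<in> A" "d \<in> A" "p \<in> fst c" "p \<in> fst d"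
  shows "frechet_derivative (snd d \<circ> chart_inv c) (at (snd c p)) (span_field X Y L h c p) =
    span_field X Y L h d p"
proof -
  have "X d p = frechet_derivative (snd d \<circ> chart_inv c) (at (snd c p)) (X c p)"
    "Y d p = frechet_derivative (snd d \<circ> chart_inv c) (at (snd c p)) (Y c p)"
    using X Y assms unfolding holomorphic_vector_field_def tangent_field_def by blast+
  then show ?thesis
    using linear_simps(1)[OF has_derivative_bounded_linear[OF transition_derivative(1)[OF assms]]]
    by (simp add: span_field_def transition_derivative(2)[OF assms])
qed

text \<open>
  The equation needs to be verified in one chart around each value only, since vector fields
  and derivatives transform alike under the transition maps.
\<close>

lemma solI:
  assumes V: "open V" and cont: "continuous_on V \<phi>" and im: "\<phi> ` V \<subseteq> points A"
    and der: "\<And>T. T \<in> V \<Longrightarrow> \<exists>c\<in>A. \<phi> T \<in> fst c \<and>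
      ((\<lambda>s. snd c (\<phi> s)) has_derivative (\<lambda>h. span_field X Y L h c (\<phi> T))) (at T)"
  shows "sol L V \<phi>"
  unfolding integral_map_def
proof (intro conjI ballI impI V cont im)
  fix T d assume T: "T \<in> V" and d: "d \<in> A" "\<phi> T \<in> fst d"
  obtain c where c: "c \<in> A" "\<phi> T \<in> fst c"
    and D: "((\<lambda>s. snd c (\<phi> s)) has_derivative (\<lambda>h. span_field X Y L h c (\<phi> T))) (at T)"
    using der[OF T] by blast
  have "((\<lambda>s. (snd d \<circ> chart_inv c) (snd c (\<phi> s))) has_derivative
      (\<lambda>h. frechet_derivative (snd d \<circ> chart_inv c) (at (snd c (\<phi> T))) (span_field X Y L h c (\<phi> T)))) (at T)"
    by (rule has_derivative_compose[OF D transition_derivative(1)[OF c(1) d(1) c(2) d(2)]])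
  then have "((\<lambda>s. (snd d \<circ> chart_inv c) (snd c (\<phi> s))) has_derivative
      (\<lambda>h. span_field X Y L h d (\<phi> T))) (at T)"
    by (simp only: span_field_transition[OF c(1) d(1) c(2) d(2)])
  moreover have "open (\<phi> -` fst c \<inter> V)"
    using continuous_open_preimage[OF cont V open_chart[OF c(1)]] by (simp add: Int_commute)
  ultimately show "((\<lambda>s. snd d (\<phi> s)) has_derivative (\<lambda>h. span_field X Y L h d (\<phi> T))) (at T)"
    by (rule has_derivative_transform_within_open) (use T c in \<open>auto simp: chart_inv_chart\<close>)
qed

lemma sol_subset: "sol L V \<phi> \<Longrightarrow> open W \<Longrightarrow> W \<subseteq> V \<Longrightarrow> sol L W \<phi>"
  unfolding integral_map_def by (blast intro: continuous_on_subset)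

lemma sol_open: "sol L V \<phi> \<Longrightarrow> open V"
  and sol_continuous: "sol L V \<phi> \<Longrightarrow> continuous_on V \<phi>"
  and sol_points: "sol L V \<phi> \<Longrightarrow> T \<in> V \<Longrightarrow> \<phi> T \<in> points A"
  and sol_derivative: "sol L V \<phi> \<Longrightarrow> T \<in> V \<Longrightarrow> c \<in> A \<Longrightarrow> \<phi> T \<in> fst c \<Longrightarrow>
    ((\<lambda>s. snd c (\<phi> s)) has_derivative (\<lambda>h. span_field X Y L h c (\<phi> T))) (at T)"
  unfolding integral_map_def by blast+

lemma sol_local:
  assumes V: "open V" and loc: "\<And>T. T \<in> V \<Longrightarrow> \<exists>N \<psi>. T \<in> N \<and> N \<subseteq> V \<and> sol L N \<psi> \<and> (\<forall>s\<in>N. \<phi> s = \<psi> s)"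
  shows "sol L V \<phi>"
proof (rule solI[OF V])
  have nb: "isCont \<phi> T \<and> \<phi> T \<in> points A \<and> (\<exists>c\<in>A. \<phi> T \<in> fst c \<and>
      ((\<lambda>s. snd c (\<phi> s)) has_derivative (\<lambda>h. span_field X Y L h c (\<phi> T))) (at T))"
    if T: "T \<in> V" for T
  proof -
    obtain N \<psi> where N: "T \<in> N" "N \<subseteq> V" "sol L N \<psi>" and eq: "\<And>s. s \<in> N \<Longrightarrow> \<phi> s = \<psi> s"
      using loc[OF T] by blast
    note op = sol_open[OF N(3)]
    have "continuous_on N \<phi>" using sol_continuous[OF N(3)] by (simp add: eq cong: continuous_on_cong)
    then have "isCont \<phi> T" using op N(1) continuous_on_eq_continuous_at by blast
    moreover obtain c where c: "c \<in> A" "\<psi> T \<in> fst c"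
      using sol_points[OF N(3,1)] by (auto simp: points_def)
    have "((\<lambda>s. snd c (\<phi> s)) has_derivative (\<lambda>h. span_field X Y L h c (\<psi> T))) (at T)"
      by (rule has_derivative_transform_within_open[OF sol_derivative[OF N(3,1) c] op N(1)])
        (simp add: eq)
    ultimately show ?thesis using c eq[OF N(1)] in_points by auto
  qed
  show "continuous_on V \<phi>" using nb by (simp add: continuous_at_imp_continuous_on)
  show "\<phi> ` V \<subseteq> points A" using nb by blast
  show "\<exists>c\<in>A. \<phi> T \<in> fst c \<and>
      ((\<lambda>s. snd c (\<phi> s)) has_derivative (\<lambda>h. span_field X Y L h c (\<phi> T))) (at T)" if "T \<in> V" for T
    using nb[OF that] by blast
qed

lemma sol_cong:
  assumes "sol L V \<psi>" "\<And>s. s \<in> V \<Longrightarrow> \<phi> s = \<psi> s"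
  shows "sol L V \<phi>"
  using assms by (intro sol_local[OF sol_open[OF assms(1)]] exI[of _ V] exI[of _ \<psi>]) auto

text \<open>
  Affine changes of time.  Translations move the base point, embeddings restrict a solution to
  fewer time directions, and isomorphisms pass between \<open>\<complex>\<close> and \<open>\<real> \<times> \<real>\<close>.
\<close>

lemma sol_affine:
  assumes \<phi>: "sol L V \<phi>" and K: "bounded_linear K" and L': "\<And>h. L (K h) = L' h"
  shows "sol L' ((\<lambda>s. K s + b) -` V) (\<lambda>s. \<phi> (K s + b))"
proof (rule solI)
  have cK: "continuous_on S (\<lambda>s. K s + b)" for S
    by (intro continuous_intros bounded_linear.continuous_on[OF K])
  show "open ((\<lambda>s. K s + b) -` V)" by (rule open_vimage[OF sol_open[OF \<phi>] cK])
  show "continuous_on ((\<lambda>s. K s + b) -` V) (\<lambda>s. \<phi> (K s + b))"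
    by (rule continuous_on_compose2[OF sol_continuous[OF \<phi>] cK]) auto
  show "(\<lambda>s. \<phi> (K s + b)) ` ((\<lambda>s. K s + b) -` V) \<subseteq> points A" using sol_points[OF \<phi>] by auto
  fix T assume "T \<in> (\<lambda>s. K s + b) -` V"
  then have T: "K T + b \<in> V" by simp
  obtain c where c: "c \<in> A" "\<phi> (K T + b) \<in> fst c"
    using sol_points[OF \<phi> T] by (auto simp: points_def)
  have "((\<lambda>s. K s + b) has_derivative (\<lambda>h. K h + 0)) (at T)"
    by (intro derivative_intros bounded_linear.has_derivative[OF K])
  from has_derivative_compose[OF this sol_derivative[OF \<phi> T c]]
  have "((\<lambda>s. snd c (\<phi> (K s + b))) has_derivative (\<lambda>h. span_field X Y L' h c (\<phi> (K T + b)))) (at T)"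
    by (simp add: span_field_def L')
  with c show "\<exists>c\<in>A. \<phi> (K T + b) \<in> fst c \<and>
      ((\<lambda>s. snd c (\<phi> (K s + b))) has_derivative (\<lambda>h. span_field X Y L' h c (\<phi> (K T + b)))) (at T)"
    by blast
qed

lemma sol_translate: "sol L V \<phi> \<Longrightarrow> sol L ((\<lambda>s. s + b) -` V) (\<lambda>s. \<phi> (s + b))"
  using sol_affine[of L V \<phi> "\<lambda>s. s" L b] by (simp add: bounded_linear_ident)

lemma local_rep_chart: "c \<in> A \<Longrightarrow> p \<in> fst c \<Longrightarrow> local_rep Z c (snd c p) = Z c p"
  by (simp add: local_rep_def chart_inv_chart)

subsection \<open>Uniqueness\<close>

lemma chart_fields:
  assumes c: "c \<in> A"
  shows "commuting_fields (snd c ` fst c) (local_rep X c) (local_rep Y c)"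
proof
  show "vec.holo (snd c ` fst c) (local_rep X c)" "vec.holo (snd c ` fst c) (local_rep Y c)"
    using X Y c by (auto simp: holomorphic_vector_field_def holomorphic_map_on_iff_holo)
  fix y assume "y \<in> snd c ` fst c"
  then obtain p where p: "p \<in> fst c" "y = snd c p" by blast
  have "lie_bracket X Y c p = 0" using XY c p(1) by (simp add: commuting_def)
  then show "frechet_derivative (local_rep Y c) (at y) (local_rep X c y) =
      frechet_derivative (local_rep X c) (at y) (local_rep Y c y)"
    using p(1) c by (simp add: lie_bracket_def p(2) local_rep_chart)
qed

text \<open>
  In a chart the difference of two solutions has derivative bounded by its own size.  On a
  ball of radius at most \<open>1 / (2 * K * Lc)\<close>, with \<open>K\<close> a bound for \<open>L\<close> and \<open>Lc\<close> a Lipschitz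
  constant of the field, its maximum is at most half of itself.
\<close>

lemma sol_unique_local:
  assumes L: "bounded_linear L" and \<phi>: "sol L V \<phi>" and \<psi>: "sol L V \<psi>"
    and T: "T \<in> V" and eq: "\<phi> T = \<psi> T"
  obtains \<delta> where "0 < \<delta>" "ball T \<delta> \<subseteq> V" "\<And>s. s \<in> ball T \<delta> \<Longrightarrow> \<phi> s = \<psi> s"
proof -
  obtain c where c: "c \<in> A" "\<phi> T \<in> fst c"
    using sol_points[OF \<phi> T] by (auto simp: points_def)
  interpret C: commuting_fields "snd c ` fst c" "local_rep X c" "local_rep Y c"
    by (rule chart_fields[OF c(1)])
  have F: "span_field X Y L h c p = C.F (L h) (snd c p)" if "p \<in> fst c" for h p
    by (simp add: span_field_def C.F_def local_rep_chart[OF c(1) that])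
  obtain R M Lc where R: "0 < R" "cball (snd c (\<phi> T)) R \<subseteq> snd c ` fst c" and Lc: "0 < Lc"
    and lip: "\<And>h y y'. y \<in> cball (snd c (\<phi> T)) R \<Longrightarrow> y' \<in> cball (snd c (\<phi> T)) R \<Longrightarrow>
      norm (C.F h y - C.F h y') \<le> norm h * Lc * norm (y - y')"
    using C.F_local_bounds[of "snd c (\<phi> T)"] c(2) by (metis imageI)
  obtain K where K: "0 < K" "\<And>h. norm (L h) \<le> norm h * K"
    using bounded_linear.pos_bounded[OF L] by blast
  define N where "N = {s \<in> V. \<phi> s \<in> fst c \<and> snd c (\<phi> s) \<in> ball (snd c (\<phi> T)) R} \<inter>
    {s \<in> V. \<psi> s \<in> fst c \<and> snd c (\<psi> s) \<in> ball (snd c (\<phi> T)) R}"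
  have op: "open {s \<in> V. \<theta> s \<in> fst c \<and> snd c (\<theta> s) \<in> ball (snd c (\<phi> T)) R}" if \<theta>: "sol L V \<theta>" for \<theta>
  proof -
    have 1: "open (V \<inter> \<theta> -` fst c)"
      by (rule continuous_open_preimage[OF sol_continuous[OF \<theta>] sol_open[OF \<theta>] open_chart[OF c(1)]])
    have 2: "continuous_on (V \<inter> \<theta> -` fst c) (\<lambda>s. snd c (\<theta> s))"
      by (rule continuous_on_compose2[OF continuous_chart[OF c(1)]
            continuous_on_subset[OF sol_continuous[OF \<theta>]]]) auto
    have "open ((V \<inter> \<theta> -` fst c) \<inter> (\<lambda>s. snd c (\<theta> s)) -` ball (snd c (\<phi> T)) R)"
      by (rule continuous_open_preimage[OF 2 1 open_ball])
    moreover have "(V \<inter> \<theta> -` fst c) \<inter> (\<lambda>s. snd c (\<theta> s)) -` ball (snd c (\<phi> T)) R =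
        {s \<in> V. \<theta> s \<in> fst c \<and> snd c (\<theta> s) \<in> ball (snd c (\<phi> T)) R}" by auto
    ultimately show ?thesis by simp
  qed
  have "open N" unfolding N_def by (intro open_Int op \<phi> \<psi>)
  moreover have "T \<in> N" using T c R eq by (simp add: N_def)
  ultimately obtain \<delta>0 where \<delta>0: "0 < \<delta>0" "cball T \<delta>0 \<subseteq> N"
    using open_contains_cball by blast
  define \<delta> where "\<delta> = min \<delta>0 (1 / (2 * K * Lc))"
  have \<delta>: "0 < \<delta>" "cball T \<delta> \<subseteq> N" "K * Lc * \<delta> \<le> 1 / 2"
  proof -
    show "0 < \<delta>" using \<delta>0 K Lc by (simp add: \<delta>_def)
    show "cball T \<delta> \<subseteq> N" using \<delta>0 by (auto simp: \<delta>_def)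
    have "K * Lc * \<delta> \<le> K * Lc * (1 / (2 * K * Lc))"
      using K Lc by (intro mult_left_mono) (auto simp: \<delta>_def)
    then show "K * Lc * \<delta> \<le> 1 / 2" using K Lc by simp
  qed
  define d where "d s = snd c (\<phi> s) - snd c (\<psi> s)" for s
  have der: "(d has_derivative (\<lambda>h. C.F (L h) (snd c (\<phi> s)) - C.F (L h) (snd c (\<psi> s)))) (at s)"
    if "s \<in> N" for s
    using that has_derivative_diff[OF sol_derivative[OF \<phi>, of s c] sol_derivative[OF \<psi>, of s c]]
    unfolding d_def by (simp add: N_def c F)
  have "continuous_on (cball T \<delta>) d"
    using \<delta>(2) by (intro continuous_at_imp_continuous_on ballI has_derivative_continuous[OF der]) blast
  then have "continuous_on (cball T \<delta>) (\<lambda>s. norm (d s))" by (intro continuous_intros)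
  then obtain s1 where s1: "s1 \<in> cball T \<delta>" and max: "\<And>s. s \<in> cball T \<delta> \<Longrightarrow> norm (d s) \<le> norm (d s1)"
    using continuous_attains_sup[OF compact_cball, of T \<delta> "\<lambda>s. norm (d s)"] \<delta>(1) by force
  have "norm (d s1 - d T) \<le> (K * Lc * norm (d s1)) * norm (s1 - T)"
  proof (rule differentiable_bound[where S = "cball T \<delta>" and
        f' = "\<lambda>s h. C.F (L h) (snd c (\<phi> s)) - C.F (L h) (snd c (\<psi> s))"])
    show "(d has_derivative (\<lambda>h. C.F (L h) (snd c (\<phi> s)) - C.F (L h) (snd c (\<psi> s)))) (at s within cball T \<delta>)"
      if "s \<in> cball T \<delta>" for s
      by (rule has_derivative_at_withinI[OF der[OF subsetD[OF \<delta>(2) that]]])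
    show "onorm (\<lambda>h. C.F (L h) (snd c (\<phi> s)) - C.F (L h) (snd c (\<psi> s))) \<le> K * Lc * norm (d s1)"
      if s: "s \<in> cball T \<delta>" for s
    proof (rule onorm_le)
      fix h
      have "s \<in> N" using s \<delta>(2) by blast
      then have "norm (C.F (L h) (snd c (\<phi> s)) - C.F (L h) (snd c (\<psi> s))) \<le> norm (L h) * Lc * norm (d s)"
        unfolding d_def by (intro lip) (auto simp: N_def)
      also have "\<dots> \<le> (norm h * K) * Lc * norm (d s1)"
        using K Lc max[OF s] by (intro mult_mono) auto
      finally show "norm (C.F (L h) (snd c (\<phi> s)) - C.F (L h) (snd c (\<psi> s))) \<le> K * Lc * norm (d s1) * norm h"
        by (simp add: ac_simps)
    qed
  qed (use s1 \<delta> in auto)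
  also have "\<dots> \<le> (K * Lc * norm (d s1)) * \<delta>"
    using s1 K Lc by (intro mult_left_mono) (auto simp: dist_norm norm_minus_commute)
  also have "\<dots> = (K * Lc * \<delta>) * norm (d s1)" by simp
  also have "\<dots> \<le> 1 / 2 * norm (d s1)" by (intro mult_right_mono \<delta>) simp
  finally have "norm (d s1) \<le> 0" by (simp add: d_def eq)
  then have d0: "d s = 0" if "s \<in> cball T \<delta>" for s using max[OF that] by simp
  have "\<phi> s = \<psi> s" if "s \<in> ball T \<delta>" for s
  proof -
    have s: "s \<in> cball T \<delta>" using that by auto
    then have "s \<in> N" using \<delta>(2) by blast
    then have "\<phi> s \<in> fst c" "\<psi> s \<in> fst c" by (auto simp: N_def)
    moreover have "snd c (\<phi> s) = snd c (\<psi> s)" using d0[OF s] by (simp add: d_def)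
    ultimately show ?thesis using chart_inv_chart[OF c(1)] by metis
  qed
  moreover have "ball T \<delta> \<subseteq> V"
  proof -
    have "N \<subseteq> V" by (auto simp: N_def)
    then show ?thesis using \<delta>(2) ball_subset_cball by blast
  qed
  ultimately show ?thesis by (rule that[OF \<delta>(1), rotated])
qed

text \<open>
  The set where two solutions agree is open by local uniqueness.  It is closed in \<open>V'\<close> by
  the Hausdorff property, provided that the domain \<open>V\<close> of the other solution is not left;
  this is the last hypothesis.
\<close>

lemma sol_agree:
  assumes L: "bounded_linear L" and \<phi>: "sol L V \<phi>" and \<psi>: "sol L V' \<psi>" and V': "connected V'"
    and T: "T \<in> V" "T \<in> V'" "\<phi> T = \<psi> T"
    and cl: "\<And>a x. a \<in> V' \<Longrightarrow> x \<longlonglongrightarrow> a \<Longrightarrow> (\<And>i. x i \<in> V \<inter> V' \<and> \<phi> (x i) = \<psi> (x i)) \<Longrightarrow> a \<in> V"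
  shows "V' \<subseteq> V" and "s \<in> V' \<Longrightarrow> \<phi> s = \<psi> s"
proof -
  define W where "W = {s \<in> V \<inter> V'. \<phi> s = \<psi> s}"
  have opVV: "open (V \<inter> V')" using sol_open[OF \<phi>] sol_open[OF \<psi>] by (rule open_Int)
  have "open W"
    unfolding open_contains_ball
  proof
    fix a assume "a \<in> W"
    then have a: "a \<in> V \<inter> V'" "\<phi> a = \<psi> a" by (auto simp: W_def)
    obtain \<delta> where "0 < \<delta>" "ball a \<delta> \<subseteq> V \<inter> V'" "\<And>s. s \<in> ball a \<delta> \<Longrightarrow> \<phi> s = \<psi> s"
      by (rule sol_unique_local[OF L sol_subset[OF \<phi> opVV Int_lower1] sol_subset[OF \<psi> opVV Int_lower2] a])
        blast
    then show "\<exists>\<delta>>0. ball a \<delta> \<subseteq> W" unfolding W_def by blast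
  qed
  then have "openin (top_of_set V') W"
    using sol_open[OF \<psi>] by (simp add: openin_open_eq) (auto simp: W_def)
  moreover have "closedin (top_of_set V') W"
    unfolding closedin_limpt
  proof (intro conjI allI impI)
    show "W \<subseteq> V'" by (auto simp: W_def)
    fix a assume a: "a islimpt W \<and> a \<in> V'"
    then obtain x where x: "\<And>i. x i \<in> W" "x \<longlonglongrightarrow> a"
      unfolding islimpt_sequential by auto
    have aV: "a \<in> V" by (rule cl[of a x]) (use a x in \<open>auto simp: W_def\<close>)
    have "isCont \<phi> a" "isCont \<psi> a"
      using sol_continuous[OF \<phi>] sol_open[OF \<phi>] sol_continuous[OF \<psi>] sol_open[OF \<psi>] aV a
      by (auto simp: continuous_on_eq_continuous_at)
    then have "(\<lambda>i. \<phi> (x i)) \<longlonglongrightarrow> \<phi> a" "(\<lambda>i. \<psi> (x i)) \<longlonglongrightarrow> \<psi> a"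
      using x(2) isCont_tendsto_compose by blast+
    moreover have "(\<lambda>i. \<phi> (x i)) = (\<lambda>i. \<psi> (x i))" using x(1) by (auto simp: W_def)
    ultimately have "\<phi> a = \<psi> a" using LIMSEQ_unique by metis
    then show "a \<in> W" using aV a by (simp add: W_def)
  qed
  ultimately have "W = V'"
    using V' T unfolding connected_clopen W_def by blast
  then show "V' \<subseteq> V" "s \<in> V' \<Longrightarrow> \<phi> s = \<psi> s" unfolding W_def by auto
qed

lemma sol_unique:
  assumes "bounded_linear L" "sol L V \<phi>" "sol L W \<psi>" "open V'" "V' \<subseteq> V" "V' \<subseteq> W"
    "connected V'" "T \<in> V'" "\<phi> T = \<psi> T" "s \<in> V'"
  shows "\<phi> s = \<psi> s"
  using sol_agree(2)[OF assms(1) sol_subset[OF assms(2,4,5)] sol_subset[OF assms(3,4,6)] assms(7)] assms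
  by blast

text \<open>
  The escape condition makes a solution maximal among all connected competitors: a
  competitor is defined and continuous at the point where it would leave \<open>V\<close>, so the
  values along an approaching sequence converge instead of escaping.
\<close>

lemma escapes_dominates:
  assumes L: "bounded_linear L" and \<phi>: "sol L V \<phi>" and esc: "escapes A V \<phi>"
    and \<psi>: "sol L V' \<psi>" and V': "connected V'"
    and T: "T \<in> V" "T \<in> V'" "\<phi> T = \<psi> T"
  shows "V' \<subseteq> V" and "s \<in> V' \<Longrightarrow> \<phi> s = \<psi> s"
proof -
  have cl: "a \<in> V" if a: "a \<in> V'" and lim: "x \<longlonglongrightarrow> a"
    and x: "\<And>i. x i \<in> V \<inter> V' \<and> \<phi> (x i) = \<psi> (x i)" for a x
  proof (rule ccontr)
    assume "a \<notin> V"
    moreover have "a \<in> closure V" using lim x closure_sequential by blast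
    ultimately have "a \<in> frontier V" by (simp add: frontier_def interior_open sol_open[OF \<phi>])
    with esc lim x have lc: "leaves_compacts A (\<lambda>i. \<phi> (x i))" unfolding escapes_def by blast
    have "isCont \<psi> a" using sol_continuous[OF \<psi>] sol_open[OF \<psi>] a
      by (auto simp: continuous_on_eq_continuous_at)
    from isCont_tendsto_compose[OF this lim] have "(\<lambda>i. \<phi> (x i)) \<longlonglongrightarrow> \<psi> a" using x by simp
    moreover have "\<phi> (x i) \<in> points A" for i using x sol_points[OF \<phi>] by blast
    ultimately show False
      using leaves_compacts_no_limit[OF lc _ sol_points[OF \<psi> a]] by blast
  qed
  show "V' \<subseteq> V" by (rule sol_agree(1)[OF L \<phi> \<psi> V' T cl])
  show "s \<in> V' \<Longrightarrow> \<phi> s = \<psi> s" by (rule sol_agree(2)[OF L \<phi> \<psi> V' T cl])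
qed

subsection \<open>Flow boxes\<close>

lemma flow_box:
  assumes q: "q \<in> points A"
  obtains \<epsilon> B c u where "0 < \<epsilon>" "open B" "q \<in> B" "c \<in> A" "B \<subseteq> fst c"
    "open (snd c ` B)"
    "continuous_on (ball 0 \<epsilon> \<times> B) u" "u ` (ball 0 \<epsilon> \<times> B) \<subseteq> fst c"
    "pair.holo (ball 0 \<epsilon> \<times> snd c ` B) (\<lambda>(h, z). snd c (u (h, chart_inv c z)))"
    "\<And>p. p \<in> B \<Longrightarrow> u (0, p) = p" "\<And>p. p \<in> B \<Longrightarrow> sol (\<lambda>h. h) (ball 0 \<epsilon>) (\<lambda>h. u (h, p))"
proof -
  obtain c where c: "c \<in> A" "q \<in> fst c" using q by (auto simp: points_def)
  define U where "U = snd c ` fst c"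
  interpret C: commuting_fields U "local_rep X c" "local_rep Y c"
    unfolding U_def by (rule chart_fields[OF c(1)])
  define z0 where "z0 = snd c q"
  have z0: "z0 \<in> U" using c by (simp add: z0_def U_def)
  obtain \<epsilon> v where \<epsilon>: "0 < \<epsilon>" and v: "pair.holo (ball 0 \<epsilon> \<times> ball z0 \<epsilon>) v"
    "v ` (ball 0 \<epsilon> \<times> ball z0 \<epsilon>) \<subseteq> U" and bU: "ball z0 \<epsilon> \<subseteq> U"
    and v0: "\<And>z. z \<in> ball z0 \<epsilon> \<Longrightarrow> v (0, z) = z"
    and vF: "\<And>h z D k. h \<in> ball 0 \<epsilon> \<Longrightarrow> z \<in> ball z0 \<epsilon> \<Longrightarrow> (v has_derivative D) (at (h, z)) \<Longrightarrow>
      D (k, 0) = C.F k (v (h, z))"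
    using C.local_flow[OF z0] by blast
  define B where "B = fst c \<inter> snd c -` ball z0 \<epsilon>"
  define u where "u x = chart_inv c (v (fst x, snd c (snd x)))" for x
  have Bc: "B \<subseteq> fst c" by (auto simp: B_def)
  have imB: "snd c ` B = ball z0 \<epsilon>"
    using bU by (force simp: B_def U_def)
  have vU: "v (h, z) \<in> snd c ` fst c" if "h \<in> ball 0 \<epsilon>" "z \<in> ball z0 \<epsilon>" for h z
    using v(2) that by (auto simp: U_def)
  have su: "snd c (u (h, p)) = v (h, snd c p)" "u (h, p) \<in> fst c" if "h \<in> ball 0 \<epsilon>" "p \<in> B" for h p
    using vU[OF that(1), of "snd c p"] that(2) by (auto simp: u_def B_def chart_chart_inv chart_inv_in)
  have cont: "continuous_on (ball 0 \<epsilon> \<times> B) u"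
    unfolding u_def
  proof (rule continuous_on_compose2[OF continuous_chart_inv[OF c(1)]])
    show "continuous_on (ball 0 \<epsilon> \<times> B) (\<lambda>x. v (fst x, snd c (snd x)))"
    proof (rule continuous_on_compose2[OF pair.holo_continuous_on[OF v(1)]])
      show "continuous_on (ball 0 \<epsilon> \<times> B) (\<lambda>x. (fst x, snd c (snd x)))"
        by (intro continuous_intros continuous_on_compose2[OF continuous_chart[OF c(1)]])
          (use Bc in auto)
    qed (auto simp: B_def)
    show "(\<lambda>x. v (fst x, snd c (snd x))) ` (ball 0 \<epsilon> \<times> B) \<subseteq> snd c ` fst c"
      using vU by (auto simp: B_def)
  qed
  show ?thesis
  proof
    show "0 < \<epsilon>" "c \<in> A" "B \<subseteq> fst c" "continuous_on (ball 0 \<epsilon> \<times> B) u" by fact+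
    show "open B" unfolding B_def
      by (rule continuous_open_preimage[OF continuous_chart[OF c(1)] open_chart[OF c(1)] open_ball])
    show "q \<in> B" using c \<epsilon> by (simp add: B_def z0_def)
    show "open (snd c ` B)" by (simp add: imB)
    show "u ` (ball 0 \<epsilon> \<times> B) \<subseteq> fst c" using su(2) by auto
    show u0: "u (0, p) = p" if "p \<in> B" for p
      using that c(1) by (simp add: u_def B_def v0 chart_inv_chart)
    show "pair.holo (ball 0 \<epsilon> \<times> snd c ` B) (\<lambda>(h, z). snd c (u (h, chart_inv c z)))"
      unfolding imB
    proof (rule pair.holo_cong[OF v(1)], clarify)
      fix h :: "complex ^ 2" and z assume hz: "h \<in> ball 0 \<epsilon>" "z \<in> ball z0 \<epsilon>"
      then have z: "z \<in> snd c ` B" by (simp add: imB)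
      then have "chart_inv c z \<in> B" using chart_inv_chart[OF c(1)] Bc by auto
      moreover have "snd c (chart_inv c z) = z" using z Bc by (intro chart_chart_inv) auto
      ultimately show "v (h, z) = snd c (u (h, chart_inv c z))" using su(1)[OF hz(1)] by simp
    qed
    show "sol (\<lambda>h. h) (ball 0 \<epsilon>) (\<lambda>h. u (h, p))" if p: "p \<in> B" for p
    proof (rule solI)
      show "continuous_on (ball 0 \<epsilon>) (\<lambda>h. u (h, p))"
        by (rule continuous_on_compose2[OF cont]) (auto intro!: continuous_intros p)
      show "(\<lambda>h. u (h, p)) ` ball 0 \<epsilon> \<subseteq> points A" using su(2)[OF _ p] in_points[OF c(1)] by auto
      fix T :: "complex ^ 2" assume T: "T \<in> ball 0 \<epsilon>"
      have z: "snd c p \<in> ball z0 \<epsilon>" using p by (simp add: B_def)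
      obtain D where D: "(v has_derivative D) (at (T, snd c p))"
        using pair.holo_frechet(1)[OF v(1)] T z by blast
      have "((\<lambda>h. (h, snd c p)) has_derivative (\<lambda>h. (h, 0))) (at T)"
        by (auto intro!: derivative_eq_intros)
      from has_derivative_compose[OF this D]
      have "((\<lambda>h. v (h, snd c p)) has_derivative (\<lambda>k. C.F k (v (T, snd c p)))) (at T)"
        by (simp add: vF[OF T z D])
      then have "((\<lambda>h. snd c (u (h, p))) has_derivative (\<lambda>k. C.F k (v (T, snd c p)))) (at T)"
        by (rule has_derivative_transform_within_open[OF _ open_ball T]) (simp add: su(1)[OF _ p])
      moreover have "C.F k (v (T, snd c p)) = span_field X Y (\<lambda>h. h) k c (u (T, p))" for k
        unfolding span_field_def C.F_def by (simp add: local_rep_def u_def)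
      ultimately show "\<exists>c\<in>A. u (T, p) \<in> fst c \<and> ((\<lambda>s. snd c (u (s, p))) has_derivative
          (\<lambda>h. span_field X Y (\<lambda>h. h) h c (u (T, p)))) (at T)"
        using c(1) su(2)[OF T p] by auto
    qed simp
  qed
qed

text \<open>
  Near \<open>q\<close> all solutions live on balls of the same radius.  This is what prevents a
  solution from breaking off while it accumulates at \<open>q\<close>.
\<close>

lemma uniform_existence:
  fixes L :: "'e::euclidean_space \<Rightarrow> complex ^ 2"
  assumes L: "bounded_linear L" and q: "q \<in> points A"
  obtains \<epsilon> B where "0 < \<epsilon>" "open B" "q \<in> B"
    "\<And>p a. p \<in> B \<Longrightarrow> \<exists>\<theta>. sol L (ball a \<epsilon>) \<theta> \<and> \<theta> a = p"
proof -
  obtain \<epsilon> B and u :: "(complex ^ 2) \<times> 'm \<Rightarrow> 'm" where \<epsilon>: "0 < \<epsilon>" and B: "open B" "q \<in> B"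
    and u: "\<And>p. p \<in> B \<Longrightarrow> u (0, p) = p" "\<And>p. p \<in> B \<Longrightarrow> sol (\<lambda>h. h) (ball 0 \<epsilon>) (\<lambda>h. u (h, p))"
    by (rule flow_box[OF q]) blast
  obtain K where K: "0 < K" "\<And>h. norm (L h) \<le> norm h * K"
    using bounded_linear.pos_bounded[OF L] by blast
  have "\<exists>\<theta>. sol L (ball a (\<epsilon> / K)) \<theta> \<and> \<theta> a = p" if p: "p \<in> B" for p a
  proof (intro exI conjI)
    have "sol L ((\<lambda>s. L s + (- L a)) -` ball 0 \<epsilon>) (\<lambda>s. u (L s + (- L a), p))"
      by (rule sol_affine[OF u(2)[OF p] L refl])
    then show "sol L (ball a (\<epsilon> / K)) (\<lambda>s. u (L s + (- L a), p))"
    proof (rule sol_subset[OF _ open_ball], clarify)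
      fix s assume "s \<in> ball a (\<epsilon> / K)"
      then have "norm (s - a) * K < \<epsilon>" using K(1)
        by (simp add: dist_norm norm_minus_commute pos_less_divide_eq)
      with K(2)[of "s - a"] have "norm (L (s - a)) < \<epsilon>" by simp
      then show "s \<in> (\<lambda>s. L s + - L a) -` ball 0 \<epsilon>" by (simp add: linear_simps[OF L])
    qed
    show "u (L a + (- L a), p) = p" using u(1)[OF p] by simp
  qed
  with \<epsilon> K(1) B show ?thesis by (intro that[of "\<epsilon> / K" B]) auto
qed

subsection \<open>Composing a complete solution family with a partial one\<close>

text \<open>
  Put \<open>\<phi> (s, t) = x (\<psi> t) s\<close> and fix \<open>t0\<close>.  For \<open>s = 0\<close> the curve \<open>t \<mapsto> \<phi> (s, t)\<close> is the \<open>L2\<close>-solution \<open>\<psi>\<close>.  If it is an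
  \<open>L2\<close>-solution near \<open>t0\<close> for some \<open>s = s0\<close>, then a solution \<open>\<theta>\<close> of the combined system with the
  value \<open>\<phi> (s0, t0)\<close> at \<open>(s0, t0)\<close> agrees with \<open>\<phi>\<close> first along \<open>s = s0\<close> and then, by uniqueness in the
  \<open>L1\<close>-direction, on a neighbourhood whose size in \<open>s\<close> is uniform near any given \<open>s\<close>.  Since the
  time space is connected, this reaches every \<open>s\<close>.  The flow of one field thus permutes
  the solutions of the other although only local combined solutions were constructed.
\<close>

lemma product_sol:
  fixes L1 :: "'e1::euclidean_space \<Rightarrow> complex ^ 2" and L2 :: "'e2::euclidean_space \<Rightarrow> complex ^ 2"
  assumes L1: "bounded_linear L1" and L2: "bounded_linear L2"
    and x: "\<And>p. p \<in> points A \<Longrightarrow> sol L1 UNIV (x p) \<and> x p 0 = p"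
    and \<psi>: "sol L2 V \<psi>"
  shows "sol (\<lambda>(s, t). L1 s + L2 t) (UNIV \<times> V) (\<lambda>(s, t). x (\<psi> t) s)"
proof -
  define L where "L = (\<lambda>(s, t). L1 s + L2 t)"
  define \<phi> where "\<phi> = (\<lambda>(s, t). x (\<psi> t) s)"
  have Leq: "L = (\<lambda>p. L1 (fst p) + L2 (snd p))" by (auto simp: L_def)
  have L: "bounded_linear L" unfolding Leq
    by (intro bounded_linear_add bounded_linear_compose[OF L1] bounded_linear_compose[OF L2]
        bounded_linear_fst bounded_linear_snd)
  have L_fst: "L (s, 0) = L1 s" and L_snd: "L (0, t) = L2 t" for s t
    using linear_simps(3)[OF L1] linear_simps(3)[OF L2] by (auto simp: L_def)
  have emb1: "bounded_linear (\<lambda>s::'e1. (s, 0::'e2))" and emb2: "bounded_linear (\<lambda>t::'e2. (0::'e1, t))"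
    by (auto intro!: bounded_linear_Pair bounded_linear_ident bounded_linear_zero)
  have slice1: "sol L1 ((\<lambda>s. (s - a, b)) -` W) (\<lambda>s. \<theta> (s - a, b))" if "sol L W \<theta>" for W \<theta> a b
    using sol_affine[OF that emb1 L_fst, of "(- a, b)"] by simp
  have slice2: "sol L2 ((\<lambda>t. (a, t - b)) -` W) (\<lambda>t. \<theta> (a, t - b))" if "sol L W \<theta>" for W \<theta> a b
    using sol_affine[OF that emb2 L_snd, of "(a, - b)"] by simp
  have "sol L ((UNIV :: 'e1 set) \<times> V) \<phi>"
  proof (rule sol_local)
    show "open ((UNIV :: 'e1 set) \<times> V)" by (intro open_Times open_UNIV sol_open[OF \<psi>])
    fix T assume "T \<in> (UNIV :: 'e1 set) \<times> V"
    then obtain s1 t0 where T: "T = (s1, t0)" and t0: "t0 \<in> V" by auto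
    define Q where "Q s \<longleftrightarrow> (\<exists>\<delta>>0. ball t0 \<delta> \<subseteq> V \<and> sol L2 (ball t0 \<delta>) (\<lambda>t. \<phi> (s, t)))" for s
    have \<phi>1: "sol L1 UNIV (\<lambda>s. \<phi> (s, t))" if "t \<in> V" for t
      using x[OF sol_points[OF \<psi> that]] by (simp add: \<phi>_def)
    \<comment> \<open>\<open>s\<close> need not satisfy \<open>Q\<close> itself: \<open>\<eta>\<close> is determined before \<open>s0\<close>, which gives openness and
      closedness of \<open>Q\<close> simultaneously.\<close>
    have step: "\<exists>\<eta>>0. \<forall>s0\<in>ball s \<eta>. Q s0 \<longrightarrow>
        (\<exists>\<delta>>0. ball t0 \<delta> \<subseteq> V \<and> sol L (ball s \<eta> \<times> ball t0 \<delta>) \<phi>)" for s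
    proof -
      have "\<phi> (s, t0) \<in> points A" using sol_points[OF \<phi>1[OF t0]] by simp
      then obtain \<epsilon> B where \<epsilon>: "0 < \<epsilon>" and B: "open B" "\<phi> (s, t0) \<in> B"
        and box: "\<And>p a. p \<in> B \<Longrightarrow> \<exists>\<theta>. sol L (ball a \<epsilon>) \<theta> \<and> \<theta> a = p"
        by (rule uniform_existence[OF L]) blast
      have "open ((\<lambda>s. \<phi> (s, t0)) -` B)"
        by (rule open_vimage[OF B(1) sol_continuous[OF \<phi>1[OF t0]]])
      then obtain \<eta>0 where \<eta>0: "0 < \<eta>0" "ball s \<eta>0 \<subseteq> (\<lambda>s. \<phi> (s, t0)) -` B"
        using B(2) by (auto elim!: openE)
      define \<eta> where "\<eta> = min \<eta>0 (\<epsilon> / 4)"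
      have \<eta>: "0 < \<eta>" "\<eta> \<le> \<eta>0" "\<eta> \<le> \<epsilon> / 4" using \<eta>0 \<epsilon> by (auto simp: \<eta>_def)
      have "\<exists>\<delta>>0. ball t0 \<delta> \<subseteq> V \<and> sol L (ball s \<eta> \<times> ball t0 \<delta>) \<phi>" if s0: "s0 \<in> ball s \<eta>" and Q: "Q s0" for s0
      proof -
        obtain \<delta>0 where \<delta>0: "0 < \<delta>0" "ball t0 \<delta>0 \<subseteq> V" "sol L2 (ball t0 \<delta>0) (\<lambda>t. \<phi> (s0, t))"
          using Q unfolding Q_def by blast
        have "s0 \<in> ball s \<eta>0" using s0 \<eta>(2) by auto
        then have "\<phi> (s0, t0) \<in> B" using \<eta>0(2) by blast
        from box[OF this, of 0] obtain \<theta> where \<theta>: "sol L (ball 0 \<epsilon>) \<theta>" "\<theta> 0 = \<phi> (s0, t0)" by blast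
        define \<delta> where "\<delta> = min \<delta>0 (\<epsilon> / 2)"
        have \<delta>: "0 < \<delta>" "\<delta> \<le> \<delta>0" "\<delta> \<le> \<epsilon> / 2" using \<delta>0 \<epsilon> by (auto simp: \<delta>_def)
        have inb: "(a - s0, b - t0) \<in> ball 0 \<epsilon>" if "a \<in> ball s0 (\<epsilon> / 2)" "b \<in> ball t0 \<delta>" for a b
        proof -
          have "norm (a - s0, b - t0) \<le> norm (a - s0) + norm (b - t0)" by (rule norm_Pair_le)
          also have "\<dots> < \<epsilon> / 2 + \<epsilon> / 2"
            using that \<delta>(3) by (intro add_strict_mono) (auto simp: dist_norm norm_minus_commute)
          finally show ?thesis by simp
        qed
        have along_t: "\<theta> (0, t - t0) = \<phi> (s0, t)" if t: "t \<in> ball t0 \<delta>" for t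
        proof (rule sol_unique[OF L2 slice2[OF \<theta>(1), of 0 t0] \<delta>0(3) open_ball _ _ connected_ball _ _ t])
          show "ball t0 \<delta> \<subseteq> (\<lambda>t. (0 :: 'e1, t - t0)) -` ball 0 \<epsilon>"
          proof
            fix t assume "t \<in> ball t0 \<delta>"
            with inb[of s0 t] \<epsilon> have "(s0 - s0, t - t0) \<in> ball 0 \<epsilon>" by simp
            then show "t \<in> (\<lambda>t. (0 :: 'e1, t - t0)) -` ball 0 \<epsilon>"
              by (simp only: vimage_eq diff_self)
          qed
          show "\<theta> (0, t0 - t0) = \<phi> (s0, t0)" using \<theta>(2) by (simp add: zero_prod_def)
        qed (use \<delta> in auto)
        have along_s: "\<theta> (a - s0, t - t0) = \<phi> (a, t)" if a: "a \<in> ball s0 (\<epsilon> / 2)" and t: "t \<in> ball t0 \<delta>" for a t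
        proof -
          have "t \<in> V" using t \<delta> \<delta>0(2) by auto
          show ?thesis
          proof (rule sol_unique[OF L1 slice1[OF \<theta>(1), of s0 "t - t0"] \<phi>1[OF \<open>t \<in> V\<close>] open_ball _ _ connected_ball _ _ a])
            show "ball s0 (\<epsilon> / 2) \<subseteq> (\<lambda>s. (s - s0, t - t0)) -` ball 0 \<epsilon>" using inb t by auto
            show "\<theta> (s0 - s0, t - t0) = \<phi> (s0, t)" using along_t[OF t] by simp
          qed (use \<epsilon> in auto)
        qed
        have sub: "ball s \<eta> \<subseteq> ball s0 (\<epsilon> / 2)"
          using s0 \<eta>(3) by (auto simp: ball_subset_ball_iff dist_commute)
        have "sol L (ball s \<eta> \<times> ball t0 \<delta>) (\<lambda>p. \<theta> (p + (- s0, - t0)))"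
        proof (rule sol_subset[OF sol_translate[OF \<theta>(1)]])
          show "ball s \<eta> \<times> ball t0 \<delta> \<subseteq> (\<lambda>p. p + (- s0, - t0)) -` ball 0 \<epsilon>"
            using inb sub by auto
        qed (intro open_Times open_ball)
        then have "sol L (ball s \<eta> \<times> ball t0 \<delta>) \<phi>"
          by (rule sol_cong) (use along_s sub in auto)
        moreover have "ball t0 \<delta> \<subseteq> V" using \<delta> \<delta>0(2) by auto
        ultimately show ?thesis using \<delta>(1) by blast
      qed
      then show ?thesis using \<eta>(1) by blast
    qed
    have Q_step: "\<exists>\<eta>>0. \<forall>a\<in>ball s \<eta>. \<forall>b\<in>ball s \<eta>. Q a \<longrightarrow> Q b" for s
    proof -
      obtain \<eta> where \<eta>: "0 < \<eta>" and st: "\<And>s0. s0 \<in> ball s \<eta> \<Longrightarrow> Q s0 \<Longrightarrow>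
          \<exists>\<delta>>0. ball t0 \<delta> \<subseteq> V \<and> sol L (ball s \<eta> \<times> ball t0 \<delta>) \<phi>"
        using step[of s] by blast
      have "Q b" if a: "a \<in> ball s \<eta>" "Q a" and b: "b \<in> ball s \<eta>" for a b
      proof -
        obtain \<delta> where \<delta>: "0 < \<delta>" "ball t0 \<delta> \<subseteq> V" "sol L (ball s \<eta> \<times> ball t0 \<delta>) \<phi>"
          using st[OF a] by blast
        have "sol L2 (ball t0 \<delta>) (\<lambda>t. \<phi> (b, t - 0))"
          by (rule sol_subset[OF slice2[OF \<delta>(3)] open_ball]) (use b in auto)
        with \<delta> show ?thesis unfolding Q_def by auto
      qed
      with \<eta> show ?thesis by blast
    qed
    obtain \<delta>0 where "0 < \<delta>0" "ball t0 \<delta>0 \<subseteq> V" using sol_open[OF \<psi>] t0 openE by blast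
    moreover have "sol L2 (ball t0 \<delta>0) (\<lambda>t. \<phi> (0, t))"
      by (rule sol_cong[OF sol_subset[OF \<psi> open_ball \<open>ball t0 \<delta>0 \<subseteq> V\<close>]])
        (use x[OF sol_points[OF \<psi>]] \<open>ball t0 \<delta>0 \<subseteq> V\<close> in \<open>auto simp: \<phi>_def\<close>)
    ultimately have "Q 0" unfolding Q_def by blast
    have "Q s1"
    proof (rule connected_induction_simple[OF connected_UNIV, of 0 s1 Q])
      show "\<exists>T. openin (top_of_set UNIV) T \<and> a \<in> T \<and> (\<forall>x\<in>T. \<forall>y\<in>T. Q x \<longrightarrow> Q y)" for a
      proof -
        obtain \<eta> where "0 < \<eta>" "\<forall>x\<in>ball a \<eta>. \<forall>y\<in>ball a \<eta>. Q x \<longrightarrow> Q y"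
          using Q_step[of a] by blast
        then show ?thesis by (intro exI[of _ "ball a \<eta>"]) auto
      qed
    qed (use \<open>Q 0\<close> in auto)
    with step[of s1] obtain \<eta> \<delta> where "0 < \<eta>" "0 < \<delta>" "ball t0 \<delta> \<subseteq> V" "sol L (ball s1 \<eta> \<times> ball t0 \<delta>) \<phi>"
      by (metis centre_in_ball)
    then show "\<exists>N \<psi>. T \<in> N \<and> N \<subseteq> UNIV \<times> V \<and> sol L N \<psi> \<and> (\<forall>s\<in>N. \<phi> s = \<psi> s)"
      by (intro exI[of _ "ball s1 \<eta> \<times> ball t0 \<delta>"] exI[of _ \<phi>]) (auto simp: T)
  qed
  then show ?thesis unfolding L_def \<phi>_def .
qed

text \<open>
  Suppose the values along \<open>(s, t)\<close> tending to the boundary accumulate at \<open>q\<close>.  Uniform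
  existence gives an \<open>L2\<close>-solution \<open>\<theta>\<close> starting at time \<open>t\<close> from \<open>x (\<psi> t) s\<close>, on a ball that contains
  the limit of the second time.  Its image under the \<open>L1\<close>-flow at time \<open>- s\<close> is again an \<open>L2\<close>-solution
  and agrees with \<open>\<psi>\<close> at \<open>t\<close>, hence \<open>V\<close> contains that ball.
\<close>

lemma product_escapes:
  fixes L1 :: "'e1::euclidean_space \<Rightarrow> complex ^ 2" and L2 :: "'e2::euclidean_space \<Rightarrow> complex ^ 2"
  assumes L1: "bounded_linear L1" and L2: "bounded_linear L2"
    and x: "\<And>p. p \<in> points A \<Longrightarrow> sol L1 UNIV (x p) \<and> x p 0 = p"
    and \<psi>: "sol L2 V \<psi>" and esc: "escapes A V \<psi>"
  shows "escapes A (UNIV \<times> V) (\<lambda>(s, t). x (\<psi> t) s)"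
  unfolding escapes_def
proof (intro allI impI, elim conjE)
  fix T :: "nat \<Rightarrow> 'e1 \<times> 'e2" and a
  assume T: "\<forall>i. T i \<in> UNIV \<times> V" and lim: "T \<longlonglongrightarrow> a" and a: "a \<in> frontier (UNIV \<times> V)"
  define \<phi> where "\<phi> = (\<lambda>(s, t). x (\<psi> t) s)"
  show "leaves_compacts A (\<lambda>i. case T i of (s, t) \<Rightarrow> x (\<psi> t) s)"
  proof (rule ccontr)
    assume "\<not> ?thesis"
    then obtain r q where r: "strict_mono r" "q \<in> points A" "((\<lambda>i. case T i of (s, t) \<Rightarrow> x (\<psi> t) s) \<circ> r) \<longlonglongrightarrow> q"
      by (rule not_leaves_compacts_subseq)
    obtain \<epsilon> B where \<epsilon>: "0 < \<epsilon>" and B: "open B" "q \<in> B"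
      and box: "\<And>p a. p \<in> B \<Longrightarrow> \<exists>\<theta>. sol L2 (ball a \<epsilon>) \<theta> \<and> \<theta> a = p"
      by (rule uniform_existence[OF L2 r(2)]) blast
    have ev1: "\<forall>\<^sub>F i in sequentially. (case T (r i) of (s, t) \<Rightarrow> x (\<psi> t) s) \<in> B"
      using topological_tendstoD[OF r(3) B] by simp
    have "(\<lambda>i. snd (T (r i))) \<longlonglongrightarrow> snd a"
      using tendsto_snd[OF LIMSEQ_subseq_LIMSEQ[OF lim r(1)]] by (simp add: o_def)
    from tendstoD[OF this \<epsilon>] have ev2: "\<forall>\<^sub>F i in sequentially. dist (snd (T (r i))) (snd a) < \<epsilon>" .
    obtain i where i: "(case T (r i) of (s, t) \<Rightarrow> x (\<psi> t) s) \<in> B" "dist (snd (T (r i))) (snd a) < \<epsilon>"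
      using eventually_happens[OF eventually_conj[OF ev1 ev2]] by auto
    obtain s t where st: "T (r i) = (s, t)" by (cases "T (r i)")
    have t: "t \<in> V" using T st by (metis mem_Sigma_iff)
    have "x (\<psi> t) s \<in> B" using i(1) st by simp
    from box[OF this, of t] obtain \<theta> where \<theta>: "sol L2 (ball t \<epsilon>) \<theta>" "\<theta> t = x (\<psi> t) s" by blast
    have tb: "t \<in> ball t \<epsilon>" using \<epsilon> by simp
    have "sol L2 ((\<lambda>\<tau>. (0::'e1, \<tau>) + (- s, 0)) -` (UNIV \<times> ball t \<epsilon>))
        (\<lambda>\<tau>. (\<lambda>(s, \<tau>). x (\<theta> \<tau>) s) ((0, \<tau>) + (- s, 0)))"
      by (rule sol_affine[OF product_sol[OF L1 L2 x \<theta>(1)]])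
        (auto intro!: bounded_linear_Pair bounded_linear_ident bounded_linear_zero simp: linear_simps(3)[OF L1])
    then have pullback: "sol L2 (ball t \<epsilon>) (\<lambda>\<tau>. x (\<theta> \<tau>) (- s))" by (simp add: vimage_def ball_def)
    have "x (\<theta> t) (- s) = x (\<psi> t) (- s + s)"
    proof (rule sol_unique[OF L1, of UNIV "x (\<theta> t)" UNIV "\<lambda>\<sigma>. x (\<psi> t) (\<sigma> + s)" UNIV 0])
      show "sol L1 UNIV (x (\<theta> t))" using x[OF sol_points[OF \<theta>(1) tb]] by blast
      show "sol L1 UNIV (\<lambda>\<sigma>. x (\<psi> t) (\<sigma> + s))"
        using sol_translate[of L1 UNIV "x (\<psi> t)" s] x[OF sol_points[OF \<psi> t]] by simp
      show "x (\<theta> t) 0 = x (\<psi> t) (0 + s)" using x[OF sol_points[OF \<theta>(1) tb]] \<theta>(2) by simp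
    qed auto
    then have "\<psi> t = x (\<theta> t) (- s)" using x[OF sol_points[OF \<psi> t]] by simp
    from escapes_dominates(1)[OF L2 \<psi> esc pullback connected_ball t tb this]
    have "ball t \<epsilon> \<subseteq> V" .
    then have "snd a \<in> V" using i(2) st by auto
    moreover have "a \<notin> UNIV \<times> V"
      using a interior_open[OF open_Times[OF open_UNIV[where 'a = 'e1] sol_open[OF \<psi>]]] by (simp add: frontier_def)
    ultimately show False by (cases a) auto
  qed
qed

lemma escapes_vimage:
  fixes K :: "'e::euclidean_space \<Rightarrow> 'f::euclidean_space"
  assumes esc: "escapes A V \<phi>" and V: "open V" and K: "continuous_on UNIV K"
  shows "escapes A (K -` V) (\<lambda>s. \<phi> (K s))"
  unfolding escapes_def
proof (intro allI impI, elim conjE)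
  fix T a assume T: "\<forall>i. T i \<in> K -` V" and lim: "T \<longlonglongrightarrow> a" and a: "a \<in> frontier (K -` V)"
  have limK: "(\<lambda>i. K (T i)) \<longlonglongrightarrow> K a"
    using continuous_on_tendsto_compose[OF K lim] by simp
  have "a \<notin> K -` V" using a open_vimage[OF V K] by (simp add: frontier_def interior_open)
  moreover have "K a \<in> closure V" using T limK closure_sequential by force
  ultimately have "K a \<in> frontier V" by (simp add: frontier_def interior_open V)
  with esc T limK show "leaves_compacts A (\<lambda>i. \<phi> (K (T i)))" unfolding escapes_def by auto
qed

text \<open>
  In one real dimension intersections of connected sets are connected, so any two solutions
  from \<open>p\<close> on intervals agree where both are defined, and the union of all of them is a solution.  In
  higher dimension this fails because of monodromy, which is why part (i) has to assume
  semicompleteness of \<open>Y\<close>.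
\<close>

lemma maximal_real_sol:
  fixes L :: "real \<Rightarrow> complex ^ 2"
  assumes L: "bounded_linear L" and p: "p \<in> points A"
  obtains J \<gamma> where "0 \<in> J" "\<gamma> 0 = p" "connected J" "sol L J \<gamma>" "escapes A J \<gamma>"
proof -
  define S where "S = {(I, g). connected I \<and> 0 \<in> I \<and> g 0 = p \<and> sol L I g}"
  define J where "J = (\<Union>(I, g)\<in>S. I)"
  have agree: "g t = g' t" if "sol L I g" "sol L I' g'" "connected I" "connected I'"
    "s \<in> I \<inter> I'" "g s = g' s" "t \<in> I \<inter> I'" for I g I' g' s t
  proof (rule sol_unique[OF L that(1,2) _ _ _ _ that(5,6,7)])
    show "open (I \<inter> I')" using sol_open that by blast
    show "connected (I \<inter> I')"
      using that(3,4) by (simp add: is_interval_connected_1[symmetric] is_interval_Int)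
  qed auto
  define \<gamma> where "\<gamma> t = snd (SOME P. P \<in> S \<and> t \<in> fst P) t" for t
  have \<gamma>: "\<gamma> t = g t" if "(I, g) \<in> S" "t \<in> I" for I g t
  proof -
    have "(SOME P. P \<in> S \<and> t \<in> fst P) \<in> S \<and> t \<in> fst (SOME P. P \<in> S \<and> t \<in> fst P)"
      by (rule someI[of _ "(I, g)"]) (use that in auto)
    moreover obtain I' g' where "(SOME P. P \<in> S \<and> t \<in> fst P) = (I', g')" by fastforce
    ultimately show ?thesis
      using that agree[of I' g' I g 0 t] by (auto simp: \<gamma>_def S_def)
  qed
  have opJ: "open J" unfolding J_def S_def using sol_open by (intro open_UN) auto
  have solJ: "sol L J \<gamma>"
  proof (rule sol_local[OF opJ])
    fix T assume "T \<in> J"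
    then obtain I g where I: "(I, g) \<in> S" "T \<in> I" by (auto simp: J_def)
    then show "\<exists>N \<psi>. T \<in> N \<and> N \<subseteq> J \<and> sol L N \<psi> \<and> (\<forall>s\<in>N. \<gamma> s = \<psi> s)"
      using \<gamma> by (intro exI[of _ I] exI[of _ g]) (auto simp: J_def S_def)
  qed
  obtain \<epsilon> B where "0 < \<epsilon>" "p \<in> B" "\<And>p a. p \<in> B \<Longrightarrow> \<exists>\<theta>. sol L (ball a \<epsilon>) \<theta> \<and> \<theta> a = p"
    by (rule uniform_existence[OF L p]) blast
  then obtain \<theta> where "sol L (ball 0 \<epsilon>) \<theta>" "\<theta> 0 = p" by blast
  then have mem: "(ball 0 \<epsilon>, \<theta>) \<in> S" using \<open>0 < \<epsilon>\<close> by (auto simp: S_def)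
  have J0: "0 \<in> J" "\<gamma> 0 = p"
  proof -
    show "0 \<in> J" unfolding J_def by (rule UN_I[OF mem]) (simp add: \<open>0 < \<epsilon>\<close>)
    show "\<gamma> 0 = p" using \<gamma>[OF mem, of 0] \<open>0 < \<epsilon>\<close> \<open>\<theta> 0 = p\<close> by simp
  qed
  have conJ: "connected J"
    unfolding J_def by (rule connected_Union) (auto simp: S_def)
  have "escapes A J \<gamma>"
    unfolding escapes_def
  proof (intro allI impI, elim conjE)
    fix T a assume T: "\<forall>i. T i \<in> J" and lim: "T \<longlonglongrightarrow> a" and a: "a \<in> frontier J"
    show "leaves_compacts A (\<lambda>i. \<gamma> (T i))"
    proof (rule ccontr)
      assume "\<not> ?thesis"
      then obtain r q where r: "strict_mono r" "q \<in> points A" "((\<lambda>i. \<gamma> (T i)) \<circ> r) \<longlonglongrightarrow> q"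
        by (rule not_leaves_compacts_subseq)
      obtain \<epsilon> B where \<epsilon>: "0 < \<epsilon>" and B: "open B" "q \<in> B"
        and box: "\<And>p a. p \<in> B \<Longrightarrow> \<exists>\<theta>. sol L (ball a \<epsilon>) \<theta> \<and> \<theta> a = p"
        by (rule uniform_existence[OF L r(2)]) blast
      have ev1: "\<forall>\<^sub>F i in sequentially. \<gamma> (T (r i)) \<in> B"
        using topological_tendstoD[OF r(3) B] by simp
      have ev2: "\<forall>\<^sub>F i in sequentially. dist (T (r i)) a < \<epsilon>"
        using tendstoD[OF LIMSEQ_subseq_LIMSEQ[OF lim r(1)] \<epsilon>] by simp
      obtain i where i: "\<gamma> (T (r i)) \<in> B" "dist (T (r i)) a < \<epsilon>"
        using eventually_happens[OF eventually_conj[OF ev1 ev2]] by auto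
      define t where "t = T (r i)"
      have t: "t \<in> J" "\<gamma> t \<in> B" "a \<in> ball t \<epsilon>" using T i by (auto simp: t_def)
      obtain \<theta> where \<theta>: "sol L (ball t \<epsilon>) \<theta>" "\<theta> t = \<gamma> t" using box[OF t(2)] by blast
      have eq: "\<gamma> s = \<theta> s" if "s \<in> J" "s \<in> ball t \<epsilon>" for s
        by (rule agree[OF solJ \<theta>(1) conJ connected_ball, of t]) (use that t \<theta> \<epsilon> in auto)
      define g where "g s = (if s \<in> J then \<gamma> s else \<theta> s)" for s
      have "sol L (J \<union> ball t \<epsilon>) g"
      proof (rule sol_local)
        show "open (J \<union> ball t \<epsilon>)" using opJ by blast
        fix s assume "s \<in> J \<union> ball t \<epsilon>"
        then consider "s \<in> J" | "s \<in> ball t \<epsilon>" by blast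
        then show "\<exists>N \<psi>. s \<in> N \<and> N \<subseteq> J \<union> ball t \<epsilon> \<and> sol L N \<psi> \<and> (\<forall>u\<in>N. g u = \<psi> u)"
        proof cases
          case 1
          then show ?thesis using solJ by (intro exI[of _ J] exI[of _ \<gamma>]) (auto simp: g_def)
        next
          case 2
          then show ?thesis using \<theta>(1) eq by (intro exI[of _ "ball t \<epsilon>"] exI[of _ \<theta>]) (auto simp: g_def)
        qed
      qed
      moreover have "connected (J \<union> ball t \<epsilon>)"
        using t \<epsilon> by (intro connected_Un conJ connected_ball) auto
      moreover have "g 0 = p" using J0 by (simp add: g_def)
      ultimately have "(J \<union> ball t \<epsilon>, g) \<in> S" using J0 by (simp add: S_def)
      then have "a \<in> J" unfolding J_def by (rule UN_I) (simp add: t(3)[simplified])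
      then show False using a opJ by (simp add: frontier_def interior_open)
    qed
  qed
  then show ?thesis by (rule that[OF J0 conJ solJ])
qed

section \<open>Maximal solutions form a maximal local action\<close>

definition holo_at :: "((complex ^ 2) \<times> 'm \<Rightarrow> 'm) \<Rightarrow> complex ^ 2 \<Rightarrow> 'm \<Rightarrow> bool"
  where "holo_at \<Phi> g p \<longleftrightarrow> (\<forall>c\<in>A. \<forall>d\<in>A. p \<in> fst c \<and> \<Phi> (g, p) \<in> fst d \<longrightarrow>
    (\<exists>D. ((\<lambda>(h, z). snd d (\<Phi> (h, chart_inv c z))) has_derivative D) (at (g, snd c p)) \<and>
      (\<forall>a u v. D (a *s u, a *s v) = a *s D (u, v))))"

definition regular_on :: "((complex ^ 2) \<times> 'm \<Rightarrow> 'm) \<Rightarrow> ((complex ^ 2) \<times> 'm) set \<Rightarrow> bool"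
  where "regular_on \<Phi> O' \<longleftrightarrow> open O' \<and> continuous_on O' \<Phi> \<and> (\<forall>g p. (g, p) \<in> O' \<longrightarrow> holo_at \<Phi> g p)"

text \<open>
  On \<open>ball g0 \<epsilon> \<times> N\<close> the action is the composite of the map \<open>k\<close>, which moves points into a flow
  box, with the local flow \<open>u\<close> of that box.  The base case of the continuation below has
  \<open>g0 = 0\<close> and \<open>k\<close> the identity; afterwards \<open>k\<close> is the action of \<open>g0\<close>.
\<close>

lemma regular_on_box:
  assumes c1: "c1 \<in> A" and B: "B \<subseteq> fst c1"
    and u: "continuous_on (ball 0 \<epsilon> \<times> B) u" "u ` (ball 0 \<epsilon> \<times> B) \<subseteq> fst c1"
    and uh: "pair.holo (ball 0 \<epsilon> \<times> snd c1 ` B) (\<lambda>(h, z). snd c1 (u (h, chart_inv c1 z)))"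
    and N: "open N" "N \<subseteq> points A" and k: "continuous_on N k" "k ` N \<subseteq> B"
    and kh: "\<And>p c. p \<in> N \<Longrightarrow> c \<in> A \<Longrightarrow> p \<in> fst c \<Longrightarrow>
      \<exists>D. ((\<lambda>z. snd c1 (k (chart_inv c z))) has_derivative D) (at (snd c p)) \<and>
        (\<forall>a v. D (a *s v) = a *s D v)"
    and eq: "\<And>g p. g \<in> ball g0 \<epsilon> \<Longrightarrow> p \<in> N \<Longrightarrow> \<Phi> (g, p) = u (g - g0, k p)"
  shows "regular_on \<Phi> (ball g0 \<epsilon> \<times> N)"
  unfolding regular_on_def
proof (intro conjI allI impI)
  show "open (ball g0 \<epsilon> \<times> N)" by (intro open_Times open_ball N)
  have shift: "g - g0 \<in> ball 0 \<epsilon>" if "g \<in> ball g0 \<epsilon>" for g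
    using that by (simp add: dist_norm norm_minus_commute)
  have "continuous_on (ball g0 \<epsilon> \<times> N) (\<lambda>x. u (fst x - g0, k (snd x)))"
  proof (rule continuous_on_compose2[OF u(1)])
    show "continuous_on (ball g0 \<epsilon> \<times> N) (\<lambda>x. (fst x - g0, k (snd x)))"
      by (intro continuous_intros continuous_on_compose2[OF k(1)]) auto
    show "(\<lambda>x. (fst x - g0, k (snd x))) ` (ball g0 \<epsilon> \<times> N) \<subseteq> ball 0 \<epsilon> \<times> B"
      using k(2) shift by (auto simp del: mem_ball)
  qed
  then show "continuous_on (ball g0 \<epsilon> \<times> N) \<Phi>"
    by (rule continuous_on_eq) (use eq in auto)
  fix g p assume "(g, p) \<in> ball g0 \<epsilon> \<times> N"
  then have g: "g \<in> ball g0 \<epsilon>" and p: "p \<in> N" by auto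
  show "holo_at \<Phi> g p"
    unfolding holo_at_def
  proof (intro ballI impI, elim conjE)
    fix c d assume c: "c \<in> A" "p \<in> fst c" and d: "d \<in> A" "\<Phi> (g, p) \<in> fst d"
    define \<kappa> where "\<kappa> z = snd c1 (k (chart_inv c z))" for z
    define w where "w x = snd c1 (u (fst x, chart_inv c1 (snd x)))" for x
    obtain D1 where D1: "(\<kappa> has_derivative D1) (at (snd c p))" "\<And>a v. D1 (a *s v) = a *s D1 v"
      using kh[OF p c] unfolding \<kappa>_def by blast
    have \<kappa>p: "\<kappa> (snd c p) = snd c1 (k p)" by (simp add: \<kappa>_def chart_inv_chart c)
    have kp: "k p \<in> B" "k p \<in> fst c1" using k(2) p B by auto
    have wh: "pair.holo (ball 0 \<epsilon> \<times> snd c1 ` B) w"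
      using uh unfolding w_def by (simp add: split_def)
    have "(g - g0, \<kappa> (snd c p)) \<in> ball 0 \<epsilon> \<times> snd c1 ` B"
      using shift[OF g] kp(1) by (auto simp: \<kappa>p)
    then obtain D2 where D2: "(w has_derivative D2) (at (g - g0, \<kappa> (snd c p)))"
      "\<And>a v. D2 (a *s fst v, a *s snd v) = a *s D2 v"
      using wh unfolding pair.holo_def by blast
    have wp: "w (g - g0, \<kappa> (snd c p)) = snd c1 (\<Phi> (g, p))"
      by (simp add: w_def \<kappa>p chart_inv_chart c1 kp(2) eq[OF g p])
    have \<Phi>c1: "\<Phi> (g, p) \<in> fst c1" using u(2) shift[OF g] kp(1) by (auto simp: eq[OF g p] simp del: mem_ball)
    define D3 where "D3 = frechet_derivative (snd d \<circ> chart_inv c1) (at (snd c1 (\<Phi> (g, p))))"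
    note D3 = transition_derivative[OF c1 d(1) \<Phi>c1 d(2), folded D3_def]
    have inner: "((\<lambda>x. (fst x - g0, \<kappa> (snd x))) has_derivative (\<lambda>x. (fst x, D1 (snd x)))) (at (g, snd c p))"
    proof -
      have "((\<lambda>x. \<kappa> (snd x)) has_derivative (\<lambda>x. D1 (snd x))) (at (g, snd c p))"
        by (rule has_derivative_compose[where f = snd]) (auto intro!: derivative_eq_intros D1(1))
      moreover have "((\<lambda>x. fst x - g0) has_derivative fst) (at (g, snd c p))"
        by (auto intro!: derivative_eq_intros)
      ultimately show ?thesis by (intro has_derivative_Pair)
    qed
    have mid: "((\<lambda>x. w (fst x - g0, \<kappa> (snd x))) has_derivative (\<lambda>x. D2 (fst x, D1 (snd x)))) (at (g, snd c p))"
      by (rule has_derivative_compose[OF inner]) (simp add: D2(1))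
    have "((\<lambda>x. (snd d \<circ> chart_inv c1) (w (fst x - g0, \<kappa> (snd x)))) has_derivative
        (\<lambda>x. D3 (D2 (fst x, D1 (snd x))))) (at (g, snd c p))"
      by (rule has_derivative_compose[OF mid]) (simp add: wp D3(1)[unfolded o_def])
    moreover have "open (ball g0 \<epsilon> \<times> (snd c ` fst c \<inter> chart_inv c -` N))"
      by (intro open_Times open_ball continuous_open_preimage[OF continuous_chart_inv[OF c(1)] open_chart_image[OF c(1)] N(1)])
    ultimately have "((\<lambda>(h, z). snd d (\<Phi> (h, chart_inv c z))) has_derivative
        (\<lambda>x. D3 (D2 (fst x, D1 (snd x))))) (at (g, snd c p))"
    proof (rule has_derivative_transform_within_open)
      show "(g, snd c p) \<in> ball g0 \<epsilon> \<times> (snd c ` fst c \<inter> chart_inv c -` N)"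
        using g p c by (auto simp: chart_inv_chart)
      fix x assume "x \<in> ball g0 \<epsilon> \<times> (snd c ` fst c \<inter> chart_inv c -` N)"
      then obtain h z where x: "x = (h, z)" "h \<in> ball g0 \<epsilon>" "chart_inv c z \<in> N" by auto
      then have kz: "k (chart_inv c z) \<in> B" using k(2) by auto
      then have "chart_inv c1 (\<kappa> z) = k (chart_inv c z)"
        using B by (auto simp: \<kappa>_def chart_inv_chart c1)
      then have "w (h - g0, \<kappa> z) = snd c1 (\<Phi> (h, chart_inv c z))"
        by (simp add: w_def eq[OF x(2,3)])
      moreover have "\<Phi> (h, chart_inv c z) \<in> fst c1"
        using u(2) shift[OF x(2)] kz by (auto simp: eq[OF x(2,3)] simp del: mem_ball)
      ultimately show "(snd d \<circ> chart_inv c1) (w (fst x - g0, \<kappa> (snd x))) =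
          (case x of (h, z) \<Rightarrow> snd d (\<Phi> (h, chart_inv c z)))"
        by (simp add: x(1) chart_inv_chart c1)
    qed
    moreover have "D3 (D2 (a *s u, D1 (a *s v))) = a *s D3 (D2 (u, D1 v))" for a u v
      using D2(2)[of a "(u, D1 v)"] by (simp add: D1(2) D3(2))
    ultimately show "\<exists>D. ((\<lambda>(h, z). snd d (\<Phi> (h, chart_inv c z))) has_derivative D) (at (g, snd c p)) \<and>
        (\<forall>a u v. D (a *s u, a *s v) = a *s D (u, v))"
      by (intro exI[of _ "\<lambda>x. D3 (D2 (fst x, D1 (snd x)))"]) simp
  qed
qed

text \<open>
  The local action is \<open>\<Phi> (g, p) = \<phi> p g\<close>.  Maximality of \<open>\<phi> p\<close> shows that any solution
  starting at \<open>\<phi> p g\<close> is a translate of \<open>\<phi> p\<close>; this yields the composition law, and it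
  shows that a flow box around \<open>\<phi> p a\<close> describes \<open>\<Phi>\<close> near \<open>(a, p)\<close> in terms of a
  single earlier map \<open>\<Phi> (g0, -)\<close>.  Openness of the domain and holomorphy of \<open>\<Phi>\<close> therefore
  propagate from \<open>(0, p)\<close> along the connected set \<open>V p\<close>.
\<close>

lemma univalent_of_maximal_solutions:
  assumes conn: "connected (points A)"
    and V: "\<And>p. p \<in> points A \<Longrightarrow> 0 \<in> V p \<and> \<phi> p 0 = p \<and> connected (V p) \<and>
      sol (\<lambda>h. h) (V p) (\<phi> p) \<and> escapes A (V p) (\<phi> p)"
  shows "univalent A X Y"
proof -
  define \<Omega> where "\<Omega> = {(g, p). p \<in> points A \<and> g \<in> V p}"
  define \<Phi> where "\<Phi> = (\<lambda>(g, p). \<phi> p g)"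
  have id: "bounded_linear (\<lambda>h :: complex ^ 2. h)" by (rule bounded_linear_ident)
  have shift: "h + g \<in> V p \<and> \<phi> p (h + g) = \<theta> h"
    if p: "p \<in> points A" and g: "g \<in> V p" and W: "sol (\<lambda>h. h) W \<theta>" "connected W" "0 \<in> W"
      and \<theta>: "\<theta> 0 = \<phi> p g" and h: "h \<in> W" for p g W \<theta> h
  proof -
    have "sol (\<lambda>h. h) ((\<lambda>s. s + (- g)) -` W) (\<lambda>s. \<theta> (s + (- g)))" by (rule sol_translate[OF W(1)])
    moreover have "(\<lambda>s. s + (- g)) -` W = (+) g ` W"
      by (auto simp: image_iff) (metis add.commute diff_add_cancel)
    ultimately have s: "sol (\<lambda>h. h) ((+) g ` W) (\<lambda>s. \<theta> (s + (- g)))" by simp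
    have c: "connected ((+) g ` W)" by (intro connected_continuous_image W(2) continuous_intros)
    have m: "g \<in> (+) g ` W" "g + h \<in> (+) g ` W" using W(3) h by force+
    have e: "\<phi> p g = \<theta> (g + (- g))" using \<theta> by simp
    from V[OF p] have Vp: "sol (\<lambda>h. h) (V p) (\<phi> p)" "escapes A (V p) (\<phi> p)" by auto
    from escapes_dominates(1)[OF id Vp s c g m(1) e] m(2)
      escapes_dominates(2)[OF id Vp s c g m(1) e m(2)]
    show ?thesis by (auto simp: add.commute)
  qed
  have reach: "\<exists>O'. (g, p) \<in> O' \<and> O' \<subseteq> \<Omega> \<and> regular_on \<Phi> O'" if gp: "(g, p) \<in> \<Omega>" for g p
  proof -
    define H where "H g \<longleftrightarrow> (\<exists>O'. (g, p) \<in> O' \<and> O' \<subseteq> \<Omega> \<and> regular_on \<Phi> O')" for g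
    have p: "p \<in> points A" and g: "g \<in> V p" using gp by (auto simp: \<Omega>_def)
    note Vp = V[OF p]
    have "H 0"
    proof -
      obtain \<epsilon> B c1 and u :: "(complex ^ 2) \<times> 'm \<Rightarrow> 'm" where \<epsilon>: "0 < \<epsilon>" and B: "open B" "p \<in> B"
        and c1: "c1 \<in> A" "B \<subseteq> fst c1"
        and u: "continuous_on (ball 0 \<epsilon> \<times> B) u" "u ` (ball 0 \<epsilon> \<times> B) \<subseteq> fst c1"
          "pair.holo (ball 0 \<epsilon> \<times> snd c1 ` B) (\<lambda>(h, z). snd c1 (u (h, chart_inv c1 z)))"
        and u0: "\<And>p. p \<in> B \<Longrightarrow> u (0, p) = p"
        and us: "\<And>p. p \<in> B \<Longrightarrow> sol (\<lambda>h. h) (ball 0 \<epsilon>) (\<lambda>h. u (h, p))"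
        by (rule flow_box[OF p]) blast
      have BM: "B \<subseteq> points A" using c1 in_points by blast
      have *: "g \<in> V p' \<and> \<phi> p' g = u (g, p')" if "g \<in> ball 0 \<epsilon>" "p' \<in> B" for g p'
        using shift[of p' 0 "ball 0 \<epsilon>" "\<lambda>h. u (h, p')" g] that V[of p'] us[OF that(2)] u0[OF that(2)] BM \<epsilon>
        by (auto simp: connected_ball)
      have "regular_on \<Phi> (ball 0 \<epsilon> \<times> B)"
      proof (rule regular_on_box[OF c1 u B(1) BM, of "\<lambda>p. p"])
        show "\<Phi> (g, p') = u (g - 0, p')" if "g \<in> ball 0 \<epsilon>" "p' \<in> B" for g p'
          using *[OF that] by (simp add: \<Phi>_def)
        show "\<exists>D. ((\<lambda>z. snd c1 (chart_inv c z)) has_derivative D) (at (snd c p')) \<and>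
            (\<forall>a v. D (a *s v) = a *s D v)" if "p' \<in> B" "c \<in> A" "p' \<in> fst c" for p' c
          using transition_derivative[OF that(2) c1(1) that(3)] that(1) c1(2)
          by (auto simp: o_def)
      qed auto
      moreover have "ball 0 \<epsilon> \<times> B \<subseteq> \<Omega>" using * BM by (auto simp: \<Omega>_def)
      ultimately show ?thesis unfolding H_def using \<epsilon> B by (intro exI[of _ "ball 0 \<epsilon> \<times> B"]) auto
    qed
    have step: "\<exists>\<eta>>0. \<forall>g0\<in>ball a \<eta> \<inter> V p. H g0 \<longrightarrow> (\<forall>g\<in>ball a \<eta>. H g)" if a: "a \<in> V p" for a
    proof -
      have sa: "sol (\<lambda>h. h) (V p) (\<phi> p)" using Vp by blast
      obtain \<epsilon> B c1 and u :: "(complex ^ 2) \<times> 'm \<Rightarrow> 'm" where \<epsilon>: "0 < \<epsilon>" and B: "open B" "\<phi> p a \<in> B"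
        and c1: "c1 \<in> A" "B \<subseteq> fst c1"
        and u: "continuous_on (ball 0 \<epsilon> \<times> B) u" "u ` (ball 0 \<epsilon> \<times> B) \<subseteq> fst c1"
          "pair.holo (ball 0 \<epsilon> \<times> snd c1 ` B) (\<lambda>(h, z). snd c1 (u (h, chart_inv c1 z)))"
        and u0: "\<And>p. p \<in> B \<Longrightarrow> u (0, p) = p"
        and us: "\<And>p. p \<in> B \<Longrightarrow> sol (\<lambda>h. h) (ball 0 \<epsilon>) (\<lambda>h. u (h, p))"
        by (rule flow_box[OF sol_points[OF sa a]]) blast
      have "open (V p \<inter> \<phi> p -` B)"
        by (rule continuous_open_preimage[OF sol_continuous[OF sa] sol_open[OF sa] B(1)])
      then obtain \<eta>0 where \<eta>0: "0 < \<eta>0" "ball a \<eta>0 \<subseteq> V p \<inter> \<phi> p -` B"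
        using a B(2) by (auto elim!: openE)
      define \<eta> where "\<eta> = min \<eta>0 (\<epsilon> / 2)"
      have \<eta>: "0 < \<eta>" "\<eta> \<le> \<eta>0" "\<eta> \<le> \<epsilon> / 2" using \<eta>0 \<epsilon> by (auto simp: \<eta>_def)
      have "H g" if g0: "g0 \<in> ball a \<eta>" and H0: "H g0" and g: "g \<in> ball a \<eta>" for g0 g
      proof -
        obtain O' where O': "(g0, p) \<in> O'" "O' \<subseteq> \<Omega>" "regular_on \<Phi> O'" using H0 unfolding H_def by blast
        have opO: "open O'" and contO: "continuous_on O' \<Phi>" and holO: "\<And>g p. (g, p) \<in> O' \<Longrightarrow> holo_at \<Phi> g p"
          using O'(3) by (auto simp: regular_on_def)
        have "open (O' \<inter> \<Phi> -` B)" by (rule continuous_open_preimage[OF contO opO B(1)])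
        define N where "N = (\<lambda>p'. (g0, p')) -` (O' \<inter> \<Phi> -` B)"
        have N: "open N" unfolding N_def
          by (rule open_vimage[OF \<open>open (O' \<inter> \<Phi> -` B)\<close>]) (intro continuous_intros)
        have NM: "N \<subseteq> points A" and NV: "\<And>p'. p' \<in> N \<Longrightarrow> g0 \<in> V p'"
          using O'(2) by (auto simp: N_def \<Omega>_def)
        have k: "continuous_on N (\<lambda>p'. \<Phi> (g0, p'))" "(\<lambda>p'. \<Phi> (g0, p')) ` N \<subseteq> B"
          by (rule continuous_on_compose2[OF contO]; auto simp: N_def intro!: continuous_intros)
            (auto simp: N_def)
        have *: "g \<in> V p' \<and> \<Phi> (g, p') = u (g - g0, \<Phi> (g0, p'))" if g: "g \<in> ball g0 \<epsilon>" and p': "p' \<in> N" for g p'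
        proof -
          have b: "\<Phi> (g0, p') \<in> B" using k(2) p' by blast
          have "g - g0 \<in> ball 0 \<epsilon>" using g by (simp add: dist_norm norm_minus_commute)
          then show ?thesis
            using shift[of p' g0 "ball 0 \<epsilon>" "\<lambda>h. u (h, \<Phi> (g0, p'))" "g - g0"] NM NV[OF p'] p' us[OF b] u0[OF b] \<epsilon>
            by (auto simp: \<Phi>_def)
        qed
        have "regular_on \<Phi> (ball g0 \<epsilon> \<times> N)"
        proof (rule regular_on_box[OF c1 u N NM k])
          show "\<exists>D. ((\<lambda>z. snd c1 (\<Phi> (g0, chart_inv c z))) has_derivative D) (at (snd c p')) \<and>
              (\<forall>a v. D (a *s v) = a *s D v)" if p': "p' \<in> N" and c: "c \<in> A" "p' \<in> fst c" for p' c
          proof -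
            have "(g0, p') \<in> O'" "\<Phi> (g0, p') \<in> fst c1" using p' c1(2) by (auto simp: N_def)
            then obtain D where D: "((\<lambda>(h, z). snd c1 (\<Phi> (h, chart_inv c z))) has_derivative D) (at (g0, snd c p'))"
              "\<And>a u v. D (a *s u, a *s v) = a *s D (u, v)"
              using holO c c1(1) unfolding holo_at_def by blast
            have "((\<lambda>z. (g0, z)) has_derivative (\<lambda>v. (0, v))) (at (snd c p'))"
              by (auto intro!: derivative_eq_intros)
            from has_derivative_compose[OF this D(1)]
            have "((\<lambda>z. snd c1 (\<Phi> (g0, chart_inv c z))) has_derivative (\<lambda>v. D (0, v))) (at (snd c p'))"
              by simp
            moreover have "D (0, a *s v) = a *s D (0, v)" for a v using D(2)[of a 0 v] by simp
            ultimately show ?thesis by blast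
          qed
        qed (use * in blast)
        moreover have "ball g0 \<epsilon> \<times> N \<subseteq> \<Omega>" using * NM by (auto simp: \<Omega>_def)
        moreover have "(g, p) \<in> ball g0 \<epsilon> \<times> N"
        proof -
          have "dist g0 g \<le> dist a g0 + dist a g" by (rule dist_triangle3)
          also have "\<dots> < \<epsilon>" using g0 g \<eta>(3) by simp
          finally have "g \<in> ball g0 \<epsilon>" by simp
          moreover have "g0 \<in> ball a \<eta>0" using g0 \<eta>(2) by simp
          then have "\<phi> p g0 \<in> B" using \<eta>0(2) by blast
          then have "p \<in> N" using O'(1) by (simp add: N_def \<Phi>_def)
          ultimately show ?thesis by blast
        qed
        ultimately show ?thesis unfolding H_def by (intro exI[of _ "ball g0 \<epsilon> \<times> N"] conjI)
      qed
      then show ?thesis using \<eta>(1) by blast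
    qed
    have "H g"
    proof (rule connected_induction_simple[of "V p" 0 g H])
      show "\<exists>T. openin (top_of_set (V p)) T \<and> a \<in> T \<and> (\<forall>x\<in>T. \<forall>y\<in>T. H x \<longrightarrow> H y)" if a: "a \<in> V p" for a
      proof -
        obtain \<eta> where "0 < \<eta>" "\<forall>g0\<in>ball a \<eta> \<inter> V p. H g0 \<longrightarrow> (\<forall>g\<in>ball a \<eta>. H g)"
          using step[OF a] by blast
        then show ?thesis
          using a by (intro exI[of _ "V p \<inter> ball a \<eta>"] conjI openin_open_Int) auto
      qed
    qed (use Vp g \<open>H 0\<close> in auto)
    then show ?thesis unfolding H_def .
  qed
  have "local_action A \<Omega> \<Phi>"
    unfolding local_action_def
  proof (intro conjI)
    show op: "open \<Omega>"
    proof (rule topological_space_class.openI)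
      fix x assume "x \<in> \<Omega>"
      then obtain O' where "x \<in> O'" "O' \<subseteq> \<Omega>" "regular_on \<Phi> O'" using reach by (metis surj_pair)
      then show "\<exists>T. open T \<and> x \<in> T \<and> T \<subseteq> \<Omega>" by (intro exI[of _ O']) (simp add: regular_on_def)
    qed
    show "connected \<Omega>"
    proof -
      have "\<Omega> = (\<Union>p\<in>points A. V p \<times> {p} \<union> {0} \<times> points A)"
        using V by (auto simp: \<Omega>_def)
      moreover have "connected (\<Union>p\<in>points A. V p \<times> {p} \<union> {0} \<times> points A)"
      proof (cases "points A = {}")
        case False
        then obtain q where q: "q \<in> points A" by blast
        show ?thesis
        proof (rule connected_Union)
          show "connected S" if "S \<in> (\<lambda>p. V p \<times> {p} \<union> {0} \<times> points A) ` points A" for S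
            using that V conn by (auto intro!: connected_Un connected_Times)
          show "\<Inter> ((\<lambda>p. V p \<times> {p} \<union> {0} \<times> points A) ` points A) \<noteq> {}"
            using q by (auto intro!: exI[of _ "(0, q)"] simp: ex_in_conv[symmetric] simp del: ex_in_conv)
        qed
      qed simp
      ultimately show ?thesis by simp
    qed
    show "{0} \<times> points A \<subseteq> \<Omega>" using V by (auto simp: \<Omega>_def)
    show "\<Omega> \<subseteq> UNIV \<times> points A" by (auto simp: \<Omega>_def)
    show "\<Phi> ` \<Omega> \<subseteq> points A" using V sol_points by (force simp: \<Omega>_def \<Phi>_def)
    show "continuous_on \<Omega> \<Phi>"
    proof (intro continuous_at_imp_continuous_on ballI, clarify)
      fix g p assume "(g, p) \<in> \<Omega>"
      then obtain O' where "(g, p) \<in> O'" "regular_on \<Phi> O'" using reach by blast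
      then show "isCont \<Phi> (g, p)"
        unfolding regular_on_def using continuous_on_eq_continuous_at by blast
    qed
    show "\<forall>g p. (g, p) \<in> \<Omega> \<longrightarrow> (\<forall>c\<in>A. \<forall>d\<in>A. p \<in> fst c \<and> \<Phi> (g, p) \<in> fst d \<longrightarrow>
       (\<exists>D. ((\<lambda>(h, z). snd d (\<Phi> (h, chart_inv c z))) has_derivative D) (at (g, snd c p)) \<and>
            (\<forall>a u v. D (a *s u, a *s v) = a *s D (u, v))))"
      using reach unfolding regular_on_def holo_at_def by blast
    show "\<forall>p\<in>points A. \<Phi> (0, p) = p" using V by (simp add: \<Phi>_def)
    show "\<forall>g h p. (g + h, p) \<in> \<Omega> \<and> (h, p) \<in> \<Omega> \<and> (g, \<Phi> (h, p)) \<in> \<Omega> \<longrightarrow>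
       \<Phi> (g + h, p) = \<Phi> (g, \<Phi> (h, p))"
    proof (intro allI impI, elim conjE)
      fix g h p assume "(h, p) \<in> \<Omega>" "(g, \<Phi> (h, p)) \<in> \<Omega>"
      then have h: "p \<in> points A" "h \<in> V p" and q: "\<phi> p h \<in> points A" "g \<in> V (\<phi> p h)"
        by (auto simp: \<Omega>_def \<Phi>_def)
      have "\<phi> p (g + h) = \<phi> (\<phi> p h) g"
        using shift[OF h, of "V (\<phi> p h)" "\<phi> (\<phi> p h)" g] V[OF q(1)] q(2) by blast
      then show "\<Phi> (g + h, p) = \<Phi> (g, \<Phi> (h, p))" by (simp add: \<Phi>_def)
    qed
  qed
  moreover have "\<forall>p\<in>points A. \<forall>g a. (\<forall>i. (g i, p) \<in> \<Omega>) \<and> g \<longlonglongrightarrow> a \<and>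
      a \<in> frontier {h. (h, p) \<in> \<Omega>} \<longrightarrow> leaves_compacts A (\<lambda>i. \<Phi> (g i, p))"
  proof
    fix p assume p: "p \<in> points A"
    have "{h. (h, p) \<in> \<Omega>} = V p" using p by (simp add: \<Omega>_def)
    moreover have "escapes A (V p) (\<phi> p)" using V[OF p] by blast
    ultimately show "\<forall>g a. (\<forall>i. (g i, p) \<in> \<Omega>) \<and> g \<longlonglongrightarrow> a \<and>
      a \<in> frontier {h. (h, p) \<in> \<Omega>} \<longrightarrow> leaves_compacts A (\<lambda>i. \<Phi> (g i, p))"
      unfolding escapes_def by (auto simp: \<Omega>_def \<Phi>_def)
  qed
  moreover have "integrates_to A X Y \<Phi>"
    unfolding integrates_to_def
  proof (intro ballI impI)
    fix p c assume p: "p \<in> points A" and c: "c \<in> A" "p \<in> fst c"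
    from sol_derivative[of "\<lambda>h. h" "V p" "\<phi> p" 0 c] V[OF p] c
    show "((\<lambda>g. snd c (\<Phi> (g, p))) has_derivative (\<lambda>v. v $ 1 *s X c p + v $ 2 *s Y c p)) (at 0)"
      by (simp add: \<Phi>_def span_field_def)
  qed
  ultimately show ?thesis unfolding univalent_def maximal_local_action_def by blast
qed

end

section \<open>The two parts of the theorem\<close>

lemma integral_curve_iff_integral_map:
  "integral_curve A Z V \<phi> \<longleftrightarrow> connected V \<and> integral_map A (\<lambda>h c p. h *s Z c p) V \<phi>"
  by (auto simp: integral_curve_def integral_map_def)

lemma real_integral_curve_iff_integral_map:
  "real_integral_curve A Z I \<gamma> \<longleftrightarrow> integral_map A (\<lambda>t c p. t *\<^sub>R Z c p) I \<gamma>"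
  by (simp add: real_integral_curve_def integral_map_def has_vector_derivative_def)

text \<open>
  In the chosen representation a holomorphic field and its real part have the same
  coordinates; they differ only in the times for which they are followed.
\<close>

lemma real_part_eq:
  fixes A :: "('m::{t2_space, second_countable_topology}, 'n::finite) chart set"
  assumes "real_part_of A Z X" "c \<in> A" "p \<in> fst c"
  shows "X c p = Z c p"
proof -
  have "p \<in> points A" using assms by (auto simp: points_def)
  then obtain V \<phi> where V: "0 \<in> V" "\<phi> 0 = p" "integral_curve A Z V \<phi>"
    and re: "real_integral_curve A X {t. of_real t * 1 \<in> V} (\<lambda>t. \<phi> (of_real t * 1))"
    using assms(1) unfolding real_part_of_def induced_by_flow_def by blast
  have "((\<lambda>s. snd c (\<phi> s)) has_derivative (\<lambda>h. h *s Z c p)) (at (of_real 0))"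
    using V assms unfolding integral_curve_def by fastforce
  from has_derivative_compose[OF bounded_linear.has_derivative[OF bounded_linear_of_real has_derivative_ident] this]
  have "((\<lambda>t. snd c (\<phi> (of_real t))) has_derivative (\<lambda>t. of_real t *s Z c p)) (at 0)" .
  moreover have "((\<lambda>t. snd c (\<phi> (of_real t))) has_derivative (\<lambda>t. t *\<^sub>R X c p)) (at 0)"
  proof -
    have "\<forall>t\<in>{t. of_real t * 1 \<in> V}. \<forall>c\<in>A. \<phi> (of_real t * 1) \<in> fst c \<longrightarrow>
       ((\<lambda>s. snd c (\<phi> (of_real s * 1))) has_vector_derivative X c (\<phi> (of_real t * 1))) (at t)"
      using re unfolding real_integral_curve_def by blast
    from bspec[OF bspec[OF this, of 0] assms(2)] show ?thesis
      using V assms(3) by (simp add: has_vector_derivative_def)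
  qed
  ultimately have "(\<lambda>t. of_real t *s Z c p) = (\<lambda>t. t *\<^sub>R X c p)" by (rule has_derivative_unique)
  from fun_cong[OF this, of 1] show ?thesis by simp
qed

lemma bounded_linear_smult_vector:
  "bounded_linear f \<Longrightarrow> bounded_linear (\<lambda>s. f s *s (v :: complex ^ 'n::finite))"
  by (rule bounded_linear_compose[OF bounded_bilinear.bounded_linear_left[OF bounded_bilinear_vector_smult]])

context commuting_pair
begin

lemma span_field_axis:
  "span_field X Y (\<lambda>s. f s *s axis 1 1) = (\<lambda>h c p. f h *s X c p)"
  "span_field X Y (\<lambda>s. f s *s axis 2 1) = (\<lambda>h c p. f h *s Y c p)"
  by (auto simp: span_field_def fun_eq_iff axis_def)

lemma univalent_of_complete_semicomplete:
  assumes conn: "connected (points A)" and cX: "complex_complete A X" and sY: "semicomplete A Y"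
  shows "univalent A X Y"
proof -
  define L1 :: "complex \<Rightarrow> complex ^ 2" where "L1 s = s *s axis 1 1" for s
  define L2 :: "complex \<Rightarrow> complex ^ 2" where "L2 s = s *s axis 2 1" for s
  have L1: "bounded_linear L1" and L2: "bounded_linear L2"
    unfolding L1_def L2_def by (intro bounded_linear_smult_vector bounded_linear_ident)+
  have f1: "span_field X Y L1 = (\<lambda>h c p. h *s X c p)" and f2: "span_field X Y L2 = (\<lambda>h c p. h *s Y c p)"
    unfolding L1_def L2_def by (rule span_field_axis)+
  have "\<forall>p\<in>points A. \<exists>\<phi>. sol L1 UNIV \<phi> \<and> \<phi> 0 = p"
    using cX unfolding complex_complete_def integral_curve_iff_integral_map f1 by blast
  then obtain x where x: "\<And>p. p \<in> points A \<Longrightarrow> sol L1 UNIV (x p) \<and> x p 0 = p" by metis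
  have "\<forall>p\<in>points A. \<exists>V \<phi>. 0 \<in> V \<and> \<phi> 0 = p \<and> connected V \<and> sol L2 V \<phi> \<and> escapes A V \<phi>"
    using sY unfolding semicomplete_def integral_curve_iff_integral_map f2 escapes_def by blast
  then obtain V \<psi> where V: "\<And>p. p \<in> points A \<Longrightarrow>
      0 \<in> V p \<and> \<psi> p 0 = p \<and> connected (V p) \<and> sol L2 (V p) (\<psi> p) \<and> escapes A (V p) (\<psi> p)" by metis
  define K :: "complex ^ 2 \<Rightarrow> complex \<times> complex" where "K g = (g $ 1, g $ 2)" for g
  have K: "bounded_linear K" unfolding K_def
    by (intro bounded_linear_Pair bounded_linear_vec_nth)
  have LK: "(\<lambda>(s, t). L1 s + L2 t) (K g) = g" for g
    by (simp add: K_def L1_def L2_def vec_eq_iff forall_2 axis_def)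
  define W where "W p = K -` (UNIV \<times> V p)" for p
  define \<phi> where "\<phi> p g = (\<lambda>(s, t). x (\<psi> p t) s) (K g)" for p g
  show ?thesis
  proof (rule univalent_of_maximal_solutions[OF conn, of W \<phi>])
    fix p assume p: "p \<in> points A"
    note Vp = V[OF p]
    then have s: "sol L2 (V p) (\<psi> p)" and e: "escapes A (V p) (\<psi> p)" by auto
    have "0 \<in> W p" "\<phi> p 0 = p" using Vp x[OF p] by (auto simp: W_def \<phi>_def K_def)
    moreover have "connected (W p)"
    proof -
      have "W p = (\<lambda>q. L1 (fst q) + L2 (snd q)) ` (UNIV \<times> V p)"
      proof
        show "W p \<subseteq> (\<lambda>q. L1 (fst q) + L2 (snd q)) ` (UNIV \<times> V p)"
        proof
          fix g assume "g \<in> W p"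
          moreover have "g = L1 (fst (K g)) + L2 (snd (K g))" using LK[of g] by (simp add: split_def)
          ultimately show "g \<in> (\<lambda>q. L1 (fst q) + L2 (snd q)) ` (UNIV \<times> V p)"
            unfolding W_def by (intro image_eqI[of g _ "K g"]) simp_all
        qed
        show "(\<lambda>q. L1 (fst q) + L2 (snd q)) ` (UNIV \<times> V p) \<subseteq> W p"
          by (auto simp: W_def K_def L1_def L2_def axis_def)
      qed
      moreover have "connected ((\<lambda>q. L1 (fst q) + L2 (snd q)) ` (UNIV \<times> V p))"
        using Vp by (intro connected_continuous_image connected_Times connected_UNIV continuous_intros
            bounded_linear.continuous_on[OF L1] bounded_linear.continuous_on[OF L2]) auto
      ultimately show ?thesis by simp
    qed
    moreover have "sol (\<lambda>h. h) (W p) (\<phi> p)"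
      using sol_affine[OF product_sol[OF L1 L2 x s] K LK, of 0] by (simp add: W_def \<phi>_def[abs_def])
    moreover have "escapes A (W p) (\<phi> p)"
      unfolding W_def \<phi>_def
    proof (rule escapes_vimage[OF product_escapes[OF L1 L2 x s e]])
      show "open ((UNIV :: complex set) \<times> V p)" by (intro open_Times open_UNIV sol_open[OF s])
      show "continuous_on UNIV K" by (intro bounded_linear.continuous_on[OF K] continuous_on_id)
    qed
    ultimately show "0 \<in> W p \<and> \<phi> p 0 = p \<and> connected (W p) \<and> sol (\<lambda>h. h) (W p) (\<phi> p) \<and> escapes A (W p) (\<phi> p)"
      by blast
  qed
qed

text \<open>
  The domain of the integral curve is the strip of times whose imaginary part lies in the
  maximal interval of the curve in imaginary time.
\<close>

lemma semicomplete_of_real_complete: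
  assumes rc: "\<And>p. p \<in> points A \<Longrightarrow> \<exists>\<gamma>. integral_map A (\<lambda>t c p. of_real t *s X c p) UNIV \<gamma> \<and> \<gamma> (0::real) = p"
  shows "semicomplete A X"
proof -
  define L1 :: "real \<Rightarrow> complex ^ 2" where "L1 s = of_real s *s axis 1 1" for s
  define L2 :: "real \<Rightarrow> complex ^ 2" where "L2 t = (\<i> * of_real t) *s axis 1 1" for t
  have L1: "bounded_linear L1" unfolding L1_def
    by (intro bounded_linear_smult_vector bounded_linear_of_real)
  have L2: "bounded_linear L2" unfolding L2_def
    by (intro bounded_linear_smult_vector bounded_linear_mult_right bounded_linear_compose[OF bounded_linear_mult_right bounded_linear_of_real])
  have f1: "span_field X Y L1 = (\<lambda>h c p. of_real h *s X c p)"
    unfolding L1_def by (rule span_field_axis)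
  obtain x where x: "\<And>p. p \<in> points A \<Longrightarrow> sol L1 UNIV (x p) \<and> x p 0 = p"
    using rc unfolding f1 by metis
  define K :: "complex \<Rightarrow> real \<times> real" where "K z = (Re z, Im z)" for z
  have K: "bounded_linear K" unfolding K_def
    by (intro bounded_linear_Pair bounded_linear_Re bounded_linear_Im)
  have LK: "(\<lambda>(s, t). L1 s + L2 t) (K z) = z *s axis 1 1" for z
    by (simp only: K_def L1_def L2_def split vector_smult_add_left[symmetric] complex_eq[symmetric])
  have f: "span_field X Y (\<lambda>z. z *s axis 1 1) = (\<lambda>h c p. h *s X c p)" by (rule span_field_axis)
  show ?thesis
    unfolding semicomplete_def integral_curve_iff_integral_map
  proof
    fix p assume p: "p \<in> points A"
    obtain J \<gamma> where J: "0 \<in> J" "\<gamma> 0 = p" "connected J" and s: "sol L2 J \<gamma>" and e: "escapes A J \<gamma>"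
      by (rule maximal_real_sol[OF L2 p])
    define W where "W = K -` (UNIV \<times> J)"
    define \<phi> where "\<phi> z = (\<lambda>(s, t). x (\<gamma> t) s) (K z)" for z
    have "0 \<in> W" "\<phi> 0 = p" using J x[OF p] by (auto simp: W_def \<phi>_def K_def)
    moreover have "connected W"
    proof -
      have "W = (\<lambda>q. Complex (fst q) (snd q)) ` (UNIV \<times> J)"
        by (force simp: W_def K_def image_iff complex_eq_iff)
      moreover have "connected ((\<lambda>q. Complex (fst q) (snd q)) ` (UNIV \<times> J))"
        using J by (intro connected_continuous_image connected_Times connected_UNIV continuous_intros)
      ultimately show ?thesis by simp
    qed
    moreover have "integral_map A (\<lambda>h c p. h *s X c p) W \<phi>"
      using sol_affine[OF product_sol[OF L1 L2 x s] K LK, of 0] by (simp add: W_def \<phi>_def[abs_def] f)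
    moreover have "escapes A W \<phi>"
      unfolding W_def \<phi>_def
    proof (rule escapes_vimage[OF product_escapes[OF L1 L2 x s e]])
      show "open ((UNIV :: real set) \<times> J)" by (intro open_Times open_UNIV sol_open[OF s])
      show "continuous_on UNIV K" by (intro bounded_linear.continuous_on[OF K] continuous_on_id)
    qed
    ultimately show "\<exists>V \<phi>. 0 \<in> V \<and> \<phi> 0 = p \<and> (connected V \<and> integral_map A (\<lambda>h c p. h *s X c p) V \<phi>) \<and>
        (\<forall>T a. (\<forall>i. T i \<in> V) \<and> T \<longlonglongrightarrow> a \<and> a \<in> frontier V \<longrightarrow> leaves_compacts A (\<lambda>i. \<phi> (T i)))"
      unfolding escapes_def by blast
  qed
qed

end

lemma commuting_pair_zero:
  fixes A :: "('m::{t2_space, second_countable_topology}, 'n::finite) chart set"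
  assumes M: "complex_manifold A" and Z: "holomorphic_vector_field A Z"
  shows "commuting_pair A Z (\<lambda>c p. 0)"
proof
  have 0: "frechet_derivative f (at z) 0 = 0" if "vec.holo S f" "z \<in> S"
    for f :: "complex ^ 'n \<Rightarrow> complex ^ 'n" and S z
    using linear_simps(3)[OF has_derivative_bounded_linear[OF vec.holo_frechet(1)[OF that]]] .
  have lr: "local_rep (\<lambda>c p. 0) c = (\<lambda>z. 0)" for c :: "('m, 'n) chart"
    by (simp add: local_rep_def fun_eq_iff)
  show "holomorphic_vector_field A (\<lambda>c p. 0)"
    unfolding holomorphic_vector_field_def tangent_field_def
  proof (intro conjI ballI)
    fix c d p assume c: "c \<in> A" and d: "d \<in> A" and p: "p \<in> fst c \<inter> fst d"
    have "vec.holo (snd c ` (fst c \<inter> fst d)) (snd d \<circ> chart_inv c)"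
      using M c d by (simp add: complex_manifold_def holomorphic_map_on_iff_holo)
    from 0[OF this] p
    show "0 = frechet_derivative (snd d \<circ> chart_inv c) (at (snd c p)) 0" by simp
  next
    fix c assume "c \<in> A"
    then show "holomorphic_map_on (snd c ` fst c) (local_rep (\<lambda>c p. 0) c)"
      using M by (simp add: lr holomorphic_map_on_iff_holo vec.holo_const complex_manifold_def)
  qed
  show "commuting A Z (\<lambda>c p. 0)"
    unfolding commuting_def lie_bracket_def lr
  proof (intro ballI)
    fix c p assume c: "c \<in> A" "p \<in> fst c"
    then have "frechet_derivative (local_rep Z c) (at (snd c p)) 0 = 0"
      using Z by (intro 0[of "snd c ` fst c"])
        (auto simp: holomorphic_vector_field_def holomorphic_map_on_iff_holo)
    then show "frechet_derivative (\<lambda>z. 0) (at (snd c p)) (Z c p) -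
        frechet_derivative (local_rep Z c) (at (snd c p)) 0 = 0" by simp
  qed
qed (rule M Z)+

theorem corollaryC:
  fixes A :: "('m::{t2_space, second_countable_topology}, 'n::finite) chart set"
    and X Y :: "('m, 'n) vfield"
  assumes "complex_manifold A"
    and "commuting A X Y"
  shows "(connected (points A) \<and>
          holomorphic_vector_field A X \<and> holomorphic_vector_field A Y \<and>
          complex_complete A X \<and> semicomplete A Y
            \<longrightarrow> univalent A X Y)
       \<and> (\<forall>Z. holomorphic_vector_field A Z \<and>
              real_part_of A Z X \<and> imaginary_part_of A Z Y \<and>
              real_complete A X
            \<longrightarrow> semicomplete A Z)"
proof (intro conjI impI allI; elim conjE)
  assume "connected (points A)" "holomorphic_vector_field A X" "holomorphic_vector_field A Y"
    "complex_complete A X" "semicomplete A Y"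
  moreover from this have "commuting_pair A X Y" using assms by (simp add: commuting_pair_def)
  ultimately show "univalent A X Y" by (simp add: commuting_pair.univalent_of_complete_semicomplete)
next
  fix Z assume Z: "holomorphic_vector_field A Z" and re: "real_part_of A Z X"
    and rc: "real_complete A X"
  interpret commuting_pair A Z "\<lambda>c p. 0" by (rule commuting_pair_zero[OF assms(1) Z])
  show "semicomplete A Z"
  proof (rule semicomplete_of_real_complete)
    fix p assume "p \<in> points A"
    then obtain \<gamma> where \<gamma>: "integral_map A (\<lambda>t c p. t *\<^sub>R X c p) UNIV \<gamma>" "\<gamma> 0 = p"
      using rc unfolding real_complete_def real_integral_curve_iff_integral_map by blast
    have "integral_map A (\<lambda>t c p. of_real t *s Z c p) UNIV \<gamma>"
      using \<gamma>(1) unfolding integral_map_def by (auto simp: real_part_eq[OF re] of_real_vector_smult)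
    with \<gamma>(2) show "\<exists>\<gamma>. integral_map A (\<lambda>t c p. of_real t *s Z c p) UNIV \<gamma> \<and> \<gamma> (0::real) = p" by blast
  qed
qed

end
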